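(* Let $p$ be a prime. An element $v\in\mathrm{Val}_p(\mathbb Q^{\rm cyc})$ is entirely characterized by a sequence of polynomials $P_n(T)\in\mathbb F_p[T]$, $P_n$ of degree $n$ for each $n\ge1$, such that: $\bullet$ each $P_n(T)$ is monic and irreducible; $\bullet$ $T\in\mathbb F_p[T]/(P_n(T))$ is a generator of the multiplicative group of the quotient field; $\bullet$ for any integer $m|n$ and for $d=(p^n-1)/(p^m-1)$, $P_m(T^d)$ is a multiple of $P_n(T)$. That is, the map which associates to $v$ the sequence $(P_n)_{n\ge1}$ of characteristic polynomials of the action by multiplication of (the residue class of) the primitive root $\zeta_{1/(p^n-1)}$ on the subfield with $p^n$ elements of the residue field of the restriction of $v$ to $\mathbb Q^{{\rm cyc},p}$ is a bijection between $\mathrm{Val}_p(\mathbb Q^{\rm cyc})$ and the set of sequences fulfilling these three conditions.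
   Context: $\mathbb Q^{\rm cyc}$ is the abstract cyclotomic field: the quotient of the group ring $\mathbb Q[\mathbb Q/\mathbb Z]$ (generators $e(\gamma)$) by the ideal $J$ generated by the idempotents $\frac1n\sum_{j=0}^{n-1}e(\frac jn)$, $n\ge2$; it is isomorphic to the subfield of $\mathbb C$ generated by all roots of unity. $\zeta_\gamma$ denotes the class of $e(\gamma)$. $\mathbb Q^{{\rm cyc},p}\subset\mathbb Q^{\rm cyc}$ is the subfield generated by the roots of unity of order prime to $p$. $\mathrm{Val}_p(\mathbb Q^{\rm cyc})$ is the set of extensions of the $p$-adic valuation of $\mathbb Q$ to $\mathbb Q^{\rm cyc}$. The residue field of the restriction of $v$ to $\mathbb Q^{{\rm cyc},p}$ is an algebraic closure of $\mathbb F_p$. *)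

theory Defs
  imports
    "HOL-Library.Poly_Mapping"
    "HOL-Library.Extended_Real"
    "HOL-Algebra.Algebra"
    "HOL-Algebra.Algebraic_Closure_Type"
    "Berlekamp_Zassenhaus.Finite_Field"
    "Jordan_Normal_Form.Char_Poly"
begin

section \<open>The abstract cyclotomic field\<close>

quotient_type rat_mod_int = rat / "\<lambda>x y. x - y \<in> \<int>"
proof (rule equivpI)
  show "reflp (\<lambda>x y :: rat. x - y \<in> \<int>)"
    by (simp add: reflp_def)
  show "symp (\<lambda>x y :: rat. x - y \<in> \<int>)"
    by (metis (mono_tags, lifting) Ints_minus minus_diff_eq sympI)
  show "transp (\<lambda>x y :: rat. x - y \<in> \<int>)"
  proof (rule transpI)
    fix x y z :: rat
    assume "x - y \<in> \<int>" "y - z \<in> \<int>"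
    then have "(x - y) + (y - z) \<in> \<int>" by (rule Ints_add)
    then show "x - z \<in> \<int>" by simp
  qed
qed

instantiation rat_mod_int :: ab_group_add
begin

lift_definition zero_rat_mod_int :: rat_mod_int is 0 .

lift_definition plus_rat_mod_int :: "rat_mod_int \<Rightarrow> rat_mod_int \<Rightarrow> rat_mod_int" is "(+)"
  by (metis Ints_add add_diff_add)

lift_definition uminus_rat_mod_int :: "rat_mod_int \<Rightarrow> rat_mod_int" is uminus
  by (metis Ints_minus minus_diff_minus)

lift_definition minus_rat_mod_int :: "rat_mod_int \<Rightarrow> rat_mod_int \<Rightarrow> rat_mod_int" is "(-)"
  by (metis Ints_diff diff_diff_add diff_diff_eq2 diff_add_eq add.commute)

instance
  by standard (transfer; simp)+

end

text \<open>
  The multiplication of \<^typ>\<open>rat_mod_int \<Rightarrow>\<^sub>0 rat\<close> is convolution, so this type is the group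
  ring of \<open>\<rat>/\<int>\<close> over \<open>\<rat>\<close>; \<open>single \<gamma> 1\<close> is the generator \<open>e(\<gamma>)\<close> and \<open>single 0 q\<close> is
  the image of the scalar \<open>q\<close>.
\<close>

abbreviation group_ring :: "(rat_mod_int \<Rightarrow>\<^sub>0 rat) ring"
  where "group_ring \<equiv> ring_of_type_algebra"

definition cyc_idempotent :: "nat \<Rightarrow> rat_mod_int \<Rightarrow>\<^sub>0 rat"
  where "cyc_idempotent n =
    Poly_Mapping.single 0 (1 / of_nat n) *
    (\<Sum>j<n. Poly_Mapping.single (abs_rat_mod_int (of_nat j / of_nat n)) 1)"

definition cyc_ideal :: "(rat_mod_int \<Rightarrow>\<^sub>0 rat) set"
  where "cyc_ideal = Idl\<^bsub>group_ring\<^esub> {cyc_idempotent n | n. 2 \<le> n}"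

type_synonym qcyc = "(rat_mod_int \<Rightarrow>\<^sub>0 rat) set"

definition Qcyc :: "qcyc ring"
  where "Qcyc = group_ring Quot cyc_ideal"

definition zeta :: "rat \<Rightarrow> qcyc"
  where "zeta q = cyc_ideal +>\<^bsub>group_ring\<^esub> Poly_Mapping.single (abs_rat_mod_int q) 1"

definition Qcyc_of_rat :: "rat \<Rightarrow> qcyc"
  where "Qcyc_of_rat q = cyc_ideal +>\<^bsub>group_ring\<^esub> Poly_Mapping.single 0 q"

definition Qcyc_prime_to :: "nat \<Rightarrow> qcyc ring"
  where "Qcyc_prime_to p = Qcyc\<lparr>carrier := generate_field Qcyc
    {x \<in> carrier Qcyc. \<exists>n>0. coprime n p \<and> x [^]\<^bsub>Qcyc\<^esub> n = \<one>\<^bsub>Qcyc\<^esub>}\<rparr>"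


section \<open>Valuations and residue fields\<close>

definition padic_valuation :: "nat \<Rightarrow> rat \<Rightarrow> ereal"
  where "padic_valuation p q =
    (if q = 0 then \<infinity>
     else ereal (real (multiplicity (int p) (fst (quotient_of q)))
               - real (multiplicity (int p) (snd (quotient_of q)))))"

text \<open>Additive valuations of rank one; the value \<open>-\<infinity>\<close> of \<^typ>\<open>ereal\<close> is never taken.\<close>

definition valuation_on :: "('a, 'b) ring_scheme \<Rightarrow> ('a \<Rightarrow> ereal) \<Rightarrow> bool"
  where "valuation_on K v \<longleftrightarrow>
    (\<forall>x\<in>carrier K. v x \<noteq> -\<infinity>) \<and>
    (\<forall>x\<in>carrier K. v x = \<infinity> \<longleftrightarrow> x = \<zero>\<^bsub>K\<^esub>) \<and>
    (\<forall>x\<in>carrier K. \<forall>y\<in>carrier K. v (x \<otimes>\<^bsub>K\<^esub> y) = v x + v y) \<and>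
    (\<forall>x\<in>carrier K. \<forall>y\<in>carrier K. min (v x) (v y) \<le> v (x \<oplus>\<^bsub>K\<^esub> y))"

text \<open>
  Since \<open>\<rat>\<^bsup>cyc\<^esup>\<close> is algebraic over \<open>\<rat>\<close>, an extension of the \<open>p\<close>-adic valuation takes its values in
  the divisible hull \<open>\<rat>\<close> of the value group \<open>\<int>\<close>, so real values suffice. Extensionality makes
  valuations that agree on \<open>\<rat>\<^bsup>cyc\<^esup>\<close> equal as functions.
\<close>

definition Val :: "nat \<Rightarrow> (qcyc \<Rightarrow> ereal) set"
  where "Val p = {v \<in> extensional (carrier Qcyc).
    valuation_on Qcyc v \<and> (\<forall>q. v (Qcyc_of_rat q) = padic_valuation p q)}"

text \<open>
  The following notions depend on \<open>v\<close> only through its restriction to \<open>carrier K\<close>.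
\<close>

definition valuation_ring :: "'a ring \<Rightarrow> ('a \<Rightarrow> ereal) \<Rightarrow> 'a ring"
  where "valuation_ring K v = K\<lparr>carrier := {x \<in> carrier K. 0 \<le> v x}\<rparr>"

definition valuation_ideal :: "'a ring \<Rightarrow> ('a \<Rightarrow> ereal) \<Rightarrow> 'a set"
  where "valuation_ideal K v = {x \<in> carrier K. 0 < v x}"

definition residue_field :: "'a ring \<Rightarrow> ('a \<Rightarrow> ereal) \<Rightarrow> 'a set ring"
  where "residue_field K v = valuation_ring K v Quot valuation_ideal K v"

definition residue_class :: "'a ring \<Rightarrow> ('a \<Rightarrow> ereal) \<Rightarrow> 'a \<Rightarrow> 'a set"
  where "residue_class K v x = valuation_ideal K v +>\<^bsub>valuation_ring K v\<^esub> x"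


section \<open>Characteristic polynomials of multiplications\<close>

text \<open>
  \<^typ>\<open>'p mod_ring\<close> with \<open>'p :: prime_card\<close> is the field with \<open>p = CARD('p)\<close> elements; in a ring of
  characteristic \<open>p\<close> the next function is its embedding as the prime field.
\<close>

definition of_prime_field :: "('a, 'b) ring_scheme \<Rightarrow> 'p::prime_card mod_ring \<Rightarrow> 'a"
  where "of_prime_field k c = [to_int_mod_ring c] \<cdot>\<^bsub>k\<^esub> \<one>\<^bsub>k\<^esub>"

text \<open>
  \<open>E\<close> is a finite-dimensional subspace of \<open>k\<close> over the prime field, stable under multiplication
  by \<open>a\<close>. The matrix \<open>A\<close> of this multiplication in the basis \<open>bs\<close> has the coordinates of the
  image of the \<open>j\<close>-th basis vector as its \<open>j\<close>-th column.
\<close>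

definition mult_char_poly ::
    "('a, 'b) ring_scheme \<Rightarrow> 'a set \<Rightarrow> 'a \<Rightarrow> 'p::prime_card mod_ring poly"
  where "mult_char_poly k E a = (THE P. \<exists>bs (A :: 'p mod_ring mat).
    ring.independent k (range (of_prime_field k :: 'p mod_ring \<Rightarrow> 'a)) bs \<and>
    ring.Span k (range (of_prime_field k :: 'p mod_ring \<Rightarrow> 'a)) bs = E \<and>
    A \<in> carrier_mat (length bs) (length bs) \<and>
    (\<forall>j<length bs. a \<otimes>\<^bsub>k\<^esub> bs ! j =
       ring.combine k (map (\<lambda>i. of_prime_field k (A $$ (i, j))) [0..<length bs]) bs) \<and>
    P = char_poly A)"

definition subfield_of_card :: "('a, 'b) ring_scheme \<Rightarrow> nat \<Rightarrow> 'a set"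
  where "subfield_of_card k q = (THE E. subfield E k \<and> card E = q)"

definition char_poly_seq :: "nat \<Rightarrow> (qcyc \<Rightarrow> ereal) \<Rightarrow> nat \<Rightarrow> 'p::prime_card mod_ring poly"
  where "char_poly_seq p v = (\<lambda>n\<in>{1..}.
    mult_char_poly (residue_field (Qcyc_prime_to p) v)
      (subfield_of_card (residue_field (Qcyc_prime_to p) v) (p ^ n))
      (residue_class (Qcyc_prime_to p) v (zeta (1 / (of_nat p ^ n - 1)))))"


section \<open>The sequences of polynomials\<close>

definition T_generates_mod :: "'p::prime_card mod_ring poly \<Rightarrow> bool"
  where "T_generates_mod P \<longleftrightarrow>
    (let R = ring_of_type_algebra; I = PIdl\<^bsub>R\<^esub> P; G = mult_of (R Quot I); T = I +>\<^bsub>R\<^esub> [:0, 1:]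
     in T \<in> carrier G \<and> generate G {T} = carrier G)"

definition primitive_poly_seqs :: "nat \<Rightarrow> (nat \<Rightarrow> 'p::prime_card mod_ring poly) set"
  where "primitive_poly_seqs p = {P \<in> extensional {1..}.
    (\<forall>n\<ge>1. degree (P n) = n \<and> monic (P n) \<and> Factorial_Ring.irreducible (P n) \<and>
            T_generates_mod (P n)) \<and>
    (\<forall>n\<ge>1. \<forall>m. m dvd n \<longrightarrow>
       P n dvd pcompose (P m) ([:0, 1:] ^ ((p ^ n - 1) div (p ^ m - 1))))}"

end

theory Submission
  imports Defs
begin

text \<open>
  Sending \<open>e(\<gamma>)\<close> to \<open>exp(2 \<pi> i \<gamma>)\<close> identifies the abstract cyclotomic field with the subfield of \<open>\<complex>\<close>
  generated by the roots of unity: that the kernel is not larger than the ideal \<open>J\<close> is the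
  irreducibility of the cyclotomic polynomials. Let \<open>\<zeta> = \<zeta>\<^bsub>1/(p^n-1)\<^esub>\<close>. The residue class of \<open>\<zeta>\<close>
  has exact order \<open>p ^ n - 1\<close>, so together with \<open>0\<close> its powers form the subfield with \<open>p ^ n\<close> elements, and
  by a Cayley-Hamilton argument its characteristic polynomial \<open>P\<^sub>n\<close> is its minimal polynomial. Thus
  \<open>P\<^sub>n\<close> encodes the kernel of the reduction \<open>\<int>[T] \<rightarrow> \<int>[\<zeta>] \<rightarrow> k\<^sub>v\<close>.

  Uniqueness: \<open>p\<close> generates the primes above it locally in \<open>\<int>[\<zeta>]\<close>, and adjoining \<open>p\<close>-power roots of
  unity \<open>\<eta>\<close> only makes \<open>\<eta> - 1\<close> a uniformizer, so the value of every element is forced by the kernels.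
  Existence: the kernels prescribed by a sequence \<open>(P\<^sub>n)\<close> form a proper ideal of the ring generated by
  all \<open>\<zeta>\<^bsub>1/(p^n-1)\<^esub>\<close>; a valuation ring dominating it gives a real-valued valuation, because
  the field is algebraic over \<open>\<rat>\<close>.
\<close>

section \<open>Conjugates of roots of unity\<close>

text \<open>Integer polynomials evaluated at a root of unity are the common language: one polynomial
  A can be read both in \<int>[\<zeta>] and modulo p, so no ring of integers and no factorization of
  p is constructed. Up to an integer denominator, every element of the field has the form A(z). The
  obstacle is well-definedness: A(\<zeta>) = 0 has to force \<open>P n\<close> to divide A modulo p.
  This is achieved without cyclotomic polynomials, by multiplying A with a polynomial that vanishes
  at the imprimitive N-th roots of unity; T^N - 1 then divides the product, and this single
  divisibility is evaluated once in the group ring and once modulo \<open>P n\<close>. The third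
  condition originates in the fact that the root of unity of level m is the d-th power of that of
  level n, for d = (p^n-1)/(p^m-1). Orders of the form p^n - 1 suffice because every integer prime
  to p divides one of them.\<close>

definition ipoly_at :: "'a::comm_ring_1 \<Rightarrow> int poly \<Rightarrow> 'a"
  where "ipoly_at x A = poly (of_int_poly A) x"

lemma ipoly_at_simps [simp]:
  "ipoly_at x 0 = 0" "ipoly_at x 1 = 1" "ipoly_at x (A + B) = ipoly_at x A + ipoly_at x B"
  "ipoly_at x (A - B) = ipoly_at x A - ipoly_at x B" "ipoly_at x (- A) = - ipoly_at x A"
  "ipoly_at x (A * B) = ipoly_at x A * ipoly_at x B" "ipoly_at x (A ^ n) = ipoly_at x A ^ n"
  "ipoly_at x (pCons c A) = of_int c + x * ipoly_at x A"
  "ipoly_at x (Polynomial.smult c A) = of_int c * ipoly_at x A"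
  "ipoly_at x (Polynomial.monom c n) = of_int c * x ^ n"
  unfolding ipoly_at_def
  by (simp_all add: of_int_poly_hom.hom_add of_int_poly_hom.hom_mult of_int_poly_hom.hom_minus
      of_int_poly_hom.hom_power of_int_poly_hom.hom_uminus of_int_hom.map_poly_pCons_hom poly_monom
      of_int_hom.map_poly_hom_smult of_int_hom.map_poly_hom_monom)

lemma ipoly_at_of_nat [simp]: "ipoly_at x (of_nat m) = of_nat m"
  by (induction m) auto

lemma ipoly_at_of_int [simp]: "ipoly_at x (of_int i) = of_int i"
  by (cases i) (auto simp del: of_nat_Suc)

lemma ipoly_at_sum: "ipoly_at x (sum f S) = (\<Sum>i\<in>S. ipoly_at x (f i))"
  by (induction S rule: infinite_finite_induct) auto

lemma ipoly_at_prod: "ipoly_at x (prod f S) = (\<Prod>i\<in>S. ipoly_at x (f i))"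
  by (induction S rule: infinite_finite_induct) auto

lemma ipoly_at_pcompose: "ipoly_at x (pcompose A B) = ipoly_at (ipoly_at x B) A"
  by (induction A) (auto simp: pcompose_pCons)

text \<open>Gauss's lemma: contents multiply and \<open>g\<close> has content 1, so \<open>c\<close>
  divides the content of the cofactor and cancels.\<close>

lemma primitive_dvd_smultD:
  fixes g A :: "int poly"
  assumes "content g = 1" "c \<noteq> 0" "g dvd Polynomial.smult c A"
  shows "g dvd A"
proof -
  from assms(3) obtain q where q: "Polynomial.smult c A = g * q" by (auto simp: dvd_def)
  have "content q = content (g * q)" by (simp add: content_mult assms(1))
  also have "\<dots> = normalize c * content A" by (simp flip: q)
  finally have "c dvd content q" by simp
  then have "[:c:] dvd q" by (simp add: const_poly_dvd_iff_dvd_content)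
  then obtain q' where "q = Polynomial.smult c q'" by (auto simp: dvd_def)
  with q assms(2) have "A = g * q'"
    by (metis mult_smult_right smult_cancel)
  then show ?thesis by simp
qed

text \<open>Pseudo-division by an annihilator of least degree leaves remainder 0 but introduces a
  power of the leading coefficient; passing to the primitive part of the annihilator lets Gauss's
  lemma remove that factor.\<close>

lemma exists_min_int_poly:
  fixes z :: "'a :: field_char_0"
  assumes "B \<noteq> 0" "ipoly_at z B = 0"
  obtains g where "content g = 1" "ipoly_at z g = 0" "degree g > 0"
    "\<And>A. ipoly_at z A = 0 \<Longrightarrow> g dvd A"
proof -
  define S where "S = (\<lambda>A. A \<noteq> 0 \<and> ipoly_at z A = 0)"
  have "S B" using assms by (simp add: S_def)
  then obtain g0 where g0: "S g0" "\<And>A. S A \<Longrightarrow> degree g0 \<le> degree A"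
    using ex_has_least_nat[of S B degree] by blast
  define g where "g = primitive_part g0"
  have g0': "g0 = Polynomial.smult (content g0) g" by (simp add: g_def)
  have cg0: "content g0 \<noteq> 0" using g0(1) by (auto simp: S_def)
  have cg: "content g = 1" using g0(1) by (simp add: S_def g_def)
  have gz: "ipoly_at z g = 0"
  proof -
    have "of_int (content g0) * ipoly_at z g = 0"
      using g0(1) g0' by (metis S_def ipoly_at_simps(9))
    then show ?thesis using cg0 by simp
  qed
  have deg: "degree g = degree g0" by (simp add: g_def)
  have gn0: "g \<noteq> 0" using cg by auto
  have "degree g > 0"
  proof (rule ccontr)
    assume "\<not> ?thesis"
    then obtain c where "g = [:c:]" using degree_eq_zeroE by blast
    with gz gn0 show False by simp
  qed
  moreover have "g dvd A" if A: "ipoly_at z A = 0" for A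
  proof -
    obtain q r where qr: "pseudo_divmod A g = (q, r)" by force
    define c where "c = lead_coeff g ^ (Suc (degree A) - degree g)"
    have eq: "Polynomial.smult c A = g * q + r" and dr: "r = 0 \<or> degree r < degree g"
      using pseudo_divmod[OF gn0 qr] by (auto simp: c_def)
    have "ipoly_at z r = 0"
      using arg_cong[OF eq, of "ipoly_at z"] A gz by simp
    then have "r = 0" using g0(2)[of r] dr deg by (force simp: S_def)
    with eq have "g dvd Polynomial.smult c A" by simp
    moreover have "c \<noteq> 0" using gn0 by (simp add: c_def)
    ultimately show ?thesis using primitive_dvd_smultD cg by blast
  qed
  ultimately show ?thesis using that cg gz by blast
qed

lemma add_power_prime_cong:
  fixes a b :: "'a :: comm_ring_1"
  assumes "Factorial_Ring.prime (l::nat)"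
  shows "of_nat l dvd (a + b) ^ l - (a ^ l + b ^ l)"
proof -
  have l: "l > 0" using assms prime_gt_0_nat by blast
  have "{..l} = insert 0 (insert l {1..<l})" using l by auto
  then have "(a + b) ^ l = a ^ l + b ^ l + (\<Sum>k\<in>{1..<l}. of_nat (l choose k) * a ^ k * b ^ (l - k))"
    using l by (simp add: binomial_ring)
  moreover have "of_nat l dvd (\<Sum>k\<in>{1..<l}. of_nat (l choose k) * a ^ k * b ^ (l - k))"
  proof (rule dvd_sum)
    fix k assume k: "k \<in> {1..<l}"
    have "l dvd (l choose k)" using k assms by (intro dvd_choose_prime) auto
    then have "of_nat l dvd (of_nat (l choose k) :: 'a)" by (metis dvd_def of_nat_mult)
    then show "of_nat l dvd (of_nat (l choose k) * a ^ k * b ^ (l - k) :: 'a)" by (metis dvd_mult2)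
  qed
  ultimately show ?thesis by simp
qed

text \<open>Induction on the coefficients: the binomial congruence splits off the constant term, and
  Fermat's little theorem replaces c^l by c.\<close>

lemma int_poly_frobenius_cong:
  fixes h :: "int poly"
  assumes l: "Factorial_Ring.prime (l::nat)"
  shows "of_nat l dvd h ^ l - pcompose h (Polynomial.monom 1 l)"
proof (induction h)
  case 0
  then show ?case using prime_gt_0_nat[OF l] by (simp add: zero_power)
next
  case (pCons c h)
  define T :: "int poly" where "T = [:0, 1:]"
  have e: "pCons c h = [:c:] + T * h" by (simp add: T_def)
  have Tl: "Polynomial.monom 1 l = T ^ l" by (simp add: T_def monom_altdef)
  have "[c ^ l = c] (mod int l)"
  proof -
    have "[(c mod int l) ^ l = c mod int l] (mod int l)"
    proof -
      define m where "m = nat (c mod int l)"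
      have m: "c mod int l = int m" using prime_gt_0_nat[OF l] by (simp add: m_def)
      have "[m ^ l = m] (mod l)"
      proof (cases "l dvd m")
        case True then show ?thesis using prime_gt_0_nat[OF l]
          by (metis cong_0_iff cong_trans cong_sym dvd_trans dvd_power)
      next
        case False
        have "[m ^ (l - 1) = 1] (mod l)" using fermat_theorem[OF l False] .
        then have "[m * m ^ (l - 1) = m * 1] (mod l)" by (rule cong_scalar_left)
        then show ?thesis using prime_gt_0_nat[OF l] by (cases l) auto
      qed
      then show ?thesis unfolding m by (simp flip: of_nat_power add: cong_int_iff)
    qed
    then show ?thesis by (simp add: cong_def mod_simps)
  qed
  then have "int l dvd c ^ l - c" by (simp add: cong_iff_dvd_diff)
  then obtain k where "c ^ l - c = int l * k" by (auto simp: dvd_def)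
  then have "[:c ^ l - c:] = of_nat l * [:k:]" by (simp add: of_nat_poly mult.commute)
  then have c: "of_nat l dvd [:c ^ l - c:]" by (rule dvdI)
  have "pCons c h ^ l - pcompose (pCons c h) (Polynomial.monom 1 l) =
     ((([:c:] + T * h)) ^ l - ([:c:] ^ l + (T * h) ^ l)) + [:c ^ l - c:] + 
     T ^ l * (h ^ l - pcompose h (Polynomial.monom 1 l))"
  proof -
    have "[:c ^ l - c:] = [:c:] ^ l - [:c:]" by (simp add: poly_const_pow)
    moreover have "pcompose (pCons c h) (Polynomial.monom 1 l) = [:c:] + T ^ l * pcompose h (Polynomial.monom 1 l)"
      by (simp add: pcompose_pCons Tl)
    ultimately show ?thesis
      unfolding e by (simp add: right_diff_distrib power_mult_distrib)
  qed
  also have "of_nat l dvd \<dots>"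
    by (intro dvd_add dvd_mult pCons.IH c add_power_prime_cong l)
  finally show ?case .
qed

text \<open>The power of the leading coefficient that pseudo-division puts in front of
  \<open>A\<close> is a unit and can be divided out.\<close>

lemma int_poly_division_unit_lead:
  fixes g A :: "int poly"
  assumes "is_unit (lead_coeff g)"
  obtains q r where "A = g * q + r" "r = 0 \<or> degree r < degree g"
proof -
  have g: "g \<noteq> 0" using assms by auto
  obtain q r where qr: "pseudo_divmod A g = (q, r)" by force
  define c where "c = lead_coeff g ^ (Suc (degree A) - degree g)"
  have eq: "Polynomial.smult c A = g * q + r" and dr: "r = 0 \<or> degree r < degree g"
    using pseudo_divmod[OF g qr] by (auto simp: c_def)
  have "is_unit c" unfolding c_def using assms by (rule is_unit_power_iff[THEN iffD2, OF disjI1])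
  then obtain c' where "c * c' = 1" by (auto simp: dvd_def)
  then have "A = g * Polynomial.smult c' q + Polynomial.smult c' r"
    using arg_cong[OF eq, of "Polynomial.smult c'"] by (simp add: smult_add_right mult.commute)
  then show ?thesis using dr by (intro that[of "Polynomial.smult c' q" "Polynomial.smult c' r"]) auto
qed

section \<open>Separability and roots of T^N - 1\<close>

definition unity_poly :: "nat \<Rightarrow> int poly"
  where "unity_poly N = Polynomial.monom 1 N - 1"

lemma ipoly_at_unity_poly [simp]: "ipoly_at x (unity_poly N) = x ^ N - 1"
  by (simp add: unity_poly_def)

lemma degree_unity_poly: "N > 0 \<Longrightarrow> degree (unity_poly N) = N"
  unfolding unity_poly_def diff_conv_add_uminus
  by (subst degree_add_eq_left) (auto simp: Polynomial.degree_monom_eq)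

lemma lead_coeff_unity_poly: "N > 0 \<Longrightarrow> lead_coeff (unity_poly N) = 1"
  using degree_unity_poly[of N] by (simp add: unity_poly_def)

text \<open>An explicit Bezout identity for T^N - 1 and its derivative; it gives separability modulo
  every prime not dividing N.\<close>

lemma unity_poly_separable_identity:
  assumes "N > 0"
  shows "[:0, 1:] * pderiv (unity_poly N) - of_nat N * unity_poly N = of_nat N"
proof -
  define T :: "int poly" where "T = [:0, 1:]"
  obtain M where M: "N = Suc M" using assms by (cases N) auto
  have "T * Polynomial.monom (int N) M = Polynomial.monom (int N) N"
    by (simp add: T_def M Polynomial.monom_Suc)
  moreover have "of_nat N * Polynomial.monom 1 N = (Polynomial.monom (int N) N :: int poly)"
    by (simp add: of_nat_poly smult_monom)
  ultimately show ?thesis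
    unfolding T_def[symmetric] by (simp add: unity_poly_def pderiv_diff pderiv_monom M algebra_simps)
qed

text \<open>
  Let \<open>g\<close> be the primitive integer polynomial of \<open>z\<close> and \<open>T ^ N - 1 = g * h\<close>; then \<open>N\<close> lies in the ideal
  \<open>(g, h)\<close>. If \<open>z ^ l\<close> were a root of \<open>h\<close>, then \<open>g\<close> would divide \<open>h (T ^ l)\<close>, which is \<open>h ^ l\<close>
  modulo \<open>l\<close>, and \<open>N ^ l\<close> would lie in \<open>(g, l)\<close>.
\<close>

lemma root_power_prime:
  fixes z :: "'a :: field_char_0"
  assumes N: "N > 0" "z ^ N = 1" and l: "Factorial_Ring.prime (l::nat)" "\<not> l dvd N"
    and A: "ipoly_at z A = 0"
  shows "ipoly_at (z ^ l) A = 0"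
proof -
  have W0: "unity_poly N \<noteq> 0" using lead_coeff_unity_poly[OF N(1)] by auto
  have Wz: "ipoly_at z (unity_poly N) = 0" using N by simp
  obtain g where g: "content g = 1" "ipoly_at z g = 0" "degree g > 0"
    "\<And>A. ipoly_at z A = 0 \<Longrightarrow> g dvd A"
    using exists_min_int_poly[OF W0 Wz] by blast
  obtain h where h: "unity_poly N = g * h" using g(4)[OF Wz] by (auto simp: dvd_def)
  have gu: "is_unit (lead_coeff g)"
    using lead_coeff_unity_poly[OF N(1)] unfolding h lead_coeff_mult by (metis dvdI)
  have "ipoly_at (z ^ l) g = 0"
  proof (rule ccontr)
    assume ng: "ipoly_at (z ^ l) g \<noteq> 0"
    have "ipoly_at (z ^ l) (g * h) = 0"
      unfolding h[symmetric] using N by (simp flip: power_mult add: mult.commute) (simp add: power_mult)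
    then have "ipoly_at (z ^ l) h = 0" using ng by simp
    then have "ipoly_at z (pcompose h (Polynomial.monom 1 l)) = 0" by (simp add: ipoly_at_pcompose)
    then have 1: "g dvd pcompose h (Polynomial.monom 1 l)" by (rule g(4))
    define T :: "int poly" where "T = [:0, 1:]"
    have "T * pderiv (unity_poly N) - of_nat N * unity_poly N = of_nat N"
      unfolding T_def by (rule unity_poly_separable_identity[OF N(1)])
    then have "of_nat N - h * (T * pderiv g) = g * (T * pderiv h - of_nat N * h)"
      unfolding h pderiv_mult by (simp add: algebra_simps)
    then have "g dvd of_nat N - h * (T * pderiv g)" by (rule dvdI)
    moreover have "of_nat N - h * (T * pderiv g) dvd of_nat N ^ l - (h * (T * pderiv g)) ^ l"
      by (metis dvd_triv_left power_diff_sumr2)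
    ultimately have 2: "g dvd of_nat N ^ l - (h * (T * pderiv g)) ^ l" by (rule dvd_trans)
    obtain r where r: "h ^ l - pcompose h (Polynomial.monom 1 l) = of_nat l * r"
      using int_poly_frobenius_cong[OF l(1)] by (auto simp: dvd_def)
    define w where "w = (T * pderiv g) ^ l"
    have "(h * (T * pderiv g)) ^ l = (pcompose h (Polynomial.monom 1 l) + of_nat l * r) * w"
      by (simp add: w_def power_mult_distrib flip: r)
    then have "of_nat N ^ l - of_nat l * (r * w) =
       (of_nat N ^ l - (h * (T * pderiv g)) ^ l) + pcompose h (Polynomial.monom 1 l) * w"
      by (simp add: algebra_simps)
    also have "g dvd \<dots>" using 1 2 by (intro dvd_add) auto
    finally have 3: "g dvd of_nat N ^ l - of_nat l * (r * w)" .
    have "coprime (int l) (int (N ^ l))"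
      using prime_imp_coprime[OF l] by (simp add: coprime_commute)
    then obtain a b where ab: "a * int l + b * int (N ^ l) = 1" using cong_solve_coprime_int
      by (metis bezout_int coprime_imp_gcd_eq_1)
    have "of_int b * (of_nat N ^ l - of_nat l * (r * w)) = of_int (b * int (N ^ l)) - of_nat l * (of_int b * r * w)"
      by (simp add: algebra_simps)
    also have "\<dots> = 1 - of_nat l * (of_int a + of_int b * r * w)"
    proof -
      have "b * int (N ^ l) = 1 - a * int l" using ab by simp
      then show ?thesis by (simp only: of_int_diff of_int_mult of_int_1 of_int_of_nat_eq) (simp add: algebra_simps)
    qed
    finally have 4: "g dvd 1 - of_nat l * (of_int a + of_int b * r * w)"
      using 3 by (metis dvd_mult)
    \<comment> \<open>Reduction modulo \<open>g\<close> keeps 1 - l s divisible by \<open>g\<close>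
      while its degree drops below that of \<open>g\<close>; it must then vanish, and its constant
      term makes l a unit of \<int>.\<close>
    obtain q s where qs: "of_int a + of_int b * r * w = g * q + s" "s = 0 \<or> degree s < degree g"
      using int_poly_division_unit_lead[OF gu] by metis
    have "1 - of_nat l * s = (1 - of_nat l * (of_int a + of_int b * r * w)) + g * (of_nat l * q)"
      unfolding qs(1) by (simp add: algebra_simps)
    also have "g dvd \<dots>" using 4 by (intro dvd_add) auto
    finally have dv: "g dvd 1 - of_nat l * s" .
    have "degree (1 - of_nat l * s) < degree g"
    proof -
      have "degree (of_nat l * s) < degree g"
        using qs(2) g(3) by (auto simp: of_nat_poly)
      then show ?thesis using g(3) by (intro degree_diff_less) auto
    qed
    with dv have "1 - of_nat l * s = 0"
      using dvd_imp_degree_le leD by blast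
    then have "coeff (of_nat l * s) 0 = 1" by (metis poly_0_coeff_0 poly_1 eq_iff_diff_eq_0)
    then have "int l * coeff s 0 = 1" by (simp add: of_nat_poly)
    then show False using l(1) by (metis dvd_triv_left not_prime_unit of_nat_1 of_nat_dvd_iff int_dvd_int_iff)
  qed
  then show ?thesis using g(4)[OF A] by (auto simp: dvd_def)
qed

text \<open>Prime factors of k are peeled off one at a time: each is prime to N, and the powers of z
  stay N-th roots of unity.\<close>

lemma root_power_coprime:
  fixes z :: "'a :: field_char_0"
  assumes "N > 0" "z ^ N = 1" "coprime k N" "ipoly_at z A = 0"
  shows "ipoly_at (z ^ k) A = 0"
  using assms(3)
proof (induction k rule: less_induct)
  case (less k)
  consider "k = 0" | "k = 1" | "k > 1" by linarith
  then show ?case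
  proof cases
    case 1
    \<comment> \<open>0 is coprime to N only if N = 1.\<close>
    then have "z = 1" using less.prems assms(2) by simp
    then show ?thesis using assms(4) by simp
  next
    case 2 then show ?thesis using assms(4) by simp
  next
    case 3
    then obtain l where l: "Factorial_Ring.prime l" "l dvd k" using prime_factor_nat by (metis less_irrefl)
    then obtain k' where k': "k = l * k'" by (auto simp: dvd_def)
    have "k' < k" using k' 3 prime_gt_1_nat[OF l(1)] by (cases "k' = 0") auto
    moreover have "coprime k' N" "coprime l N" using less.prems by (auto simp: k')
    ultimately have "ipoly_at (z ^ k') A = 0" using less.IH by blast
    moreover have "(z ^ k') ^ N = 1" using assms(2) by (metis mult.commute power_mult power_one)
    moreover have "\<not> l dvd N" using \<open>coprime l N\<close> l(1)
      by (meson coprime_absorb_left not_prime_unit)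
    ultimately have "ipoly_at ((z ^ k') ^ l) A = 0"
      using root_power_prime[OF assms(1)] l(1) by blast
    then show ?thesis by (simp add: k' mult.commute flip: power_mult)
  qed
qed

text \<open>
  The factor for \<open>d\<close> vanishes at the \<open>N\<close>-th roots of unity \<open>\<xi>\<close> with \<open>\<xi> ^ (N div d) = 1\<close>. It is also \<open>d\<close>
  times one minus an idempotent generating the cyclotomic ideal, so the product is a nonzero constant
  wherever these idempotents vanish: in the abstract cyclotomic field, and in a field of
  characteristic prime to \<open>N\<close> at an element of exact order \<open>N\<close>.
\<close>

definition nonprimitive_killer :: "nat \<Rightarrow> int poly"
  where "nonprimitive_killer N =
    (\<Prod>d | d dvd N \<and> 2 \<le> d. of_nat d - (\<Sum>j<d. Polynomial.monom 1 (j * (N div d))))"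

text \<open>The N distinct powers z^i are all roots of the product: those with i prime to N are
  roots of \<open>A\<close> by conjugacy, the others of the second factor. A remainder of degree
  below N with N roots vanishes.\<close>

lemma unity_poly_dvd_mult_killer:
  fixes z :: "'a :: field_char_0"
  assumes N: "N > 0" "z ^ N = 1" and prim: "\<And>i. 0 < i \<Longrightarrow> i < N \<Longrightarrow> z ^ i \<noteq> 1"
    and A: "ipoly_at z A = 0"
  shows "unity_poly N dvd A * nonprimitive_killer N"
proof -
  have z0: "z \<noteq> 0" using N by (metis power_0_left not_gr0 zero_neq_one)
  have vanish: "ipoly_at (z ^ i) (A * nonprimitive_killer N) = 0" for i
  proof (cases "coprime i N")
    case True
    then show ?thesis using root_power_coprime[OF N True A] by simp
  next
    case False
    \<comment> \<open>The factor of index gcd(i, N) vanishes at z^i: all d summands equal 1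
      there.\<close>
    define d where "d = gcd i N"
    have d: "d dvd N" "d dvd i" "d > 0" using N by (auto simp: d_def)
    moreover have "d \<noteq> 1" using False by (simp add: d_def coprime_iff_gcd_eq_1)
    ultimately have d2: "2 \<le> d" by linarith
    have "i * (N div d) = N * (i div d)" using d
      by (metis dvd_div_mult mult.commute)
    then have "(z ^ i) ^ (N div d) = 1" by (metis N(2) power_mult power_one)
    then have "(z ^ i) ^ (j * (N div d)) = 1" for j by (metis mult.commute power_mult power_one)
    then have "ipoly_at (z ^ i) (of_nat d - (\<Sum>j<d. Polynomial.monom 1 (j * (N div d)))) = 0"
      by (simp add: ipoly_at_sum)
    moreover have "finite {d. d dvd N \<and> 2 \<le> d}" using N(1) by simp
    ultimately have "ipoly_at (z ^ i) (nonprimitive_killer N) = 0"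
      unfolding nonprimitive_killer_def ipoly_at_prod using d(1) d2
      by (intro prod_zero) auto
    then show ?thesis by simp
  qed
  obtain q r where qr: "A * nonprimitive_killer N = unity_poly N * q + r"
    "r = 0 \<or> degree r < degree (unity_poly N)"
    using int_poly_division_unit_lead[of "unity_poly N"] lead_coeff_unity_poly[OF N(1)] by (metis dvd_refl)
  have "r = 0"
  proof (rule ccontr)
    assume r0: "r \<noteq> 0"
    define f where "f = (of_int_poly r :: 'a poly)"
    have f0: "f \<noteq> 0" using r0 by (simp add: f_def)
    have "poly f (z ^ i) = 0" for i
    proof -
      have "ipoly_at (z ^ i) r = 0"
        using vanish[of i] N(2) unfolding qr(1)
        by (simp flip: power_mult add: mult.commute) (simp add: power_mult)
      then show ?thesis by (simp add: f_def ipoly_at_def)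
    qed
    then have "(\<lambda>i. z ^ i) ` {..<N} \<subseteq> {x. poly f x = 0}" by auto
    then have "card ((\<lambda>i. z ^ i) ` {..<N}) \<le> card {x. poly f x = 0}"
      by (intro card_mono poly_roots_finite f0)
    also have "\<dots> \<le> degree f" by (rule card_poly_roots_bound[OF f0])
    also have "\<dots> < N" using qr(2) r0 degree_unity_poly[OF N(1)] by (simp add: f_def)
    finally have less: "card ((\<lambda>i. z ^ i) ` {..<N}) < N" .
    have "inj_on (\<lambda>i. z ^ i) {..<N}"
    proof (rule linorder_inj_onI)
      fix i j assume ij: "i < j" "i \<in> {..<N}" "j \<in> {..<N}"
      then have "z ^ (j - i) \<noteq> 1" by (intro prim) auto
      moreover have "z ^ j = z ^ i * z ^ (j - i)" using ij by (simp flip: power_add)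
      ultimately show "z ^ i \<noteq> z ^ j" using z0 by auto
    qed auto
    with less show False by (simp add: card_image)
  qed
  then show ?thesis using qr(1) by simp
qed

section \<open>The abstract cyclotomic field inside the complex numbers\<close>

lemma ring_of_type_algebra_simps [simp]:
  "carrier ring_of_type_algebra = UNIV" "x \<otimes>\<^bsub>ring_of_type_algebra\<^esub> y = x * y"
  "x \<oplus>\<^bsub>ring_of_type_algebra\<^esub> y = x + y" "\<one>\<^bsub>ring_of_type_algebra\<^esub> = 1"
  "\<zero>\<^bsub>ring_of_type_algebra\<^esub> = 0"
  by (simp_all add: ring_of_type_algebra_def)

lemma poly_mapping_add_induct [case_names zero single add]:
  assumes "P 0" "\<And>a b. P (Poly_Mapping.single a b)" "\<And>f g. P f \<Longrightarrow> P g \<Longrightarrow> P (f + g)"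
  shows "P (f :: 'a \<Rightarrow>\<^sub>0 'b::monoid_add)"
proof (induction f rule: update_induct)
  show "P 0" by (rule assms(1))
next
  fix f :: "'a \<Rightarrow>\<^sub>0 'b" and a b
  assume a: "a \<notin> Poly_Mapping.keys f" and f: "P f"
  have "poly_mapping.lookup f a = 0" using a by (simp add: in_keys_iff)
  then have "Poly_Mapping.update a b f = f + Poly_Mapping.single a b"
    by (intro poly_mapping_eqI) (auto simp: lookup_update lookup_add lookup_single when_def)
  then show "P (Poly_Mapping.update a b f)" using assms f by metis
qed

section \<open>The character of Q/Z with values in the complex roots of unity\<close>

definition root_unity :: "rat \<Rightarrow> complex"
  where "root_unity q = cis (2 * pi * of_rat q)"

lemma root_unity_add: "root_unity (a + b) = root_unity a * root_unity b"
  by (simp add: root_unity_def cis_mult of_rat_add distrib_left)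

lemma root_unity_0 [simp]: "root_unity 0 = 1"
  by (simp add: root_unity_def)

lemma root_unity_int: "m \<in> \<int> \<Longrightarrow> root_unity m = 1"
  by (elim Ints_cases) (simp add: root_unity_def)

lemma root_unity_power: "root_unity q ^ n = root_unity (of_nat n * q)"
  by (simp add: root_unity_def DeMoivre of_rat_mult mult_ac)

lemma root_unity_primitive: "0 < i \<Longrightarrow> i < n \<Longrightarrow> root_unity (1 / of_nat n) ^ i \<noteq> 1"
proof
  assume i: "0 < i" "i < n" and eq: "root_unity (1 / of_nat n) ^ i = 1"
  have "cis (2 * pi * (real i / real n)) = 1"
    using eq by (simp add: root_unity_power) (simp add: root_unity_def of_rat_divide)
  then have "cos (2 * pi * (real i / real n)) = 1" by (metis cis.sel(1) one_complex.sel(1))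
  then obtain k where "2 * pi * (real i / real n) = of_int k * 2 * pi" by (auto simp: cos_one_2pi_int)
  then have "(2 * pi) * (real i / real n) = (2 * pi) * of_int k" by (simp add: mult_ac)
  then have "real i / real n = of_int k" by (subst (asm) mult_cancel_left) auto
  moreover have "0 < real i / real n" "real i / real n < 1" using i by auto
  ultimately have "0 < k" "k < 1" by simp_all
  then show False by simp
qed

lemma root_unity_inverse_power [simp]: "n > 0 \<Longrightarrow> root_unity (1 / of_nat n) ^ n = 1"
  by (simp add: root_unity_power root_unity_int)

lift_definition root_unity_mod :: "rat_mod_int \<Rightarrow> complex" is root_unity
proof -
  fix x y :: rat assume "x - y \<in> \<int>"
  then have "root_unity (x - y) = 1" by (rule root_unity_int)
  then show "root_unity x = root_unity y" using root_unity_add[of "x - y" y] by simp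
qed

lemma root_unity_mod_add: "root_unity_mod (a + b) = root_unity_mod a * root_unity_mod b"
  by transfer (rule root_unity_add)

lemma root_unity_mod_0: "root_unity_mod 0 = 1"
  by transfer simp

lemma abs_rat_mod_int_add: "abs_rat_mod_int (a + b) = abs_rat_mod_int a + abs_rat_mod_int b"
  by (simp add: plus_rat_mod_int.abs_eq)

lemma abs_rat_mod_int_eqI: "a - b \<in> \<int> \<Longrightarrow> abs_rat_mod_int a = abs_rat_mod_int b"
  by (simp add: rat_mod_int.abs_eq_iff)

definition group_ring_eval :: "(rat_mod_int \<Rightarrow>\<^sub>0 rat) \<Rightarrow> complex"
  where "group_ring_eval f = (\<Sum>k\<in>Poly_Mapping.keys f. of_rat (poly_mapping.lookup f k) * root_unity_mod k)"

lemma group_ring_eval_0 [simp]: "group_ring_eval 0 = 0"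
  by (simp add: group_ring_eval_def)

lemma group_ring_eval_single [simp]:
  "group_ring_eval (Poly_Mapping.single k q) = of_rat q * root_unity_mod k"
  by (simp add: group_ring_eval_def)

lemma group_ring_eval_add [simp]: "group_ring_eval (f + g) = group_ring_eval f + group_ring_eval g"
  unfolding group_ring_eval_def
  by (rule setsum_keys_plus_distrib) (auto simp: of_rat_add distrib_right)

lemma group_ring_eval_mult [simp]: "group_ring_eval (f * g) = group_ring_eval f * group_ring_eval g"
proof (induction f rule: poly_mapping_add_induct)
  case (single a b)
  show ?case
    by (induction g rule: poly_mapping_add_induct)
      (auto simp: mult_single of_rat_mult root_unity_mod_add distrib_left)
qed (auto simp: distrib_right)

lemma group_ring_eval_1 [simp]: "group_ring_eval 1 = 1"
  using group_ring_eval_single[of 0 1] by (simp add: root_unity_mod_0)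

lemma group_ring_eval_of_int [simp]: "group_ring_eval (of_int i) = of_int i"
  by (simp add: root_unity_mod_0 flip: single_of_int)

lemma group_ring_eval_of_nat [simp]: "group_ring_eval (of_nat i) = of_nat i"
  using group_ring_eval_of_int[of "int i"] by simp

lemma group_ring_eval_sum: "group_ring_eval (sum f S) = (\<Sum>i\<in>S. group_ring_eval (f i))"
  by (induction S rule: infinite_finite_induct) auto

lemma group_ring_eval_ipoly_at: "group_ring_eval (ipoly_at t A) = ipoly_at (group_ring_eval t) A"
  by (induction A) auto

definition basic_unit :: "nat \<Rightarrow> rat_mod_int \<Rightarrow>\<^sub>0 rat"
  where "basic_unit n = Poly_Mapping.single (abs_rat_mod_int (1 / of_nat n)) 1"

lemma basic_unit_power: "basic_unit n ^ i = Poly_Mapping.single (abs_rat_mod_int (of_nat i / of_nat n)) 1"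
proof (induction i)
  case 0
  then show ?case by (simp flip: zero_rat_mod_int_def)
next
  case (Suc i)
  then show ?case
    by (simp add: basic_unit_def mult_single add_divide_distrib abs_rat_mod_int_add)
qed

lemma basic_unit_power_self: "n > 0 \<Longrightarrow> basic_unit n ^ n = 1"
  using abs_rat_mod_int_eqI[of 1 0] by (simp add: basic_unit_power flip: zero_rat_mod_int_def)

lemma basic_unit_mult_power: "m > 0 \<Longrightarrow> basic_unit (n * m) ^ m = basic_unit n"
  by (simp add: basic_unit_power) (simp add: basic_unit_def)

lemma group_ring_eval_basic_unit [simp]: "group_ring_eval (basic_unit n) = root_unity (1 / of_nat n)"
  by (simp add: basic_unit_def root_unity_mod.abs_eq)

text \<open>A finite support has a common denominator \<open>N\<close> for the exponents and
  \<open>c\<close> for the coefficients. Sums are brought to the level N N' by substituting T^N' and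
  T^N.\<close>

lemma group_ring_clear_denominators:
  obtains N c A where "N > 0" "c \<noteq> 0" "of_int c * f = ipoly_at (basic_unit N) A"
proof -
  have "\<exists>N c A. N > 0 \<and> c \<noteq> 0 \<and> of_int c * f = ipoly_at (basic_unit N) A"
  proof (induction f rule: poly_mapping_add_induct)
    case zero
    show ?case by (intro exI[of _ 1] exI[of _ 0]) auto
  next
    case (single k q)
    obtain r where r: "k = abs_rat_mod_int r" using Quotient_rat_mod_int[THEN Quotient_abs_rep, of k] by metis
    obtain a b where ab: "quotient_of r = (a, b)" by force
    have b: "b > 0" and rab: "r = of_int a / of_int b"
      using ab quotient_of_denom_pos quotient_of_div by blast+
    obtain u w where uw: "quotient_of q = (u, w)" by force
    have w: "w > 0" and q: "q = of_int u / of_int w"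
      using uw quotient_of_denom_pos quotient_of_div by blast+
    define i where "i = nat (a mod b)"
    have i: "int i = a mod b" using b by (simp add: i_def)
    have "of_nat i = (of_int (a mod b) :: rat)" using i by (metis of_int_of_nat_eq)
    moreover have "(of_int a :: rat) = of_int (a div b) * of_int b + of_int (a mod b)"
      by (metis div_mult_mod_eq of_int_add of_int_mult)
    ultimately have "r - of_nat i / of_nat (nat b) = of_int (a div b)"
      using b by (simp add: rab add_divide_distrib)
    then have k: "k = abs_rat_mod_int (of_nat i / of_nat (nat b))"
      unfolding r by (intro abs_rat_mod_int_eqI) auto
    have "of_int w * Poly_Mapping.single k q = Poly_Mapping.single k (of_int w * q)"
      unfolding single_of_int[symmetric] mult_single by simp
    also have "of_int w * q = of_int u" using w q by simp
    also have "Poly_Mapping.single k (of_int u) = of_int u * basic_unit (nat b) ^ i"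
      unfolding single_of_int[symmetric] basic_unit_power mult_single k by simp
    finally have "of_int w * Poly_Mapping.single k q = ipoly_at (basic_unit (nat b)) (Polynomial.monom u i)"
      by simp
    moreover have "nat b > 0" "w \<noteq> 0" using b w by auto
    ultimately show ?case by blast
  next
    case (add f g)
    then obtain N c A N' c' A' where 1: "N > 0" "c \<noteq> 0" "of_int c * f = ipoly_at (basic_unit N) A"
      and 2: "N' > 0" "c' \<noteq> 0" "of_int c' * g = ipoly_at (basic_unit N') A'" by blast
    define B where "B = of_int c' * pcompose A (Polynomial.monom 1 N') + of_int c * pcompose A' (Polynomial.monom 1 N)"
    have "of_int (c * c') * (f + g) = of_int c' * (of_int c * f) + of_int c * (of_int c' * g)"
      by (simp add: algebra_simps)
    also have "\<dots> = ipoly_at (basic_unit (N * N')) B"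
      using basic_unit_mult_power[OF 2(1), of N] basic_unit_mult_power[OF 1(1), of N']
      unfolding 1(3) 2(3) B_def by (simp add: ipoly_at_pcompose mult.commute[of N' N])
    finally show ?case using 1 2 by (metis mult_eq_0_iff nat_0_less_mult_iff)
  qed
  then show ?thesis using that by blast
qed

lemma cring_group_ring: "cring group_ring"
  by (rule cring_from_type_algebra)

lemma cyc_ideal_ideal: "ideal cyc_ideal group_ring"
  unfolding cyc_ideal_def
  by (rule ring.genideal_ideal) (auto simp: cring.axioms(1) cring_group_ring)

lemma cyc_idempotent_in_cyc_ideal: "2 \<le> n \<Longrightarrow> cyc_idempotent n \<in> cyc_ideal"
  unfolding cyc_ideal_def
  using ring.genideal_self[OF cring.axioms(1)[OF cring_group_ring], of "{cyc_idempotent n |n. 2 \<le> n}"] by auto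

lemma cyc_ideal_closed:
  "0 \<in> cyc_ideal" "a \<in> cyc_ideal \<Longrightarrow> b \<in> cyc_ideal \<Longrightarrow> a + b \<in> cyc_ideal"
  "a \<in> cyc_ideal \<Longrightarrow> x * a \<in> cyc_ideal" "a \<in> cyc_ideal \<Longrightarrow> a * x \<in> cyc_ideal"
  using additive_subgroup.zero_closed[OF ideal.axioms(1)[OF cyc_ideal_ideal]]
    additive_subgroup.a_closed[OF ideal.axioms(1)[OF cyc_ideal_ideal], of a b]
    ideal.I_l_closed[OF cyc_ideal_ideal, of a x] ideal.I_r_closed[OF cyc_ideal_ideal, of a x]
  by auto

text \<open>Identifies the factor of index d in \<open>nonprimitive_killer N\<close>, evaluated at
  \<open>basic_unit N\<close>, as d times the complement of the idempotent.\<close>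

lemma of_nat_mult_cyc_idempotent:
  assumes "d dvd N" "N > 0"
  shows "of_nat d * cyc_idempotent d = (\<Sum>j<d. basic_unit N ^ (j * (N div d)))"
proof -
  have d: "d > 0" using assms by (auto simp: dvd_def intro!: Nat.gr0I)
  have "of_nat d * cyc_idempotent d = (\<Sum>j<d. Poly_Mapping.single (abs_rat_mod_int (of_nat j / of_nat d)) 1)"
    unfolding cyc_idempotent_def mult.assoc[symmetric]
    using d by (simp add: mult_single flip: single_of_nat)
  also have "\<dots> = (\<Sum>j<d. basic_unit N ^ (j * (N div d)))"
  proof (intro sum.cong refl)
    fix j
    obtain e where e: "N = d * e" using assms by (auto simp: dvd_def)
    have "e > 0" using e assms by auto
    then show "Poly_Mapping.single (abs_rat_mod_int (of_nat j / of_nat d)) 1 = basic_unit N ^ (j * (N div d))"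
      using d by (simp add: basic_unit_power e)
  qed
  finally show ?thesis .
qed

lemma ring_hom_group_ring_eval: "ring_hom_ring group_ring (ring_of_type_algebra :: complex ring) group_ring_eval"
  by (rule ring_hom_ringI2) (auto intro!: ring_hom_memI cring.axioms(1) cring_from_type_algebra)

text \<open>If f evaluates to 0, an integer multiple of f is A(e(1/N)) with A vanishing at the
  complex root of unity. Then A times \<open>nonprimitive_killer N\<close> is a multiple of T^N - 1,
  hence 0 at e(1/N), while modulo the ideal the second factor is a nonzero integer.\<close>

lemma cyc_ideal_iff: "f \<in> cyc_ideal \<longleftrightarrow> group_ring_eval f = 0"
proof
  define Z :: "(rat_mod_int \<Rightarrow>\<^sub>0 rat) set" where "Z = {f. group_ring_eval f = 0}"
  have "ideal Z group_ring"
    using ring_hom_ring.kernel_is_ideal[OF ring_hom_group_ring_eval] by (simp add: a_kernel_def' Z_def)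
  moreover have "cyc_idempotent n \<in> Z" if n: "2 \<le> n" for n
  proof -
    have "root_unity (1 / of_nat n) \<noteq> 1" using root_unity_primitive[of 1 n] n by simp
    moreover have "(\<Sum>j<n. root_unity (1 / of_nat n) ^ j) * (root_unity (1 / of_nat n) - 1) = root_unity (1 / of_nat n) ^ n - 1"
      by (simp add: power_diff_1_eq mult.commute)
    ultimately have "(\<Sum>j<n. root_unity (1 / of_nat n) ^ j) = 0" using n by simp
    then have "group_ring_eval (of_nat n * cyc_idempotent n) = 0"
      using n by (subst of_nat_mult_cyc_idempotent[of n n])
        (auto simp: group_ring_eval_sum root_unity_power basic_unit_power root_unity_mod.abs_eq)
    then show ?thesis using n by (simp add: Z_def)
  qed
  ultimately have "cyc_ideal \<subseteq> Z"
    unfolding cyc_ideal_def by (intro ring.genideal_minimal) auto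
  then show "group_ring_eval f = 0" if "f \<in> cyc_ideal" using that by (auto simp: Z_def)
next
  assume f: "group_ring_eval f = 0"
  obtain N c A where N: "N > 0" "c \<noteq> 0" "of_int c * f = ipoly_at (basic_unit N) A"
    by (rule group_ring_clear_denominators)
  have "ipoly_at (root_unity (1 / of_nat N)) A = 0"
    using arg_cong[OF N(3), of group_ring_eval] f by (simp add: group_ring_eval_ipoly_at)
  then have "unity_poly N dvd A * nonprimitive_killer N"
    using N(1) root_unity_primitive by (intro unity_poly_dvd_mult_killer[of N "root_unity (1 / of_nat N)"]) auto
  then obtain Q where "A * nonprimitive_killer N = unity_poly N * Q" by (auto simp: dvd_def)
  then have 0: "ipoly_at (basic_unit N) A * ipoly_at (basic_unit N) (nonprimitive_killer N) = 0"
    using basic_unit_power_self[OF N(1)] by (metis ipoly_at_simps(6) ipoly_at_unity_poly diff_self mult_zero_left)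
  define D where "D = {d. d dvd N \<and> 2 \<le> d}"
  have "finite D" using N(1) by (simp add: D_def)
  moreover have "D \<subseteq> {d. d dvd N \<and> 2 \<le> d}" by (simp add: D_def)
  \<comment> \<open>Each idempotent lies in the ideal, so modulo it the factor of index d may be
    replaced by the integer d.\<close>
  ultimately have "(\<Prod>d\<in>D. of_nat d) - (\<Prod>d\<in>D. of_nat d - of_nat d * cyc_idempotent d) \<in> cyc_ideal"
  proof (induction D)
    case empty
    then show ?case by (simp add: cyc_ideal_closed)
  next
    case (insert d D)
    define x y where "x = (\<Prod>d\<in>D. of_nat d :: rat_mod_int \<Rightarrow>\<^sub>0 rat)"
      and "y = (\<Prod>d\<in>D. of_nat d - of_nat d * cyc_idempotent d)"
    have "x - y \<in> cyc_ideal" using insert by (auto simp: x_def y_def)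
    moreover have "cyc_idempotent d \<in> cyc_ideal"
      using insert.prems by (intro cyc_idempotent_in_cyc_ideal) auto
    ultimately have "of_nat d * (x - y) + cyc_idempotent d * (of_nat d * y) \<in> cyc_ideal"
      by (intro cyc_ideal_closed)
    also have "of_nat d * (x - y) + cyc_idempotent d * (of_nat d * y) =
       of_nat d * x - (of_nat d - of_nat d * cyc_idempotent d) * y" by (simp add: algebra_simps)
    finally show ?case using insert.hyps by (simp add: x_def y_def)
  qed
  moreover have "ipoly_at (basic_unit N) (nonprimitive_killer N) = (\<Prod>d\<in>D. of_nat d - of_nat d * cyc_idempotent d)"
    unfolding nonprimitive_killer_def ipoly_at_prod D_def
    using N(1) by (intro prod.cong refl) (auto simp: ipoly_at_sum of_nat_mult_cyc_idempotent)
  ultimately have "(of_int c * f) * ((\<Prod>d\<in>D. of_nat d) - ipoly_at (basic_unit N) (nonprimitive_killer N)) \<in> cyc_ideal"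
    by (auto intro: cyc_ideal_closed)
  then have 1: "(of_int c * f) * (\<Prod>d\<in>D. of_nat d) \<in> cyc_ideal"
    using 0 unfolding N(3) right_diff_distrib by simp
  define e where "e = of_int c * (\<Prod>d\<in>D. of_nat d :: rat)"
  have "e \<noteq> 0" using N(2) \<open>finite D\<close> by (auto simp: e_def D_def)
  have "(\<Prod>d\<in>D. of_nat d) = Poly_Mapping.single (0 :: rat_mod_int) (\<Prod>d\<in>D. of_nat d :: rat)"
    by (simp flip: of_nat_prod add: single_of_nat)
  then have e: "of_int c * (\<Prod>d\<in>D. of_nat d) = Poly_Mapping.single (0 :: rat_mod_int) e"
    by (simp add: e_def mult_single flip: single_of_int)
  have "f = (Poly_Mapping.single 0 (1 / e) * Poly_Mapping.single 0 e) * f"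
    using \<open>e \<noteq> 0\<close> by (simp add: mult_single)
  also have "\<dots> = Poly_Mapping.single 0 (1 / e) * ((of_int c * f) * (\<Prod>d\<in>D. of_nat d))"
    unfolding e[symmetric] by (simp only: mult_ac)
  finally show "f \<in> cyc_ideal" using cyc_ideal_closed(3)[OF 1] by metis
qed

text \<open>The concrete copy of the field. Complex numbers make the arithmetic of a field type
  available; \<open>qcyc_embed\<close> and \<open>qcyc_of\<close> carry results back to the quotient
  ring.\<close>

definition cyclo :: "complex set"
  where "cyclo = range group_ring_eval"

lemma cyclo_add: "x \<in> cyclo \<Longrightarrow> y \<in> cyclo \<Longrightarrow> x + y \<in> cyclo"
  and cyclo_mult: "x \<in> cyclo \<Longrightarrow> y \<in> cyclo \<Longrightarrow> x * y \<in> cyclo"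
  unfolding cyclo_def by (auto simp flip: group_ring_eval_add group_ring_eval_mult)

lemma cyclo_of_rat: "of_rat q \<in> cyclo"
  unfolding cyclo_def
  by (rule range_eqI[of _ _ "Poly_Mapping.single 0 q"]) (simp add: root_unity_mod_0)

lemma cyclo_of_int: "of_int i \<in> cyclo"
  using cyclo_of_rat[of "of_int i"] by simp

lemma cyclo_0: "0 \<in> cyclo" and cyclo_1: "1 \<in> cyclo" and cyclo_of_nat: "of_nat n \<in> cyclo"
  using cyclo_of_int[of 0] cyclo_of_int[of 1] cyclo_of_int[of "int n"] by simp_all

lemma cyclo_uminus: "x \<in> cyclo \<Longrightarrow> - x \<in> cyclo"
  using cyclo_mult[OF cyclo_of_int[of "-1"]] by fastforce

lemma cyclo_diff: "x \<in> cyclo \<Longrightarrow> y \<in> cyclo \<Longrightarrow> x - y \<in> cyclo"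
  using cyclo_add[of x "- y"] cyclo_uminus by simp

lemma cyclo_power: "x \<in> cyclo \<Longrightarrow> x ^ n \<in> cyclo"
  by (induction n) (auto intro: cyclo_1 cyclo_mult)

lemma cyclo_sum: "(\<And>i. i \<in> S \<Longrightarrow> f i \<in> cyclo) \<Longrightarrow> sum f S \<in> cyclo"
  by (induction S rule: infinite_finite_induct) (auto intro: cyclo_0 cyclo_add)

lemma cyclo_ipoly_at: "x \<in> cyclo \<Longrightarrow> ipoly_at x A \<in> cyclo"
  by (induction A) (auto intro: cyclo_0 cyclo_add cyclo_mult cyclo_of_int)

lemma cyclo_root_unity: "root_unity q \<in> cyclo"
  unfolding cyclo_def
  by (rule range_eqI[of _ _ "Poly_Mapping.single (abs_rat_mod_int q) 1"]) (simp add: root_unity_mod.abs_eq)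

lemma cyclo_clear_denominators:
  assumes "x \<in> cyclo"
  obtains N c A where "N > 0" "c \<noteq> 0" "of_int c * x = ipoly_at (root_unity (1 / of_nat N)) A"
proof -
  obtain f where f: "x = group_ring_eval f" using assms by (auto simp: cyclo_def)
  obtain N c A where N: "N > 0" "c \<noteq> 0" "of_int c * f = ipoly_at (basic_unit N) A"
    by (rule group_ring_clear_denominators)
  have "of_int c * x = ipoly_at (root_unity (1 / of_nat N)) A"
    using arg_cong[OF N(3), of group_ring_eval] by (simp add: group_ring_eval_ipoly_at f)
  then show ?thesis using that N by blast
qed

text \<open>
  Multiplication by \<open>A(z)\<close> on the powers of \<open>z\<close> is given by an integer matrix, whose
  characteristic polynomial annihilates \<open>A(z)\<close>.
\<close>

lemma ipoly_at_unity_root_integral: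
  fixes z :: complex
  assumes "N > 0" "z ^ N = 1"
  obtains B where "lead_coeff B = 1" "ipoly_at (ipoly_at z A) B = 0"
proof -
  have u: "is_unit (lead_coeff (unity_poly N))" by (simp add: lead_coeff_unity_poly assms)
  have "\<exists>r. degree r < N \<and> ipoly_at z r = ipoly_at z A * z ^ i" for i
  proof -
    obtain q r where qr: "A * Polynomial.monom 1 i = unity_poly N * q + r"
        "r = 0 \<or> degree r < degree (unity_poly N)"
      using int_poly_division_unit_lead[OF u] by metis
    have "ipoly_at z r = ipoly_at z A * z ^ i"
      using arg_cong[OF qr(1), of "ipoly_at z"] assms by simp
    moreover have "degree r < N" using qr(2) assms(1) by (auto simp: degree_unity_poly)
    ultimately show ?thesis by blast
  qed
  then obtain r where r: "\<And>i. degree (r i) < N" "\<And>i. ipoly_at z (r i) = ipoly_at z A * z ^ i"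
    by metis
  define M where "M = mat N N (\<lambda>(i, j). coeff (r i) j)"
  define v where "v = vec N (\<lambda>i. z ^ i)"
  have M: "M \<in> carrier_mat N N" by (simp add: M_def)
  have v0: "v \<noteq> 0\<^sub>v N"
  proof
    assume "v = 0\<^sub>v N"
    then have "v $ 0 = 0" using assms(1) by simp
    then show False using assms(1) by (simp add: v_def)
  qed
  have "eigenvector (of_int_hom.mat_hom M) v (ipoly_at z A)"
    unfolding eigenvector_def
  proof (intro conjI)
    show "v \<in> carrier_vec (dim_row (of_int_hom.mat_hom M))" using M by (simp add: v_def)
    show "v \<noteq> 0\<^sub>v (dim_row (of_int_hom.mat_hom M))" using M v0 by simp
    show "of_int_hom.mat_hom M *\<^sub>v v = ipoly_at z A \<cdot>\<^sub>v v"
    proof (rule eq_vecI)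
      fix i assume "i < dim_vec (ipoly_at z A \<cdot>\<^sub>v v)"
      then have i: "i < N" by (simp add: v_def)
      have "(of_int_hom.mat_hom M *\<^sub>v v) $ i = (\<Sum>j<N. of_int (coeff (r i) j) * z ^ j)"
        using i by (simp add: M_def v_def scalar_prod_def atLeast0LessThan)
      also have "\<dots> = ipoly_at z (r i)"
      proof -
        have "ipoly_at z (r i) = (\<Sum>j\<le>degree (r i). of_int (coeff (r i) j) * z ^ j)"
          by (simp add: ipoly_at_def poly_altdef)
        also have "\<dots> = (\<Sum>j<N. of_int (coeff (r i) j) * z ^ j)"
          using r(1)[of i] by (intro sum.mono_neutral_left) (auto simp: coeff_eq_0)
        finally show ?thesis by simp
      qed
      finally show "(of_int_hom.mat_hom M *\<^sub>v v) $ i = (ipoly_at z A \<cdot>\<^sub>v v) $ i"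
        using i r(2) by (simp add: v_def)
    qed (simp add: v_def M_def)
  qed
  then have "poly (char_poly (of_int_hom.mat_hom M)) (ipoly_at z A) = 0"
    using eigenvalue_root_char_poly[of "of_int_hom.mat_hom M :: complex mat" N] M
    by (auto simp: eigenvalue_def)
  then have "ipoly_at (ipoly_at z A) (char_poly M) = 0"
    unfolding ipoly_at_def[of _ "char_poly M"]
    by (simp flip: of_int_hom.char_poly_hom[OF M])
  moreover have "lead_coeff (char_poly M) = 1" using degree_monic_char_poly[OF M] by simp
  ultimately show ?thesis using that by blast
qed

lemma cyclo_algebraic:
  assumes "x \<in> cyclo"
  obtains B where "B \<noteq> 0" "ipoly_at x B = 0"
proof -
  obtain N c A where N: "N > 0" "c \<noteq> 0" "of_int c * x = ipoly_at (root_unity (1 / of_nat N)) A"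
    using cyclo_clear_denominators[OF assms] .
  obtain B where B: "lead_coeff B = 1" "ipoly_at (of_int c * x) B = 0"
    unfolding N(3) using ipoly_at_unity_root_integral[OF N(1), of "root_unity (1 / of_nat N)"] N(1)
    by (metis root_unity_inverse_power)
  have "ipoly_at x (pcompose B [:0, c:]) = 0" using B(2) by (simp add: ipoly_at_pcompose mult.commute)
  moreover have "pcompose B [:0, c:] \<noteq> 0"
    using B(1) N(2) by (subst pcompose_eq_0_iff) auto
  ultimately show ?thesis using that by blast
qed

text \<open>Dividing the relation by the largest possible power of x leaves a nonzero constant term,
  from which the inverse of x is read off.\<close>

lemma algebraic_nonzero_constant_coeff:
  fixes x :: "'a :: field_char_0"
  assumes "B \<noteq> 0" "ipoly_at x B = 0" "x \<noteq> 0"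
  obtains c B' where "c \<noteq> 0" "of_int c + x * ipoly_at x B' = 0"
  using assms
proof (induction B)
  case (pCons a B)
  then show ?case by (cases "a = 0") auto
qed auto

lemma cyclo_inverse:
  assumes "x \<in> cyclo"
  shows "inverse x \<in> cyclo"
proof (cases "x = 0")
  case False
  obtain B where "B \<noteq> 0" "ipoly_at x B = 0" using cyclo_algebraic[OF assms] .
  then obtain c B' where c: "c \<noteq> 0" "of_int c + x * ipoly_at x B' = 0"
    using False by (rule algebraic_nonzero_constant_coeff)
  from c(2) have "x * ipoly_at x B' = - of_int c" by (simp add: eq_neg_iff_add_eq_0 add.commute)
  then have "x * (of_rat (- 1 / of_int c) * ipoly_at x B') = 1"
    using c(1) by (simp add: of_rat_divide of_rat_minus mult.left_commute[of x])
  then have "inverse x = of_rat (- 1 / of_int c) * ipoly_at x B'" by (rule inverse_unique)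
  also have "\<dots> \<in> cyclo" by (intro cyclo_mult cyclo_of_rat cyclo_ipoly_at assms)
  finally show ?thesis .
qed (simp add: cyclo_0)

lemma cyclo_divide: "x \<in> cyclo \<Longrightarrow> y \<in> cyclo \<Longrightarrow> x / y \<in> cyclo"
  unfolding divide_inverse by (intro cyclo_mult cyclo_inverse)

lemmas cyclo_closed = cyclo_0 cyclo_1 cyclo_of_nat cyclo_of_int cyclo_of_rat cyclo_add cyclo_mult cyclo_uminus
  cyclo_diff cyclo_power cyclo_ipoly_at cyclo_root_unity cyclo_inverse cyclo_divide

text \<open>All members of a coset have the same value under \<open>group_ring_eval\<close>. This is
  the shape in which the first isomorphism theorem provides the map.\<close>

definition qcyc_embed :: "qcyc \<Rightarrow> complex"
  where "qcyc_embed x = the_elem (group_ring_eval ` x)"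

lemma qcyc_embed_iso: "qcyc_embed \<in> ring_iso Qcyc (ring_of_type_algebra\<lparr>carrier := cyclo\<rparr>)"
proof -
  have "a_kernel group_ring (ring_of_type_algebra :: complex ring) group_ring_eval = cyc_ideal"
    by (auto simp: a_kernel_def' cyc_ideal_iff)
  then show ?thesis
    using ring_hom_ring.FactRing_iso_set_aux[OF ring_hom_group_ring_eval]
    by (simp add: Qcyc_def cyclo_def qcyc_embed_def[abs_def])
qed

lemma qcyc_embed_mult: "x \<in> carrier Qcyc \<Longrightarrow> y \<in> carrier Qcyc \<Longrightarrow> qcyc_embed (x \<otimes>\<^bsub>Qcyc\<^esub> y) = qcyc_embed x * qcyc_embed y"
  and qcyc_embed_add: "x \<in> carrier Qcyc \<Longrightarrow> y \<in> carrier Qcyc \<Longrightarrow> qcyc_embed (x \<oplus>\<^bsub>Qcyc\<^esub> y) = qcyc_embed x + qcyc_embed y"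
  and qcyc_embed_one: "qcyc_embed \<one>\<^bsub>Qcyc\<^esub> = 1"
  and qcyc_embed_bij: "bij_betw qcyc_embed (carrier Qcyc) cyclo"
  using ring_iso_memE[OF qcyc_embed_iso] by auto

lemma cring_Qcyc: "cring Qcyc"
  unfolding Qcyc_def by (rule ideal.quotient_is_cring[OF cyc_ideal_ideal cring_group_ring])

lemma group_ring_coset: "x \<in> cyc_ideal +>\<^bsub>group_ring\<^esub> f \<longleftrightarrow> (\<exists>a\<in>cyc_ideal. x = a + f)"
  by (auto simp: a_r_coset_def')

lemma qcyc_embed_coset: "qcyc_embed (cyc_ideal +>\<^bsub>group_ring\<^esub> f) = group_ring_eval f"
proof -
  have "group_ring_eval ` (cyc_ideal +>\<^bsub>group_ring\<^esub> f) = {group_ring_eval f}"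
    using cyc_ideal_closed(1) by (auto simp: group_ring_coset cyc_ideal_iff image_iff)
  then show ?thesis by (simp add: qcyc_embed_def)
qed

lemma coset_in_Qcyc: "cyc_ideal +>\<^bsub>group_ring\<^esub> f \<in> carrier Qcyc"
  by (auto simp: Qcyc_def FactRing_def A_RCOSETS_def')

lemma qcyc_embed_zero: "qcyc_embed \<zero>\<^bsub>Qcyc\<^esub> = 0"
proof -
  interpret Q: cring Qcyc by (rule cring_Qcyc)
  have "qcyc_embed (\<zero>\<^bsub>Qcyc\<^esub> \<oplus>\<^bsub>Qcyc\<^esub> \<zero>\<^bsub>Qcyc\<^esub>) = qcyc_embed \<zero>\<^bsub>Qcyc\<^esub> + qcyc_embed \<zero>\<^bsub>Qcyc\<^esub>"
    by (intro qcyc_embed_add) auto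
  then show ?thesis by simp
qed

lemma qcyc_embed_zeta: "zeta q \<in> carrier Qcyc" "qcyc_embed (zeta q) = root_unity q"
  by (simp_all add: zeta_def coset_in_Qcyc qcyc_embed_coset root_unity_mod.abs_eq)

lemma qcyc_embed_of_rat: "Qcyc_of_rat q \<in> carrier Qcyc" "qcyc_embed (Qcyc_of_rat q) = of_rat q"
  by (simp_all add: Qcyc_of_rat_def coset_in_Qcyc qcyc_embed_coset root_unity_mod_0)

definition qcyc_of :: "complex \<Rightarrow> qcyc"
  where "qcyc_of = inv_into (carrier Qcyc) qcyc_embed"

lemma qcyc_of_carrier [simp]: "x \<in> cyclo \<Longrightarrow> qcyc_of x \<in> carrier Qcyc"
  unfolding qcyc_of_def using qcyc_embed_bij by (metis bij_betw_def inv_into_into)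

lemma qcyc_embed_in_cyclo [simp]: "x \<in> carrier Qcyc \<Longrightarrow> qcyc_embed x \<in> cyclo"
  using qcyc_embed_bij by (metis bij_betwE)

lemma qcyc_embed_qcyc_of [simp]: "x \<in> cyclo \<Longrightarrow> qcyc_embed (qcyc_of x) = x"
  unfolding qcyc_of_def using qcyc_embed_bij by (metis bij_betw_def f_inv_into_f)

lemma qcyc_of_qcyc_embed [simp]: "x \<in> carrier Qcyc \<Longrightarrow> qcyc_of (qcyc_embed x) = x"
  unfolding qcyc_of_def using qcyc_embed_bij by (metis bij_betw_def inv_into_f_f)

lemma qcyc_eqI: "x \<in> carrier Qcyc \<Longrightarrow> y \<in> carrier Qcyc \<Longrightarrow> qcyc_embed x = qcyc_embed y \<Longrightarrow> x = y"
  by (metis qcyc_of_qcyc_embed)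

lemma qcyc_of_mult: "x \<in> cyclo \<Longrightarrow> y \<in> cyclo \<Longrightarrow> qcyc_of (x * y) = qcyc_of x \<otimes>\<^bsub>Qcyc\<^esub> qcyc_of y"
  and qcyc_of_add: "x \<in> cyclo \<Longrightarrow> y \<in> cyclo \<Longrightarrow> qcyc_of (x + y) = qcyc_of x \<oplus>\<^bsub>Qcyc\<^esub> qcyc_of y"
  by (rule qcyc_eqI; simp add: qcyc_embed_mult qcyc_embed_add cyclo_mult cyclo_add
      cring.cring_simprules(1,5)[OF cring_Qcyc])+

lemma qcyc_of_0: "qcyc_of 0 = \<zero>\<^bsub>Qcyc\<^esub>" and qcyc_of_1: "qcyc_of 1 = \<one>\<^bsub>Qcyc\<^esub>"
  by (rule qcyc_eqI; simp add: qcyc_embed_zero qcyc_embed_one cyclo_0 cyclo_1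
      cring.cring_simprules(2,6)[OF cring_Qcyc])+

lemma qcyc_of_root_unity: "qcyc_of (root_unity q) = zeta q"
  and qcyc_of_of_rat: "qcyc_of (of_rat q) = Qcyc_of_rat q"
  by (metis qcyc_embed_zeta qcyc_of_qcyc_embed, metis qcyc_embed_of_rat qcyc_of_qcyc_embed)

lemma field_Qcyc: "field Qcyc"
proof (rule cring.cring_fieldI2[OF cring_Qcyc])
  show "\<zero>\<^bsub>Qcyc\<^esub> \<noteq> \<one>\<^bsub>Qcyc\<^esub>" using qcyc_embed_zero qcyc_embed_one by auto
next
  fix a assume a: "a \<in> carrier Qcyc" "a \<noteq> \<zero>\<^bsub>Qcyc\<^esub>"
  have "qcyc_embed a \<noteq> 0" using a qcyc_of_0 by (metis qcyc_of_qcyc_embed)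
  then have "a \<otimes>\<^bsub>Qcyc\<^esub> qcyc_of (inverse (qcyc_embed a)) = \<one>\<^bsub>Qcyc\<^esub>"
    using qcyc_of_mult[of "qcyc_embed a" "inverse (qcyc_embed a)"] a
    by (simp add: cyclo_inverse qcyc_of_1)
  then show "\<exists>b\<in>carrier Qcyc. a \<otimes>\<^bsub>Qcyc\<^esub> b = \<one>\<^bsub>Qcyc\<^esub>"
    using a by (auto intro!: bexI simp: cyclo_inverse)
qed

section \<open>Extensions of the p-adic valuation\<close>

lemma padic_valuation_of_int:
  "padic_valuation p (of_int i) = (if i = 0 then \<infinity> else ereal (real (multiplicity (int p) i)))"
  by (simp add: padic_valuation_def)

lemma padic_valuation_of_int_nonneg: "0 \<le> padic_valuation p (of_int i)"
  by (simp add: padic_valuation_of_int)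

lemma padic_valuation_of_int_pos_iff:
  assumes "Factorial_Ring.prime p"
  shows "0 < padic_valuation p (of_int i) \<longleftrightarrow> int p dvd i"
proof (cases "i = 0")
  case False
  have "0 < multiplicity (int p) i \<longleftrightarrow> int p dvd i"
    using assms False by (metis multiplicity_gt_zero_iff prime_int_nat_transfer not_prime_unit prime_nat_int_transfer)
  then show ?thesis using False by (simp add: padic_valuation_of_int)
next
  case True
  then show ?thesis using padic_valuation_of_int[of p 0] by simp
qed

lemma padic_valuation_self: "Factorial_Ring.prime p \<Longrightarrow> padic_valuation p (of_nat p) = 1"
  using padic_valuation_of_int[of p "int p"] multiplicity_prime[of "int p"] by (auto simp: prime_gt_0_nat one_ereal_def)

text \<open>An element of \<open>Val p\<close> read through \<open>qcyc_of\<close>. Nothing is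
  assumed about \<open>w\<close> outside \<open>cyclo\<close>, hence the membership premises
  throughout.\<close>

locale cyclo_valuation =
  fixes p :: nat and w :: "complex \<Rightarrow> ereal"
  assumes prime_p: "Factorial_Ring.prime p"
    and not_MInf: "x \<in> cyclo \<Longrightarrow> w x \<noteq> - \<infinity>"
    and PInf_iff: "x \<in> cyclo \<Longrightarrow> w x = \<infinity> \<longleftrightarrow> x = 0"
    and mult: "x \<in> cyclo \<Longrightarrow> y \<in> cyclo \<Longrightarrow> w (x * y) = w x + w y"
    and min_le_add: "x \<in> cyclo \<Longrightarrow> y \<in> cyclo \<Longrightarrow> min (w x) (w y) \<le> w (x + y)"
    and of_rat: "w (of_rat q) = padic_valuation p q"
begin

lemma zero [simp]: "w 0 = \<infinity>"
  using PInf_iff[OF cyclo_0] by simp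

lemma of_int: "w (of_int i) = padic_valuation p (of_int i)"
  using of_rat[of "of_int i"] by simp

lemma of_int_nonneg: "0 \<le> w (of_int i)"
  by (simp add: of_int padic_valuation_of_int_nonneg)

lemma of_int_pos_iff: "0 < w (of_int i) \<longleftrightarrow> int p dvd i"
  using padic_valuation_of_int_pos_iff[OF prime_p] by (simp add: of_int)

lemma of_nat_p: "w (of_nat p) = 1"
  using of_int[of "int p"] padic_valuation_self[OF prime_p] by simp

lemma one [simp]: "w 1 = 0"
  using of_int[of 1] padic_valuation_of_int[of p 1] by simp

lemma minus_one [simp]: "w (- 1) = 0"
proof -
  have "multiplicity (int p) (- 1) = 0"
    by (simp add: multiplicity_unit_right)
  then show ?thesis using of_int[of "-1"] padic_valuation_of_int[of p "-1"] by simp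
qed

lemma uminus: "x \<in> cyclo \<Longrightarrow> w (- x) = w x"
  using mult[OF cyclo_of_int[of "-1"], of x] by simp

lemma real_value: "x \<in> cyclo \<Longrightarrow> x \<noteq> 0 \<Longrightarrow> \<exists>r. w x = ereal r"
  using not_MInf PInf_iff by (cases "w x") auto

lemma power: "x \<in> cyclo \<Longrightarrow> w (x ^ n) = ereal (real n) * w x"
proof (induction n)
  case (Suc n)
  then show ?case
    using ereal_left_distrib[of 1 "ereal (real n)" "w x"]
    by (simp add: mult cyclo_power one_ereal_def)
qed simp

lemma add_nonneg: "x \<in> cyclo \<Longrightarrow> y \<in> cyclo \<Longrightarrow> 0 \<le> w x \<Longrightarrow> 0 \<le> w y \<Longrightarrow> 0 \<le> w (x + y)"
  and add_pos: "x \<in> cyclo \<Longrightarrow> y \<in> cyclo \<Longrightarrow> 0 < w x \<Longrightarrow> 0 < w y \<Longrightarrow> 0 < w (x + y)"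
  using min_le_add[of x y] by (auto simp: min_def split: if_splits)

lemma diff_pos: "x \<in> cyclo \<Longrightarrow> y \<in> cyclo \<Longrightarrow> 0 < w x \<Longrightarrow> 0 < w y \<Longrightarrow> 0 < w (x - y)"
  using add_pos[of x "- y"] by (simp add: uminus cyclo_uminus)

lemma mult_nonneg: "x \<in> cyclo \<Longrightarrow> y \<in> cyclo \<Longrightarrow> 0 \<le> w x \<Longrightarrow> 0 \<le> w y \<Longrightarrow> 0 \<le> w (x * y)"
  by (simp add: mult)

lemma mult_pos_left: "x \<in> cyclo \<Longrightarrow> y \<in> cyclo \<Longrightarrow> 0 < w x \<Longrightarrow> 0 \<le> w y \<Longrightarrow> 0 < w (x * y)"
  by (simp add: mult add_pos_nonneg)

lemma sum_pos: "(\<And>i. i \<in> S \<Longrightarrow> f i \<in> cyclo) \<Longrightarrow> (\<And>i. i \<in> S \<Longrightarrow> 0 < w (f i)) \<Longrightarrow> 0 < w (sum f S)"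
  by (induction S rule: infinite_finite_induct) (auto intro!: add_pos cyclo_sum)

lemma power_pos_imp_pos:
  assumes "x \<in> cyclo" "0 < w (x ^ n)"
  shows "0 < w x"
proof (rule ccontr)
  assume "\<not> 0 < w x"
  then have "w (x ^ n) \<le> 0" using power[OF assms(1), of n] not_MInf[OF assms(1)]
    by (cases "w x") (auto simp: mult_nonneg_nonpos)
  with assms show False by simp
qed

text \<open>Meant for \<eta> - 1 with \<eta> a root of unity of p-power order: a high power of it is
  p times an element of nonnegative value.\<close>

lemma pos_if_power_eq_p_mult:
  assumes "x \<in> cyclo" "y \<in> cyclo" "0 \<le> w y" "x ^ n = of_nat p * y"
  shows "0 < w x"
  using assms by (intro power_pos_imp_pos[of x n]) (auto intro: mult_pos_left cyclo_of_nat simp: of_nat_p)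

lemma unity_root:
  assumes "x \<in> cyclo" "x ^ n = 1" "n > 0"
  shows "w x = 0"
proof -
  have "ereal (real n) * w x = 0" using power[OF assms(1), of n] assms(2) by simp
  then show ?thesis using assms(3) by simp
qed

lemma root_unity [simp]: "w (root_unity q) = 0"
proof -
  obtain a b where "quotient_of q = (a, b)" by force
  then have "b > 0" "q = of_int a / of_int b" using quotient_of_denom_pos quotient_of_div by blast+
  then have "of_nat (nat b) * q = of_int a" by simp
  then have "root_unity q ^ nat b = 1" using root_unity_int[of "of_int a"] by (simp add: root_unity_power)
  then show ?thesis using \<open>b > 0\<close> by (intro unity_root[of _ "nat b"] cyclo_root_unity) auto
qed

lemma ipoly_at_nonneg: "x \<in> cyclo \<Longrightarrow> 0 \<le> w x \<Longrightarrow> 0 \<le> w (ipoly_at x A)"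
  by (induction A) (auto intro!: add_nonneg mult_nonneg of_int_nonneg intro: cyclo_closed)

end

lemma Val_iff:
  assumes "Factorial_Ring.prime p"
  shows "v \<in> Val p \<longleftrightarrow> v \<in> extensional (carrier Qcyc) \<and> cyclo_valuation p (\<lambda>x. v (qcyc_of x))"
proof -
  have all: "(\<forall>x\<in>carrier Qcyc. Q x) \<longleftrightarrow> (\<forall>x\<in>cyclo. Q (qcyc_of x))" for Q
    by (metis qcyc_embed_in_cyclo qcyc_of_carrier qcyc_of_qcyc_embed)
  have z: "qcyc_of x = \<zero>\<^bsub>Qcyc\<^esub> \<longleftrightarrow> x = 0" if "x \<in> cyclo" for x
    using that by (metis qcyc_embed_qcyc_of qcyc_embed_zero qcyc_of_0)
  show ?thesis
    unfolding Val_def valuation_on_def cyclo_valuation_def all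
    using assms z by (auto simp: qcyc_of_of_rat simp flip: qcyc_of_mult qcyc_of_add)
qed

section \<open>Polynomials over the prime field\<close>

lemma frobenius_add:
  fixes f g :: "'p::prime_card mod_ring poly"
  shows "(f + g) ^ (CARD('p) ^ n) = f ^ (CARD('p) ^ n) + g ^ (CARD('p) ^ n)"
  by (rule freshmans_dream') (simp_all add: prime_card)

lemma mod_ring_power_card_power:
  fixes c :: "'p::prime_card mod_ring"
  shows "c ^ (CARD('p) ^ n) = c"
proof (induction n)
  case (Suc n)
  have "c ^ (CARD('p) ^ Suc n) = (c ^ (CARD('p) ^ n)) ^ CARD('p)"
    by (simp add: mult.commute flip: power_mult)
  then show ?case using Suc finite_field_power_card_eq_same[of c] by simp
qed simp

text \<open>The disjunct \<open>f = 0\<close> matters for m = 0: as \<open>degree 0 = 0\<close>, the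
  bound alone would exclude the zero polynomial.\<close>

lemma bij_betw_Poly_residues:
  "bij_betw Poly {cs :: 'a::zero list. length cs = m} {f. f = 0 \<or> degree f < m}"
  unfolding bij_betw_def
proof
  show "inj_on Poly {cs :: 'a list. length cs = m}"
  proof (rule inj_onI, rule nth_equalityI)
    fix cs ds :: "'a list" and i
    assume l: "cs \<in> {cs. length cs = m}" "ds \<in> {cs. length cs = m}" and eq: "Poly cs = Poly ds"
    then show "length cs = length ds" by simp
    assume "i < length cs"
    then show "cs ! i = ds ! i"
      using l arg_cong[OF eq, of "\<lambda>f. coeff f i"] by (simp add: nth_default_nth)
  qed
  have "f \<in> Poly ` {cs. length cs = m}" if "f = 0 \<or> degree f < m" for f :: "'a poly"
    using that by (intro image_eqI[of _ _ "map (coeff f) [0..<m]"])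
      (auto simp: poly_eq_iff nth_default_def coeff_eq_0)
  moreover have "Poly cs = 0 \<or> degree (Poly cs) < length cs" for cs :: "'a list"
    using leading_coeff_0_iff[of "Poly cs"] by (force simp: nth_default_def split: if_splits)
  ultimately show "Poly ` {cs :: 'a list. length cs = m} = {f. f = 0 \<or> degree f < m}"
    by auto
qed

lemma finite_residues: "finite {f :: 'a::{zero,finite} poly. f = 0 \<or> degree f < m}"
  and card_residues: "card {f :: 'a::{zero,finite} poly. f = 0 \<or> degree f < m} = CARD('a) ^ m"
  using bij_betw_finite[OF bij_betw_Poly_residues[of m, where 'a = 'a]]
    bij_betw_same_card[OF bij_betw_Poly_residues[of m, where 'a = 'a]]
    finite_lists_length_eq[of "UNIV :: 'a set" m] card_lists_length_eq[of "UNIV :: 'a set" m]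
  by simp_all

lemma mod_in_residues:
  fixes P :: "'a::field poly"
  assumes "P \<noteq> 0"
  shows "f mod P \<in> {f. f = 0 \<or> degree f < degree P}"
  using degree_mod_less[OF assms, of f] by auto

lemma monic_dvd_degree_eq:
  fixes f g :: "'a::field poly"
  assumes "f dvd g" "monic f" "monic g" "degree f = degree g"
  shows "f = g"
proof -
  obtain h where h: "g = f * h" using assms(1) by (auto simp: dvd_def)
  then have "f \<noteq> 0" "h \<noteq> 0" using assms by auto
  then have "degree h = 0" using assms(4) h by (simp add: degree_mult_eq)
  then obtain c where "h = [:c:]" using degree_eq_zeroE by blast
  then show ?thesis using assms(2,3) h by (cases "c = 0") auto
qed

text \<open>Pigeonhole on the finitely many residues modulo \<open>P\<close>, followed by
  cancellation of the common power of \<open>f\<close>.\<close>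

lemma dvd_power_minus_one:
  fixes P f :: "'p::prime_card mod_ring poly"
  assumes "prime_elem P" "\<not> P dvd f"
  shows "\<exists>j>0. P dvd f ^ j - 1"
proof -
  have P0: "P \<noteq> 0" using assms by auto
  have "finite ((\<lambda>i. f ^ i mod P) ` UNIV)"
    by (rule finite_subset[OF _ finite_residues[of "degree P", where 'a = "'p mod_ring"]])
      (use mod_in_residues[OF P0] in blast)
  then have "\<not> inj (\<lambda>i::nat. f ^ i mod P)" using finite_imageD infinite_UNIV_nat by blast
  then obtain i j where "i < j" "f ^ i mod P = f ^ j mod P"
    by (metis (mono_tags, lifting) injI linorder_neqE_nat)
  then have "P dvd f ^ j - f ^ i" by (metis mod_eq_dvd_iff)
  also have "f ^ j - f ^ i = f ^ i * (f ^ (j - i) - 1)"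
    using \<open>i < j\<close> by (simp add: right_diff_distrib flip: power_add)
  finally have "P dvd f ^ i \<or> P dvd f ^ (j - i) - 1" using assms(1) by (simp add: prime_elem_dvd_mult_iff)
  then have "P dvd f ^ (j - i) - 1" using assms prime_elem_dvd_power by blast
  then show ?thesis using \<open>i < j\<close> by (intro exI[of _ "j - i"]) auto
qed

text \<open>Replaces the quotient ring and its multiplicative group by divisibility in the
  polynomial ring, the form in which the condition is used and verified afterwards.\<close>

lemma T_generates_mod_iff:
  fixes P :: "'p::prime_card mod_ring poly"
  assumes P: "Factorial_Ring.irreducible P"
  shows "T_generates_mod P \<longleftrightarrow> \<not> P dvd [:0, 1:] \<and> (\<forall>f. \<not> P dvd f \<longrightarrow> (\<exists>i. P dvd f - [:0, 1:] ^ i))"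
proof -
  define R :: "'p mod_ring poly ring" where "R = ring_of_type_algebra"
  define I where "I = PIdl\<^bsub>R\<^esub> P"
  define Q where "Q = R Quot I"
  define \<pi> where "\<pi> = (\<lambda>f. I +>\<^bsub>R\<^esub> f)"
  define T :: "'p mod_ring poly" where "T = [:0, 1:]"
  have prime: "prime_elem P" using P by (rule irreducible_imp_prime_elem)
  then have P0: "P \<noteq> 0" by auto
  interpret R: cring R unfolding R_def by (rule cring_from_type_algebra)
  have [simp]: "carrier R = UNIV" "\<And>x y. x \<otimes>\<^bsub>R\<^esub> y = x * y" "\<And>x y. x \<oplus>\<^bsub>R\<^esub> y = x + y" "\<one>\<^bsub>R\<^esub> = 1" "\<zero>\<^bsub>R\<^esub> = 0"
    by (simp_all add: R_def)
  have I: "f \<in> I \<longleftrightarrow> P dvd f" for f by (auto simp: I_def cgenideal_def dvd_def mult.commute)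
  interpret I: ideal I R unfolding I_def by (rule R.cgenideal_ideal) simp
  interpret Q: cring Q unfolding Q_def by (rule I.quotient_is_cring) unfold_locales
  have hom: "ring_hom_ring R Q \<pi>" unfolding Q_def \<pi>_def by (rule I.rcos_ring_hom_ring)
  interpret \<pi>: ring_hom_ring R Q \<pi> by (rule hom)
  have minus: "x \<ominus>\<^bsub>R\<^esub> y = x - y" for x y :: "'p mod_ring poly"
    using R.minus_equality[of "- y" y] by (simp add: R.minus_eq)
  have eq: "\<pi> f = \<pi> g \<longleftrightarrow> P dvd f - g" for f g
    unfolding \<pi>_def using R.quotient_eq_iff_same_a_r_cos[OF I.is_ideal, of f g] by (simp add: minus I)
  have eq0: "\<pi> f = \<zero>\<^bsub>Q\<^esub> \<longleftrightarrow> P dvd f" for f using eq[of f 0] \<pi>.hom_zero by simp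
  have carr: "carrier Q = range \<pi>" by (auto simp: Q_def FactRing_def A_RCOSETS_def' \<pi>_def)
  have pow: "\<pi> f [^]\<^bsub>Q\<^esub> (i::nat) = \<pi> (f ^ i)" for f i
  proof (induction i)
    case 0 show ?case using \<pi>.hom_one by simp
  next
    case (Suc i)
    then show ?case using \<pi>.hom_mult[of "f ^ i" f] by (simp add: mult.commute)
  qed
  have fieldQ: "field Q"
  proof (rule Q.cring_fieldI2)
    have "\<not> P dvd 1" using prime prime_elem_not_unit by blast
    then have "\<pi> 1 \<noteq> \<zero>\<^bsub>Q\<^esub>" using eq0[of 1] by blast
    moreover have "\<pi> 1 = \<one>\<^bsub>Q\<^esub>" using \<pi>.hom_one by simp
    ultimately show "\<zero>\<^bsub>Q\<^esub> \<noteq> \<one>\<^bsub>Q\<^esub>" by metis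
  next
    fix a assume a: "a \<in> carrier Q" "a \<noteq> \<zero>\<^bsub>Q\<^esub>"
    obtain f where f: "a = \<pi> f" using a(1) unfolding carr by (rule rangeE)
    have "\<not> P dvd f" using a(2) eq0[of f] f by simp
    then obtain j where j: "j > 0" "P dvd f ^ j - 1" using dvd_power_minus_one[OF prime] by blast
    have "a \<otimes>\<^bsub>Q\<^esub> \<pi> (f ^ (j - 1)) = \<pi> (f * f ^ (j - 1))" using \<pi>.hom_mult f by simp
    also have "f * f ^ (j - 1) = f ^ j" using j(1) by (cases j) auto
    also have "\<pi> (f ^ j) = \<pi> 1" using eq[of "f ^ j" 1] j(2) by blast
    also have "\<pi> 1 = \<one>\<^bsub>Q\<^esub>" using \<pi>.hom_one by simp
    finally show "\<exists>b\<in>carrier Q. a \<otimes>\<^bsub>Q\<^esub> b = \<one>\<^bsub>Q\<^esub>" unfolding carr by (rule bexI[OF _ rangeI])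
  qed
  \<comment> \<open>There are two constants \<open>mult_of\<close>. The condition uses that of
    \<open>Ring_Divisibility\<close>, the group theorem that of \<open>Multiplicative_Group\<close>;
    both unfold to the same monoid.\<close>
  define G where "G = Ring_Divisibility.mult_of Q"
  have grp: "Group.group G"
    using field.field_mult_group[OF fieldQ]
    by (simp add: G_def Ring_Divisibility.mult_of_def Multiplicative_Group.mult_of_def)
  have carrG: "carrier G = \<pi> ` {f. \<not> P dvd f}"
  proof (rule Set.set_eqI)
    fix x show "x \<in> carrier G \<longleftrightarrow> x \<in> \<pi> ` {f. \<not> P dvd f}"
      by (simp add: G_def carr image_iff) (metis eq0)
  qed
  \<comment> \<open>Finiteness allows the generated subgroup to be described by nonnegative powers
    alone.\<close>
  have "carrier Q \<subseteq> \<pi> ` {f. f = 0 \<or> degree f < degree P}"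
  proof
    fix x assume "x \<in> carrier Q"
    then obtain f where "x = \<pi> f" unfolding carr by (rule rangeE)
    also have "\<pi> f = \<pi> (f mod P)" unfolding eq by (metis dvd_minus_mod)
    finally show "x \<in> \<pi> ` {f. f = 0 \<or> degree f < degree P}"
      using mod_in_residues[OF P0, of f] by (rule image_eqI)
  qed
  then have "finite (carrier Q)" by (rule finite_subset[OF _ finite_imageI[OF finite_residues]])
  then have finG: "finite (carrier G)" by (simp add: G_def)
  have gen: "generate G {\<pi> T} = range (\<lambda>i. \<pi> (T ^ i))" if "\<not> P dvd T"
  proof -
    have "\<pi> T \<in> carrier G" using that unfolding carrG by simp
    then have "generate G {\<pi> T} = {\<pi> T [^]\<^bsub>G\<^esub> (i::nat) |i. i \<in> UNIV}"
      by (rule group.generate_pow_on_finite_carrier[OF grp finG])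
    then show ?thesis by (simp add: G_def Ring_Divisibility.nat_pow_mult_of pow full_SetCompr_eq)
  qed
  have "T_generates_mod P \<longleftrightarrow> \<pi> T \<in> carrier G \<and> generate G {\<pi> T} = carrier G"
    by (simp add: T_generates_mod_def Let_def G_def Q_def \<pi>_def I_def R_def T_def)
  also have "\<pi> T \<in> carrier G \<longleftrightarrow> \<not> P dvd T" using eq0[of T] unfolding carrG
    by (simp add: image_iff) (metis eq0)
  also have "\<not> P dvd T \<and> generate G {\<pi> T} = carrier G \<longleftrightarrow>
     \<not> P dvd T \<and> (\<forall>f. \<not> P dvd f \<longrightarrow> (\<exists>i. P dvd f - T ^ i))"
  proof (intro conj_cong refl)
    assume nT: "\<not> P dvd T"
    have "\<not> P dvd T ^ i" for i using nT prime prime_elem_dvd_power by blast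
    then have "range (\<lambda>i. \<pi> (T ^ i)) \<subseteq> carrier G" unfolding carrG by (intro image_subsetI imageI) simp
    then have "generate G {\<pi> T} = carrier G \<longleftrightarrow> (\<forall>f. \<not> P dvd f \<longrightarrow> \<pi> f \<in> range (\<lambda>i. \<pi> (T ^ i)))"
      unfolding gen[OF nT] carrG by (simp add: set_eq_subset image_subset_iff)
    then show "generate G {\<pi> T} = carrier G \<longleftrightarrow> (\<forall>f. \<not> P dvd f \<longrightarrow> (\<exists>i. P dvd f - T ^ i))"
      by (simp add: image_iff eq)
  qed
  finally show ?thesis by (simp add: T_def)
qed

text \<open>If r is the order of T modulo \<open>P\<close>, the powers of exponent below r are
  distinct and, T being a generator, exhaust the nonzero residues. Counting these determines
  r.\<close>

lemma order_of_T_generator: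
  fixes P :: "'p::prime_card mod_ring poly"
  assumes P: "Factorial_Ring.irreducible P" and T: "T_generates_mod P"
  shows "P dvd [:0, 1:] ^ (CARD('p) ^ degree P - 1) - 1"
    and "\<And>i. 0 < i \<Longrightarrow> i < CARD('p) ^ degree P - 1 \<Longrightarrow> \<not> P dvd [:0, 1:] ^ i - 1"
proof -
  define T :: "'p mod_ring poly" where "T = [:0, 1:]"
  define N where "N = CARD('p) ^ degree P - 1"
  have prime: "prime_elem P" using P by (rule irreducible_imp_prime_elem)
  then have P0: "P \<noteq> 0" by auto
  have nT: "\<not> P dvd T" and gen: "\<And>f. \<not> P dvd f \<Longrightarrow> \<exists>i. P dvd f - T ^ i"
    using T T_generates_mod_iff[OF P] by (auto simp: T_def)
  define r where "r = (LEAST j. j > 0 \<and> P dvd T ^ j - 1)"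
  have r: "r > 0" "P dvd T ^ r - 1"
    using LeastI_ex[OF dvd_power_minus_one[OF prime nT]] by (auto simp: r_def)
  have least: "\<not> P dvd T ^ i - 1" if "0 < i" "i < r" for i
    using not_less_Least[of i "\<lambda>j. j > 0 \<and> P dvd T ^ j - 1"] that by (auto simp: r_def)
  define S where "S = {f :: 'p mod_ring poly. f = 0 \<or> degree f < degree P} - {0}"
  have cardS: "card S = N"
    using card_residues[of "degree P", where 'a = "'p mod_ring"] finite_residues
    by (simp add: S_def N_def)
  have "bij_betw (\<lambda>i. T ^ i mod P) {..<r} S"
    unfolding bij_betw_def
  proof
    show "inj_on (\<lambda>i. T ^ i mod P) {..<r}"
    proof (rule linorder_inj_onI)
      fix i j assume ij: "i < j" "i \<in> {..<r}" "j \<in> {..<r}"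
      show "T ^ i mod P \<noteq> T ^ j mod P"
      proof
        assume "T ^ i mod P = T ^ j mod P"
        then have "P dvd T ^ j - T ^ i" by (metis mod_eq_dvd_iff)
        also have "T ^ j - T ^ i = T ^ i * (T ^ (j - i) - 1)"
          using ij(1) by (simp add: right_diff_distrib flip: power_add)
        finally have "P dvd T ^ i \<or> P dvd T ^ (j - i) - 1" using prime by (simp add: prime_elem_dvd_mult_iff)
        then show False using least[of "j - i"] ij nT prime prime_elem_dvd_power by fastforce
      qed
    qed auto
    show "(\<lambda>i. T ^ i mod P) ` {..<r} = S"
    proof safe
      fix i
      have "\<not> P dvd T ^ i" using nT prime prime_elem_dvd_power by blast
      then show "T ^ i mod P \<in> S"
        using mod_in_residues[OF P0, of "T ^ i"] by (auto simp: S_def mod_eq_0_iff_dvd)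
    next
      fix f assume f: "f \<in> S"
      then have fm: "f mod P = f" by (auto simp: S_def mod_poly_less)
      have "\<not> P dvd f" using f fm by (auto simp: S_def mod_eq_0_iff_dvd)
      then obtain i where "P dvd f - T ^ i" using gen by blast
      then have 1: "f = T ^ i mod P" using fm by (metis mod_eq_dvd_iff)
      have "P dvd (T ^ r) ^ (i div r) - 1"
        using r(2) by (metis dvd_trans power_diff_1_eq dvd_triv_left)
      then have "P dvd T ^ (i mod r) * ((T ^ r) ^ (i div r) - 1)" by simp
      also have "\<dots> = T ^ i - T ^ (i mod r)"
        by (simp add: right_diff_distrib flip: power_mult power_add)
      finally have "T ^ i mod P = T ^ (i mod r) mod P" by (simp add: mod_eq_dvd_iff)
      then show "f \<in> (\<lambda>i. T ^ i mod P) ` {..<r}" using 1 r(1) by auto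
    qed
  qed
  then have "r = N" using bij_betw_same_card cardS by fastforce
  then show "P dvd [:0, 1:] ^ (CARD('p) ^ degree P - 1) - 1"
    "\<And>i. 0 < i \<Longrightarrow> i < CARD('p) ^ degree P - 1 \<Longrightarrow> \<not> P dvd [:0, 1:] ^ i - 1"
    using r(2) least by (simp_all add: N_def T_def)
qed

section \<open>Characteristic polynomials of generators of finite fields\<close>

lemma (in field) finite_card_unity_roots:
  assumes "N > 0"
  shows "finite {x \<in> carrier R. x [^] N = \<one>}" "card {x \<in> carrier R. x [^] N = \<one>} \<le> N"
proof -
  \<comment> \<open>Coefficient list of X^N - 1, highest degree first.\<close>
  define q where "q = \<one> # (replicate (N - 1) \<zero> @ [\<ominus> \<one>])"
  have q: "q \<in> carrier (poly_ring R)"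
    by (auto simp: q_def univ_poly_carrier[symmetric] polynomial_def)
  have deg: "Polynomials.degree q = N" using assms by (simp add: q_def)
  have "eval q x = x [^] N \<ominus> \<one>" if x: "x \<in> carrier R" for x
  proof -
    have "eval (replicate (N - 1) \<zero> @ [\<ominus> \<one>]) x = eval [\<ominus> \<one>] x"
      using x by (intro eval_replicate) auto
    then show ?thesis using x deg by (simp add: q_def a_minus_def)
  qed
  moreover have "q \<noteq> []" by (simp add: q_def)
  ultimately have sub: "{x \<in> carrier R. x [^] N = \<one>} \<subseteq> set_mset (roots q)"
    by (auto simp: roots_mem_iff_is_root[OF q] is_root_def r_right_minus_eq)
  then show fin: "finite {x \<in> carrier R. x [^] N = \<one>}" by (rule finite_subset) simp
  have "card {x \<in> carrier R. x [^] N = \<one>} \<le> card (set_mset (roots q))"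
    using sub by (intro card_mono) auto
  also have "\<dots> = size (mset_set (set_mset (roots q)))" by simp
  also have "\<dots> \<le> size (roots q)" by (intro size_mset_mono mset_set_set_mset_msubset)
  also have "\<dots> \<le> N" using size_roots_le_degree[OF q] deg by simp
  finally show "card {x \<in> carrier R. x [^] N = \<one>} \<le> N" .
qed

text \<open>\<open>ev\<close> is evaluation of polynomials at an element \<open>ev T\<close> of
  exact multiplicative order q - 1; in the application this is the residue class of the root of
  unity. Taking a homomorphism instead of the bare element turns relations in \<open>k\<close> into
  statements on polynomials.\<close>

locale root_generator = Ring.field k for k :: "('a, 'b) ring_scheme" (structure) +
  fixes ev :: "'p::prime_card mod_ring poly \<Rightarrow> 'a" and n q :: nat and K :: "'a set"
  defines "q \<equiv> CARD('p) ^ n" and "K \<equiv> range (of_prime_field k :: 'p mod_ring \<Rightarrow> 'a)"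
  assumes ev_hom: "ev \<in> Ring.ring_hom ring_of_type_algebra k"
    and n_pos: "n > 0"
    and ev_T_power: "ev ([:0, 1:] ^ (q - 1)) = \<one>"
    and ev_T_power_neq: "\<And>i. 0 < i \<Longrightarrow> i < q - 1 \<Longrightarrow> ev ([:0, 1:] ^ i) \<noteq> \<one>"
begin

lemma ev_closed [simp]: "ev f \<in> carrier k"
  and ev_add: "ev (f + g) = ev f \<oplus> ev g"
  and ev_mult: "ev (f * g) = ev f \<otimes> ev g"
  and ev_1 [simp]: "ev 1 = \<one>"
  using ring_hom_memE[OF ev_hom] by auto

lemma ev_0 [simp]: "ev 0 = \<zero>"
proof -
  have "ev 0 \<oplus> ev 0 = ev 0 \<oplus> \<zero>" using ev_add[of 0 0] by simp
  then show ?thesis by (simp only: add.l_cancel ev_closed zero_closed)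
qed

lemma ev_uminus: "ev (- f) = \<ominus> ev f"
  using ev_add[of "- f" f] by (simp add: minus_equality)

lemma ev_diff: "ev (f - g) = ev f \<ominus> ev g"
  using ev_add[of f "- g"] by (simp add: a_minus_def ev_uminus)

lemma ev_power: "ev (f ^ i) = ev f [^] i"
  by (induction i) (simp_all add: ev_mult m_comm)

lemma ev_eq_iff: "ev f = ev g \<longleftrightarrow> ev (f - g) = \<zero>"
  by (simp add: ev_diff r_right_minus_eq)

lemma ev_dvd: "f dvd g \<Longrightarrow> ev f = \<zero> \<Longrightarrow> ev g = \<zero>"
  by (auto simp: dvd_def ev_mult)

lemma ev_sum_0: "(\<And>i. i \<in> S \<Longrightarrow> ev (f i) = \<zero>) \<Longrightarrow> ev (sum f S) = \<zero>"
  by (induction S rule: infinite_finite_induct) (auto simp: ev_add)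

abbreviation "T \<equiv> [:0, 1:] :: 'p mod_ring poly"

lemma card_gt_1: "CARD('p) > 1" 
  using prime_card[where 'a = 'p] prime_gt_1_nat by blast

lemma q_gt_1: "q > 1"
  unfolding q_def using card_gt_1 n_pos by (rule one_less_power)

text \<open>The q-th power map is additive and fixes constants, and it fixes the image of T because
  of its order.\<close>

lemma ev_power_q: "ev (f ^ q) = ev f"
proof (induction f)
  case 0
  then show ?case using q_gt_1 by (simp add: zero_power)
next
  case (pCons c f)
  have e: "pCons c f = [:c:] + T * f" by simp
  have "Suc (q - 1) = q" using q_gt_1 by simp
  then have "T ^ q = T ^ (q - 1) * T" by (simp only: power_Suc2[symmetric])
  then have 1: "ev (T ^ q) = ev T" by (simp only: ev_mult ev_T_power l_one ev_closed)
  have 2: "[:c:] ^ q = [:c:]" by (simp only: poly_const_pow q_def mod_ring_power_card_power)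
  have "pCons c f ^ q = [:c:] ^ q + T ^ q * f ^ q"
    unfolding q_def power_mult_distrib[symmetric] frobenius_add[symmetric] by simp
  then have "ev (pCons c f ^ q) = ev [:c:] \<oplus> ev T \<otimes> ev f"
    using 1 2 pCons.IH by (metis ev_add ev_mult)
  also have "\<dots> = ev (pCons c f)" unfolding ev_mult[symmetric] ev_add[symmetric] by simp
  finally show ?case .
qed

definition E :: "'a set" where "E = range ev"

lemma E_power: "x \<in> E \<Longrightarrow> x [^] q = x"
  using ev_power_q ev_power unfolding E_def by (metis rangeE)

lemma ev_T_nonzero: "ev T \<noteq> \<zero>"
proof
  assume "ev T = \<zero>"
  then have "ev (T ^ (q - 1)) = \<zero>" using q_gt_1 unfolding ev_power by (simp add: nat_pow_zero)
  then show False using ev_T_power by (metis one_not_zero)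
qed

text \<open>X^(q-1) - 1 has at most q - 1 roots in a field, and the powers of \<open>ev T\<close>
  already provide that many.\<close>

lemma unity_roots_eq: "{x \<in> carrier k. x [^] (q - 1) = \<one>} = (\<lambda>i. ev (T ^ i)) ` {..<q - 1}"
  and card_powers: "card ((\<lambda>i. ev (T ^ i)) ` {..<q - 1}) = q - 1"
proof -
  have "inj_on (\<lambda>i. ev (T ^ i)) {..<q - 1}"
  proof (rule linorder_inj_onI)
    fix i j assume ij: "i < j" "i \<in> {..<q - 1}" "j \<in> {..<q - 1}"
    have "i + (j - i) = j" using ij(1) by simp
    then have Tj: "ev (T ^ j) = ev (T ^ i) \<otimes> ev (T ^ (j - i))"
      by (simp only: power_add[symmetric] ev_mult[symmetric])
    have T0: "ev (T ^ i) \<noteq> \<zero>"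
      unfolding ev_power by (induction i) (simp_all only: nat_pow_0 nat_pow_Suc one_not_zero
        integral_iff ev_closed nat_pow_closed ev_T_nonzero not_False_eq_True simp_thms)
    have "ev (T ^ (j - i)) \<noteq> \<one>" using ij by (intro ev_T_power_neq) auto
    then have "ev (T ^ i) \<otimes> ev (T ^ (j - i)) \<noteq> ev (T ^ i) \<otimes> \<one>"
      using m_lcancel[OF T0 ev_closed ev_closed one_closed] by simp
    then show "ev (T ^ i) \<noteq> ev (T ^ j)" unfolding Tj by simp
  qed auto
  then show card: "card ((\<lambda>i. ev (T ^ i)) ` {..<q - 1}) = q - 1" by (simp add: card_image)
  have "(\<lambda>i. ev (T ^ i)) ` {..<q - 1} \<subseteq> {x \<in> carrier k. x [^] (q - 1) = \<one>}"
  proof (rule image_subsetI)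
    fix i
    have "(T ^ i) ^ (q - 1) = (T ^ (q - 1)) ^ i" unfolding power_mult[symmetric] by (simp only: mult.commute)
    then have "ev (T ^ i) [^] (q - 1) = \<one>"
      by (metis ev_T_power ev_power nat_pow_one)
    then show "ev (T ^ i) \<in> {x \<in> carrier k. x [^] (q - 1) = \<one>}" by (simp only: mem_Collect_eq ev_closed simp_thms)
  qed
  then show "{x \<in> carrier k. x [^] (q - 1) = \<one>} = (\<lambda>i. ev (T ^ i)) ` {..<q - 1}"
    using finite_card_unity_roots[of "q - 1"] q_gt_1 card by (intro card_seteq[symmetric]) auto
qed

lemma E_eq: "E = insert \<zero> ((\<lambda>i. ev (T ^ i)) ` {..<q - 1})"
proof
  show "insert \<zero> ((\<lambda>i. ev (T ^ i)) ` {..<q - 1}) \<subseteq> E"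
    using rangeI[of ev 0] unfolding E_def by (simp add: image_subset_iff)
  show "E \<subseteq> insert \<zero> ((\<lambda>i. ev (T ^ i)) ` {..<q - 1})"
  proof
    fix x assume x: "x \<in> E"
    then have xc: "x \<in> carrier k" by (auto simp: E_def)
    have "x [^] (q - 1) \<otimes> x = x"
      unfolding nat_pow_Suc[symmetric] using E_power[OF x] q_gt_1 by simp
    then have "x = \<zero> \<or> x [^] (q - 1) = \<one>"
      using xc m_rcancel[of x "x [^] (q - 1)" \<one>] by auto
    then show "x \<in> insert \<zero> ((\<lambda>i. ev (T ^ i)) ` {..<q - 1})"
      using xc unfolding unity_roots_eq[symmetric] by auto
  qed
qed

lemma card_E: "card E = q" and finite_E: "finite E"
proof -
  have "\<zero> \<notin> (\<lambda>i. ev (T ^ i)) ` {..<q - 1}"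
    unfolding unity_roots_eq[symmetric] using q_gt_1 by (auto simp: nat_pow_zero)
  then show "card E = q" "finite E" unfolding E_eq using card_powers q_gt_1 by simp_all
qed

lemma subring_E: "subring E k"
  by (rule subringI) (auto simp: E_def simp flip: ev_1 ev_uminus ev_mult ev_add)

lemma subfield_E: "subfield E k"
proof (rule subfieldI'[OF subring_E])
  fix x assume x: "x \<in> E - {\<zero>}"
  then have xc: "x \<in> carrier k" by (auto simp: E_def)
  \<comment> \<open>x^(q-1) = 1 makes x^(q-2) the inverse; for q = 2 this is x^0.\<close>
  have "x [^] (q - 2) \<otimes> x = x [^] (q - 1)"
    unfolding nat_pow_Suc[symmetric] using q_gt_1 by (simp add: Suc_diff_le numeral_2_eq_2 Suc_diff_Suc)
  also have "\<dots> = \<one>" using x unfolding E_eq unity_roots_eq[symmetric] by auto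
  finally have "inv x = x [^] (q - 2)" using xc by (intro comm_inv_char) (auto simp: m_comm)
  also have "\<dots> \<in> E" using x by (auto simp: E_def simp flip: ev_power)
  finally show "inv x \<in> E" .
qed

text \<open>By Lagrange in its multiplicative group, any subfield of q elements consists of 0 and
  (q-1)-th roots of unity, all of which lie in \<open>E\<close>; equality follows by
  counting.\<close>

lemma subfield_of_card_eq: "subfield_of_card k q = E"
  unfolding subfield_of_card_def
proof (rule the_equality)
  show "subfield E k \<and> card E = q" using subfield_E card_E by simp
next
  fix F assume F: "subfield F k \<and> card F = q"
  then interpret F: subfield F k by simp
  have fin: "finite F" using F q_gt_1 by (metis card.infinite not_one_less_zero)
  have Ff: "Ring.field (k\<lparr>carrier := F\<rparr>)" using F subfield_iff(2) by blast
  have "F \<subseteq> E"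
  proof
    fix x assume x: "x \<in> F"
    show "x \<in> E"
    proof (cases "x = \<zero>")
      case False
      interpret M: Group.group "Multiplicative_Group.mult_of (k\<lparr>carrier := F\<rparr>)"
        by (rule field.field_mult_group[OF Ff])
      have "Coset.order (Multiplicative_Group.mult_of (k\<lparr>carrier := F\<rparr>)) = q - 1"
        using F fin by (simp add: Coset.order_def Multiplicative_Group.mult_of_def subringE(2)[OF F.subring_axioms])
      then have "x [^]\<^bsub>Multiplicative_Group.mult_of (k\<lparr>carrier := F\<rparr>)\<^esub> (q - 1) = \<one>\<^bsub>Multiplicative_Group.mult_of (k\<lparr>carrier := F\<rparr>)\<^esub>"
        using M.pow_order_eq_1[of x] x False by (simp add: Multiplicative_Group.mult_of_def)
      then have "x [^] (q - 1) = \<one>"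
        by (simp add: Multiplicative_Group.mult_of_def nat_pow_def)
      then show ?thesis using x F.subset unfolding E_eq unity_roots_eq[symmetric] by auto
    qed (simp add: E_eq)
  qed
  then show "F = E" using F card_E finite_E by (intro card_subset_eq) auto
qed

text \<open>Division by \<open>f\<close> shows that residues of degree below that of
  \<open>f\<close> already map onto \<open>E\<close>, so p^n is at most p^(degree f).\<close>

lemma annihilator_degree:
  assumes "ev f = \<zero>" "f \<noteq> 0"
  shows "n \<le> degree f"
proof -
  have "E \<subseteq> ev ` {g. g = 0 \<or> degree g < degree f}"
  proof
    fix x assume "x \<in> E"
    then obtain g where g: "x = ev g" by (auto simp: E_def)
    have "x = ev (g mod f)"
      unfolding g ev_eq_iff by (rule ev_dvd[OF dvd_minus_mod assms(1)])
    then show "x \<in> ev ` {g. g = 0 \<or> degree g < degree f}"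
      using mod_in_residues[OF assms(2), of g] by (rule image_eqI)
  qed
  then have "card E \<le> card (ev ` {g. g = 0 \<or> degree g < degree f})"
    by (rule card_mono[OF finite_imageI[OF finite_residues]])
  also have "\<dots> \<le> card {g :: 'p mod_ring poly. g = 0 \<or> degree g < degree f}"
    by (rule card_image_le[OF finite_residues])
  also have "\<dots> = CARD('p) ^ degree f"
    unfolding card_residues by simp
  finally show ?thesis using power_le_imp_le_exp[OF card_gt_1] unfolding card_E q_def by blast
qed

lemma annihilator_unique:
  assumes "monic f" "degree f = n" "ev f = \<zero>"
  shows "ev g = \<zero> \<longleftrightarrow> f dvd g"
proof
  assume "ev g = \<zero>"
  have f0: "f \<noteq> 0" using assms(1) by auto
  have "ev g = ev (g mod f)" unfolding ev_eq_iff by (rule ev_dvd[OF dvd_minus_mod assms(3)])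
  then have "ev (g mod f) = \<zero>" using \<open>ev g = \<zero>\<close> by simp
  then have "g mod f = 0" using annihilator_degree[of "g mod f"] degree_mod_less[OF f0, of g] assms(2) by linarith
  then show "f dvd g" by (simp add: mod_eq_0_iff_dvd)
qed (use assms(3) ev_dvd in blast)

lemma annihilator_eqI:
  assumes "monic f" "degree f = n" "ev f = \<zero>" "monic g" "degree g = n" "ev g = \<zero>"
  shows "f = g"
  using assms annihilator_unique[of f g] by (intro monic_dvd_degree_eq) auto

lemma annihilator_irreducible:
  assumes "monic f" "degree f = n" "ev f = \<zero>"
  shows "Factorial_Ring.irreducible f"
proof (rule Factorial_Ring.irreducibleI)
  show f0: "f \<noteq> 0" using assms(1) by auto
  show "\<not> is_unit f" using f0 assms(2) n_pos by (simp add: is_unit_iff_degree)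
  fix a b assume ab: "f = a * b"
  then have ne: "a \<noteq> 0" "b \<noteq> 0" using f0 by auto
  have "ev a = \<zero> \<or> ev b = \<zero>" using assms(3) ab integral[of "ev a" "ev b"] by (simp add: ev_mult)
  then have "n \<le> degree a \<or> n \<le> degree b" using annihilator_degree ne by blast
  moreover have "n = degree a + degree b" using ab ne assms(2) by (simp add: degree_mult_eq)
  ultimately show "is_unit a \<or> is_unit b" using ne by (auto simp: is_unit_iff_degree)
qed

lemma annihilator_T_generates:
  assumes "monic f" "degree f = n" "ev f = \<zero>"
  shows "T_generates_mod f"
  unfolding T_generates_mod_iff[OF annihilator_irreducible[OF assms]] annihilator_unique[OF assms, symmetric]
proof (intro conjI allI impI ev_T_nonzero)
  fix g assume "ev g \<noteq> \<zero>"
  moreover have "ev g \<in> E" by (simp add: E_def)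
  ultimately obtain i where "ev g = ev (T ^ i)" unfolding E_eq by auto
  then show "\<exists>i. ev (g - T ^ i) = \<zero>" using ev_eq_iff by blast
qed

section \<open>Linear algebra over the prime field\<close>

lemma of_prime_field_eq: "of_prime_field k c = ev [:c:]"
proof -
  have nat: "ev (of_nat m) = [m] \<cdot> \<one>" for m :: nat
    by (induction m) (simp_all add: ev_add a_comm)
  obtain m where m: "to_int_mod_ring c = int m"
    using range_to_int_mod_ring[where 'a = 'p] by (metis atLeastLessThan_iff nonneg_int_cases rangeI)
  have "[:c:] = of_nat m"
    using m by (metis of_int_mod_ring_to_int_mod_ring of_int_of_int_mod_ring of_int_of_nat_eq of_nat_poly)
  then show ?thesis by (simp add: of_prime_field_def m nat add_pow_int_ge)
qed

lemma const_hom_0: "ev [:c:] = \<zero> \<longleftrightarrow> c = 0"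
proof
  assume "ev [:c:] = \<zero>"
  then show "c = 0" using annihilator_degree[of "[:c:]"] n_pos by fastforce
qed simp

lemma card_K: "card K = CARD('p)"
proof -
  have "inj (of_prime_field k :: 'p mod_ring \<Rightarrow> 'a)"
  proof (rule injI)
    fix c d :: "'p mod_ring" assume "of_prime_field k c = of_prime_field k d"
    then have "ev ([:c:] - [:d:]) = \<zero>" by (simp add: of_prime_field_eq ev_eq_iff)
    then show "c = d" using const_hom_0[of "c - d"] by simp
  qed
  then show ?thesis by (simp add: card_image K_def)
qed

lemma K_eq: "K = range (\<lambda>c. ev [:c:])"
  by (simp add: K_def of_prime_field_eq)

lemma subfield_K: "subfield K k"
proof (rule subfieldI')
  show "subring K k"
  proof (rule subringI)
    show "\<one> \<in> K" unfolding K_eq by (rule range_eqI[of _ _ 1]) (simp flip: one_pCons)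
    fix x assume "x \<in> K" then obtain c where "x = ev [:c:]" by (auto simp: K_eq)
    then show "\<ominus> x \<in> K" unfolding K_eq by (intro range_eqI[of _ _ "- c"]) (simp flip: ev_uminus)
  next
    fix x y assume "x \<in> K" "y \<in> K" then obtain c d where "x = ev [:c:]" "y = ev [:d:]" by (auto simp: K_eq)
    then have "x \<otimes> y = ev [:c * d:]" "x \<oplus> y = ev [:c + d:]"
      by (simp_all add: mult.commute flip: ev_mult ev_add)
    then show "x \<otimes> y \<in> K" "x \<oplus> y \<in> K" unfolding K_eq by auto
  next
    show "K \<subseteq> carrier k" by (auto simp: K_eq)
  qed
next
  fix x assume "x \<in> K - {\<zero>}"
  then obtain c where c: "x = ev [:c:]" and "x \<noteq> \<zero>" by (auto simp: K_eq)
  then have c0: "c \<noteq> 0" by auto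
  have "[:c:] * [:inverse c:] = 1" using c0 by (simp add: one_pCons)
  then have "inv x = ev [:inverse c:]" unfolding c by (intro comm_inv_char) (auto simp flip: ev_mult)
  then show "inv x \<in> K" by (simp add: K_eq)
qed

lemma combine_ev:
  fixes c :: "nat \<Rightarrow> 'p mod_ring"
  shows "combine (map (\<lambda>i. of_prime_field k (c i)) [0..<m]) (map (\<lambda>i. ev (b i)) [0..<m]) = ev (\<Sum>i<m. [:c i:] * b i)"
proof (induction m arbitrary: c b)
  case (Suc m)
  have s: "map f [0..<Suc m] = f 0 # map (\<lambda>i. f (Suc i)) [0..<m]" for f :: "nat \<Rightarrow> 'z"
    by (simp add: map_upt_Suc del: upt_Suc)
  show ?case
    unfolding s sum.lessThan_Suc_shift ev_add combine.simps Suc.IH ev_mult of_prime_field_eq[of "c 0"] ..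
qed simp

text \<open>Coordinates identify \<open>E\<close> with the lists of this length over the prime
  field; comparing cardinalities determines the length.\<close>

lemma independent_length:
  assumes "independent K bs" "Span K bs = E"
  shows "length bs = n"
proof -
  have bsc: "set bs \<subseteq> carrier k" using independent_in_carrier[OF assms(1)] .
  have "bij_betw (\<lambda>cs. combine cs bs) {cs. set cs \<subseteq> K \<and> length cs = length bs} E"
    unfolding bij_betw_def
  proof
    have comb: "combine cs bs \<in> Span K bs" if "set cs \<subseteq> K" for cs
      using that Span_eq_combine_set[OF subfield_K bsc] by blast
    show "inj_on (\<lambda>cs. combine cs bs) {cs. set cs \<subseteq> K \<and> length cs = length bs}"
      using unique_decomposition[OF subfield_K assms(1)] comb by (intro inj_onI) blast
    show "(\<lambda>cs. combine cs bs) ` {cs. set cs \<subseteq> K \<and> length cs = length bs} = E"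
      unfolding assms(2)[symmetric] using unique_decomposition[OF subfield_K assms(1)] comb by blast
  qed
  then have "card {cs. set cs \<subseteq> K \<and> length cs = length bs} = q" using card_E by (simp add: bij_betw_same_card)
  then have "CARD('p) ^ length bs = CARD('p) ^ n" using card_lists_length_eq[of K "length bs"] card_K by (simp add: K_def q_def)
  then show ?thesis using card_gt_1 by simp
qed

text \<open>
  The vector of the \<open>bs ! i\<close> is an eigenvector of \<open>A\<close> for \<open>ev T\<close>, so \<open>ev\<close> annihilates the row vector
  of their preimages times \<open>T - A\<close>; multiplying by the adjugate gives the claim.
\<close>

lemma char_poly_annihilates:
  fixes A :: "'p mod_ring mat"
  assumes ind: "independent K bs" and span: "Span K bs = E"
    and A: "A \<in> carrier_mat (length bs) (length bs)"
    and mult: "\<And>j. j < length bs \<Longrightarrow> ev T \<otimes> bs ! j =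
      combine (map (\<lambda>i. of_prime_field k (A $$ (i, j))) [0..<length bs]) bs"
  shows "ev (char_poly A) = \<zero>"
proof -
  have len: "length bs = n" using independent_length[OF ind span] .
  have bsc: "set bs \<subseteq> carrier k" using independent_in_carrier[OF ind] .
  have "set bs \<subseteq> E" using Span_base_incl[OF subfield_K bsc] span by simp
  then have "\<forall>i<n. \<exists>b. bs ! i = ev b" unfolding E_def by (metis len nth_mem rangeE subsetD)
  then obtain b where b: "\<And>i. i < n \<Longrightarrow> bs ! i = ev (b i)" by metis
  have bs: "bs = map (\<lambda>i. ev (b i)) [0..<n]" by (rule nth_equalityI) (auto simp: len b)
  define M where "M = char_poly_matrix A"
  have M: "M \<in> carrier_mat n n" using A len by (simp add: M_def)
  have Mij: "M $$ (i, j) = (if i = j then T else 0) - [:A $$ (i, j):]" if "i < n" "j < n" for i j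
    using that A len by (auto simp: M_def char_poly_matrix_def)
  define D where "D = (\<lambda>j. \<Sum>i<n. b i * M $$ (i, j))"
  have D: "ev (D j) = \<zero>" if j: "j < n" for j
  proof -
    have "D j = (\<Sum>i<n. (if i = j then T * b j else 0) - [:A $$ (i, j):] * b i)"
      unfolding D_def using j by (intro sum.cong) (auto simp: Mij right_diff_distrib mult.commute)
    also have "\<dots> = T * b j - (\<Sum>i<n. [:A $$ (i, j):] * b i)"
      using j by (simp add: sum_subtractf del: mult_pCons_left)
    finally have "ev (D j) = ev T \<otimes> bs ! j \<ominus> combine (map (\<lambda>i. of_prime_field k (A $$ (i, j))) [0..<n]) bs"
      unfolding bs combine_ev using j by (simp only: ev_diff ev_mult nth_map length_upt nth_upt diff_zero add_0)
    then show ?thesis using mult[of j] j len by (metis b ev_closed ev_mult r_right_minus_eq)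
  qed
  \<comment> \<open>Column 0 of M adj(M) = det(M) isolates \<open>b 0\<close>, whose image under
    \<open>ev\<close> is a basis vector, hence nonzero and cancellable.\<close>
  have "(\<Sum>j<n. D j * adj_mat M $$ (j, 0)) = b 0 * char_poly A"
  proof -
    have adj: "adj_mat M \<in> carrier_mat n n" "M * adj_mat M = det M \<cdot>\<^sub>m 1\<^sub>m n" using adj_mat[OF M] by auto
    have "(\<Sum>j<n. D j * adj_mat M $$ (j, 0)) = (\<Sum>j<n. \<Sum>i<n. b i * (M $$ (i, j) * adj_mat M $$ (j, 0)))"
      by (simp add: D_def sum_distrib_right mult.assoc)
    also have "\<dots> = (\<Sum>i<n. \<Sum>j<n. b i * (M $$ (i, j) * adj_mat M $$ (j, 0)))" by (rule sum.swap)
    also have "\<dots> = (\<Sum>i<n. b i * (M * adj_mat M) $$ (i, 0))"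
      using M adj(1) n_pos by (intro sum.cong) (auto simp: scalar_prod_def sum_distrib_left atLeast0LessThan)
    also have "\<dots> = (\<Sum>i<n. if i = 0 then b 0 * det M else 0)"
      unfolding adj(2) using n_pos by (intro sum.cong) auto
    also have "\<dots> = b 0 * det M" using n_pos by simp
    finally show ?thesis by (simp add: char_poly_def M_def)
  qed
  moreover have "ev (\<Sum>j<n. D j * adj_mat M $$ (j, 0)) = \<zero>"
    by (rule ev_sum_0) (simp add: ev_mult D)
  ultimately have "ev (b 0) \<otimes> ev (char_poly A) = \<zero>" by (simp add: ev_mult)
  moreover have "ev (b 0) \<noteq> \<zero>"
  proof -
    obtain u us where us: "bs = u # us" using len n_pos by (cases bs) auto
    have "u \<notin> Span K us" using ind unfolding us by (rule independent_backwards(1))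
    moreover have "\<zero> \<in> Span K us"
      using subgroup.one_closed[OF Span_is_add_subgroup[OF subfield_K, of us]] bsc us by simp
    ultimately show ?thesis using b[of 0] n_pos us by auto
  qed
  ultimately show ?thesis using integral by fastforce
qed

lemma exists_mult_matrix:
  obtains bs and A :: "'p mod_ring mat" where "independent K bs" "Span K bs = E" "A \<in> carrier_mat (length bs) (length bs)"
    "\<forall>j<length bs. ev T \<otimes> bs ! j =
      combine (map (\<lambda>i. of_prime_field k (A $$ (i, j))) [0..<length bs]) bs"
proof -
  \<comment> \<open>\<open>E\<close> is finite, so a list of all its elements spans it; a basis is
    filtered from that list.\<close>
  obtain us where us: "set us = E" using finite_E finite_list by blast
  then have usc: "set us \<subseteq> carrier k" by (auto simp: E_def)
  have Span_us: "Span K us = E"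
  proof
    show "E \<subseteq> Span K us" using Span_base_incl[OF subfield_K usc] us by simp
    show "Span K us \<subseteq> E"
    proof (rule Span_min[OF subfield_K usc])
      show "subgroup E (add_monoid k)" using subring.axioms(1)[OF subring_E] .
      show "K <#> set us \<subseteq> E"
        by (auto simp: set_mult_def us E_def K_eq simp flip: ev_mult)
    qed
  qed
  obtain bs where bs: "set bs \<subseteq> carrier k" "independent K bs" "Span K bs = E"
    using filter_base[OF subfield_K usc] Span_us by metis
  have "\<exists>c :: nat \<Rightarrow> 'p mod_ring. ev T \<otimes> bs ! j = combine (map (\<lambda>i. of_prime_field k (c i)) [0..<length bs]) bs"
    if j: "j < length bs" for j
  proof -
    have "bs ! j \<in> E" using Span_base_incl[OF subfield_K bs(1)] bs(3) j nth_mem by blast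
    then have "ev T \<otimes> bs ! j \<in> Span K bs" unfolding bs(3) E_def by (auto simp flip: ev_mult)
    then obtain cs where cs: "set cs \<subseteq> K" "length cs = length bs" "ev T \<otimes> bs ! j = combine cs bs"
      using unique_decomposition[OF subfield_K bs(2)] by blast
    have "\<forall>i<length bs. \<exists>c. cs ! i = of_prime_field k (c :: 'p mod_ring)"
      using cs(1,2) unfolding K_def by (metis nth_mem rangeE subsetD)
    then obtain c where "\<And>i. i < length bs \<Longrightarrow> cs ! i = of_prime_field k (c i :: 'p mod_ring)" by metis
    then have "cs = map (\<lambda>i. of_prime_field k (c i)) [0..<length bs]"
      using cs(2) by (intro nth_equalityI) auto
    then show ?thesis using cs(3) by blast
  qed
  then obtain c :: "nat \<Rightarrow> nat \<Rightarrow> 'p mod_ring" where c: "\<And>j. j < length bs \<Longrightarrow> ev T \<otimes> bs ! j = combine (map (\<lambda>i. of_prime_field k (c j i)) [0..<length bs]) bs"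
    by metis
  define A where "A = mat (length bs) (length bs) (\<lambda>(i, j). c j i)"
  have "ev T \<otimes> bs ! j = combine (map (\<lambda>i. of_prime_field k (A $$ (i, j))) [0..<length bs]) bs" if j: "j < length bs" for j
  proof -
    have "map (\<lambda>i. of_prime_field k (A $$ (i, j))) [0..<length bs] = map (\<lambda>i. of_prime_field k (c j i)) [0..<length bs]"
      using j by (auto simp: A_def)
    then show ?thesis using c[OF j] by metis
  qed
  then show ?thesis using that[OF bs(2,3), of A] by (simp add: A_def)
qed

text \<open>Every admissible basis and matrix yields a monic annihilator of degree n, and there is
  only one such polynomial. This settles the definite description without comparing matrices under a
  change of basis.\<close>

lemma mult_char_poly_props:
  defines "P \<equiv> mult_char_poly k E (ev T) :: 'p mod_ring poly"
  shows "monic P" "degree P = n" "ev P = \<zero>"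
proof -
  have char: "monic (char_poly A) \<and> degree (char_poly A) = n \<and> ev (char_poly A) = \<zero>"
    if "independent K bs" "Span K bs = E" "A \<in> carrier_mat (length bs) (length bs)"
      "\<forall>j<length bs. ev T \<otimes> bs ! j = combine (map (\<lambda>i. of_prime_field k (A $$ (i, j))) [0..<length bs]) bs"
    for bs and A :: "'p mod_ring mat"
    using degree_monic_char_poly[OF that(3)] char_poly_annihilates[OF that(1-3)] that(4) independent_length[OF that(1,2)]
    by simp
  obtain bs and A :: "'p mod_ring mat" where *: "independent K bs" "Span K bs = E" "A \<in> carrier_mat (length bs) (length bs)"
    "\<forall>j<length bs. ev T \<otimes> bs ! j = combine (map (\<lambda>i. of_prime_field k (A $$ (i, j))) [0..<length bs]) bs"
    by (rule exists_mult_matrix)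
  have "P = char_poly A"
    unfolding P_def mult_char_poly_def K_def[symmetric]
  proof (rule the_equality, goal_cases)
    case 1 show ?case using * by blast
  next
    case (2 P')
    then obtain bs' A' where "independent K bs'" "Span K bs' = E" "A' \<in> carrier_mat (length bs') (length bs')"
      "\<forall>j<length bs'. ev T \<otimes> bs' ! j = combine (map (\<lambda>i. of_prime_field k (A' $$ (i, j))) [0..<length bs']) bs'"
      "P' = char_poly A'" by blast
    then show ?case using char[of bs' A'] char[of bs A] * annihilator_eqI by blast
  qed
  then show "monic P" "degree P = n" "ev P = \<zero>" using char[of bs A] * by auto
qed

end

section \<open>Residue fields\<close>

locale field_valuation = Ring.field K for K :: "'a ring" (structure) +
  fixes v :: "'a \<Rightarrow> ereal"
  assumes val: "valuation_on K v"
begin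

lemma v_not_MInf: "x \<in> carrier K \<Longrightarrow> v x \<noteq> - \<infinity>"
  and v_PInf_iff: "x \<in> carrier K \<Longrightarrow> v x = \<infinity> \<longleftrightarrow> x = \<zero>"
  and v_mult: "x \<in> carrier K \<Longrightarrow> y \<in> carrier K \<Longrightarrow> v (x \<otimes> y) = v x + v y"
  and v_add: "x \<in> carrier K \<Longrightarrow> y \<in> carrier K \<Longrightarrow> min (v x) (v y) \<le> v (x \<oplus> y)"
  using val by (auto simp: valuation_on_def)

lemma v_zero [simp]: "v \<zero> = \<infinity>"
  using v_PInf_iff by simp

lemma v_one [simp]: "v \<one> = 0"
proof -
  have "v \<one> = v \<one> + v \<one>" using v_mult[of \<one> \<one>] by simp
  moreover have "v \<one> \<noteq> \<infinity>" "v \<one> \<noteq> - \<infinity>" using v_PInf_iff v_not_MInf by auto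
  ultimately show ?thesis by (cases "v \<one>") auto
qed

lemma v_uminus: assumes x: "x \<in> carrier K" shows "v (\<ominus> x) = v x"
proof -
  have "v (\<ominus> \<one>) + v (\<ominus> \<one>) = 0" using v_mult[of "\<ominus> \<one>" "\<ominus> \<one>"] by (simp add: l_minus r_minus)
  then have "v (\<ominus> \<one>) = 0" by (cases "v (\<ominus> \<one>)") auto
  then show ?thesis using v_mult[of "\<ominus> \<one>" x] x by (simp add: l_minus)
qed

abbreviation "\<O> \<equiv> valuation_ring K v"
abbreviation "\<mm> \<equiv> valuation_ideal K v"

lemma O_simps: "carrier \<O> = {x \<in> carrier K. 0 \<le> v x}" "monoid.mult \<O> = monoid.mult K" "add \<O> = add K"
    "\<one>\<^bsub>\<O>\<^esub> = \<one>" "\<zero>\<^bsub>\<O>\<^esub> = \<zero>"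
  by (simp_all add: valuation_ring_def)

lemma v_add_nonneg: "x \<in> carrier K \<Longrightarrow> y \<in> carrier K \<Longrightarrow> 0 \<le> v x \<Longrightarrow> 0 \<le> v y \<Longrightarrow> 0 \<le> v (x \<oplus> y)"
  and v_add_pos: "x \<in> carrier K \<Longrightarrow> y \<in> carrier K \<Longrightarrow> 0 < v x \<Longrightarrow> 0 < v y \<Longrightarrow> 0 < v (x \<oplus> y)"
  using v_add[of x y] by (auto simp: min_def split: if_splits)

lemma cring_O: "cring \<O>"
proof -
  have "subring {x \<in> carrier K. 0 \<le> v x} K"
    by (rule subringI) (auto simp: v_uminus v_mult v_add_nonneg)
  then show ?thesis
    unfolding valuation_ring_def using subcring_iff subcringI' subringE(1) by metis
qed

lemma ideal_m: "ideal \<mm> \<O>"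
proof (rule idealI)
  show "ring \<O>" using cring_O cring.axioms(1) by blast
  interpret O: cring \<O> by (rule cring_O)
  show "subgroup \<mm> (add_monoid \<O>)"
  proof (rule O.add.subgroupI)
    show "\<mm> \<subseteq> carrier \<O>" by (auto simp: valuation_ideal_def O_simps)
    show "\<mm> \<noteq> {}" using zero_closed v_zero by (auto simp: valuation_ideal_def intro!: exI[of _ \<zero>])
    fix a assume a: "a \<in> \<mm>"
    then have "a \<in> carrier \<O>" "a \<in> carrier K" by (auto simp: valuation_ideal_def O_simps)
    then have "\<ominus>\<^bsub>\<O>\<^esub> a \<oplus> a = \<zero>" "\<ominus>\<^bsub>\<O>\<^esub> a \<in> carrier K"
      using O.l_neg O.a_inv_closed by (simp_all add: O_simps)
    then have "\<ominus>\<^bsub>\<O>\<^esub> a = \<ominus> a" using \<open>a \<in> carrier K\<close> by (simp add: minus_equality)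
    then show "\<ominus>\<^bsub>\<O>\<^esub> a \<in> \<mm>" using a by (simp add: valuation_ideal_def v_uminus)
  next
    fix a b assume "a \<in> \<mm>" "b \<in> \<mm>"
    then show "a \<oplus>\<^bsub>\<O>\<^esub> b \<in> \<mm>" by (auto simp: valuation_ideal_def O_simps v_add_pos)
  qed
  fix a x assume "a \<in> \<mm>" "x \<in> carrier \<O>"
  then have "a \<in> carrier K" "x \<in> carrier K" "0 < v a" "0 \<le> v x" by (auto simp: valuation_ideal_def O_simps)
  then show "x \<otimes>\<^bsub>\<O>\<^esub> a \<in> \<mm>" "a \<otimes>\<^bsub>\<O>\<^esub> x \<in> \<mm>"
    by (auto simp: valuation_ideal_def O_simps v_mult add_pos_nonneg add_nonneg_pos)
qed

lemma maximalideal_m: "maximalideal \<mm> \<O>"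
proof (rule maximalidealI[OF ideal_m])
  have "\<one> \<in> carrier \<O>" "\<one> \<notin> \<mm>" by (auto simp: O_simps valuation_ideal_def)
  then show "carrier \<O> \<noteq> \<mm>" by blast
next
  fix J assume J: "ideal J \<O>" "\<mm> \<subseteq> J" "J \<subseteq> carrier \<O>"
  show "J = \<mm> \<or> J = carrier \<O>"
  proof (cases "J = \<mm>")
    case False
    then obtain x where x: "x \<in> J" "x \<notin> \<mm>" using J(2) by blast
    then have xK: "x \<in> carrier K" "0 \<le> v x" using J(3) by (auto simp: O_simps)
    then have vx: "v x = 0" using x(2) by (auto simp: valuation_ideal_def)
    then have x0: "x \<noteq> \<zero>" by auto
    then have inv: "inv x \<in> carrier K" "x \<otimes> inv x = \<one>"
      using xK(1) field_Units by auto
    then have "v (inv x) = 0" using v_mult[of x "inv x"] xK vx by simp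
    then have "inv x \<in> carrier \<O>" using inv(1) by (simp add: O_simps)
    then have "x \<otimes>\<^bsub>\<O>\<^esub> inv x \<in> J" using x(1) ideal.I_r_closed[OF J(1)] by blast
    then have "\<one>\<^bsub>\<O>\<^esub> \<in> J" using inv(2) by (simp add: O_simps)
    then show ?thesis using ideal.one_imp_carrier[OF J(1)] by blast
  qed simp
qed

lemma field_residue: "Ring.field (residue_field K v)"
  unfolding residue_field_def by (rule maximalideal.quotient_is_field[OF maximalideal_m cring_O])

lemma residue_class_hom: "residue_class K v \<in> Ring.ring_hom \<O> (residue_field K v)"
  unfolding residue_field_def residue_class_def[abs_def] by (rule ideal.rcos_ring_hom[OF ideal_m])

lemma residue_class_eq_zero_iff:
  assumes x: "x \<in> carrier K" "0 \<le> v x"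
  shows "residue_class K v x = \<zero>\<^bsub>residue_field K v\<^esub> \<longleftrightarrow> 0 < v x"
proof -
  interpret O: cring \<O> by (rule cring_O)
  have z: "\<zero>\<^bsub>residue_field K v\<^esub> = \<mm>" by (simp add: residue_field_def FactRing_def)
  have xO: "x \<in> carrier \<O>" using x by (simp add: O_simps)
  have "residue_class K v x = \<mm> \<longleftrightarrow> x \<in> \<mm>"
  proof
    assume "residue_class K v x = \<mm>"
    then show "x \<in> \<mm>"
      unfolding residue_class_def by (rule ideal.rcos_const_imp_mem[OF ideal_m xO])
  next
    assume "x \<in> \<mm>"
    then show "residue_class K v x = \<mm>"
      unfolding residue_class_def
      using O.a_coset_join2[OF xO additive_subgroup.a_subgroup[OF ideal.axioms(1)[OF ideal_m]]] by blast
  qed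
  then show ?thesis using x unfolding z by (simp add: valuation_ideal_def)
qed

end

section \<open>The subfield generated by roots of unity of order prime to p\<close>

lemma qcyc_embed_pow: "x \<in> carrier Qcyc \<Longrightarrow> qcyc_embed (x [^]\<^bsub>Qcyc\<^esub> (m::nat)) = qcyc_embed x ^ m"
proof (induction m)
  interpret Q: Ring.field Qcyc by (rule field_Qcyc)
  case (Suc m)
  then show ?case by (simp add: qcyc_embed_mult mult.commute)
qed (simp add: qcyc_embed_one)

lemma field_Qcyc_prime_to: "Ring.field (Qcyc_prime_to p)"
  and Qcyc_prime_to_subset: "carrier (Qcyc_prime_to p) \<subseteq> carrier Qcyc"
proof -
  interpret Q: Ring.field Qcyc by (rule field_Qcyc)
  define S where "S = {x \<in> carrier Qcyc. \<exists>n>0. coprime n p \<and> x [^]\<^bsub>Qcyc\<^esub> n = \<one>\<^bsub>Qcyc\<^esub>}"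
  have S: "S \<subseteq> carrier Qcyc" by (auto simp: S_def)
  show "Ring.field (Qcyc_prime_to p)" "carrier (Qcyc_prime_to p) \<subseteq> carrier Qcyc"
    using Q.generate_field_is_field[OF S] Q.generate_field_incl[OF S]
    by (simp_all add: Qcyc_prime_to_def S_def)
qed

lemma ipoly_at_in_Qcyc_prime_to:
  assumes "0 < N" "coprime N p" "z \<in> cyclo" "z ^ N = 1"
  shows "qcyc_of (ipoly_at z A) \<in> carrier (Qcyc_prime_to p)"
proof -
  interpret Q: Ring.field Qcyc by (rule field_Qcyc)
  define G where "G = carrier (Qcyc_prime_to p)"
  have one: "qcyc_of 1 \<in> G" by (simp add: G_def Qcyc_prime_to_def qcyc_of_1 generate_field.one)
  have add: "qcyc_of (x + y) \<in> G" if "x \<in> cyclo" "y \<in> cyclo" "qcyc_of x \<in> G" "qcyc_of y \<in> G" for x y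
    using that by (simp add: G_def Qcyc_prime_to_def qcyc_of_add generate_field.eng_add)
  have mult: "qcyc_of (x * y) \<in> G" if "x \<in> cyclo" "y \<in> cyclo" "qcyc_of x \<in> G" "qcyc_of y \<in> G" for x y
    using that by (simp add: G_def Qcyc_prime_to_def qcyc_of_mult generate_field.eng_mult)
  have minus: "qcyc_of (- x) \<in> G" if x: "x \<in> cyclo" "qcyc_of x \<in> G" for x
  proof -
    have "qcyc_of (- x) \<oplus>\<^bsub>Qcyc\<^esub> qcyc_of x = \<zero>\<^bsub>Qcyc\<^esub>"
      using x by (simp add: cyclo_uminus qcyc_of_0 flip: qcyc_of_add)
    then have "qcyc_of (- x) = \<ominus>\<^bsub>Qcyc\<^esub> qcyc_of x"
      using x cyclo_uminus by (simp add: Q.minus_equality)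
    then show ?thesis using x by (simp add: G_def Qcyc_prime_to_def generate_field.a_inv)
  qed
  have zero: "qcyc_of 0 \<in> G"
    using add[OF cyclo_1 cyclo_uminus[OF cyclo_1]] minus[OF cyclo_1] one by simp
  have nat: "qcyc_of (of_nat m) \<in> G" for m
    by (induction m) (auto intro: zero one add cyclo_1 cyclo_of_nat)
  have int: "qcyc_of (of_int c) \<in> G" for c
  proof (cases c)
    case (nonneg m) then show ?thesis using nat by simp
  next
    case (neg m)
    then show ?thesis using minus[OF cyclo_of_nat nat, of "Suc m"] by simp
  qed
  have "qcyc_of z [^]\<^bsub>Qcyc\<^esub> N = \<one>\<^bsub>Qcyc\<^esub>"
    using assms(3,4) by (intro qcyc_eqI) (auto simp: qcyc_embed_pow qcyc_embed_one)
  then have z: "qcyc_of z \<in> G"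
    using assms unfolding G_def Qcyc_prime_to_def by (auto intro!: generate_field.incl)
  have "qcyc_of (ipoly_at z A) \<in> G"
    by (induction A) (auto intro!: zero add mult int z cyclo_of_int cyclo_mult cyclo_ipoly_at assms)
  then show ?thesis by (simp add: G_def)
qed

section \<open>Reduction of integer polynomials modulo p\<close>

lemma red_eq_0_iff:
  "of_int_poly A = (0 :: 'p::prime_card mod_ring poly) \<longleftrightarrow> (\<exists>B. A = of_nat CARD('p) * B)"
proof
  assume A: "of_int_poly A = (0 :: 'p mod_ring poly)"
  have "int CARD('p) dvd coeff A i" for i
  proof -
    have "of_int (coeff A i) = (0 :: 'p mod_ring)"
      using arg_cong[OF A, of "\<lambda>f. coeff f i"] by (simp add: coeff_map_poly)
    then show ?thesis by (simp add: of_int_eq_0_iff_char_dvd)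
  qed
  then have "[:int CARD('p):] dvd A" by (simp add: const_poly_dvd_iff)
  then show "\<exists>B. A = of_nat CARD('p) * B" by (auto simp: dvd_def of_nat_poly)
next
  assume "\<exists>B. A = of_nat CARD('p) * B"
  then obtain B where B: "A = of_nat CARD('p) * B" by blast
  have "coeff A i = int CARD('p) * coeff B i" for i
    by (simp add: B of_nat_poly)
  then show "of_int_poly A = (0 :: 'p mod_ring poly)"
    by (intro poly_eqI) (simp add: coeff_map_poly of_int_eq_0_iff_char_dvd)
qed

lemma red_hom:
  "of_int_poly (A + B) = (of_int_poly A + of_int_poly B :: 'a::comm_ring_1 poly)"
  "of_int_poly (A - B) = (of_int_poly A - of_int_poly B :: 'a::comm_ring_1 poly)"
  "of_int_poly (A * B) = (of_int_poly A * of_int_poly B :: 'a::comm_ring_1 poly)"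
  "of_int_poly (A ^ m) = (of_int_poly A ^ m :: 'a::comm_ring_1 poly)"
  "of_int_poly 1 = (1 :: 'a::comm_ring_1 poly)"
  "of_int_poly [:0, 1:] = ([:0, 1:] :: 'a::comm_ring_1 poly)"
  by (simp_all add: of_int_poly_hom.hom_add of_int_poly_hom.hom_mult of_int_poly_hom.hom_minus
      of_int_poly_hom.hom_power map_poly_pCons)

lemma of_int_poly_pcompose:
  "of_int_poly (pcompose A B) = (pcompose (of_int_poly A) (of_int_poly B) :: 'a::comm_ring_1 poly)"
  by (induction A) (auto simp: pcompose_pCons red_hom of_int_hom.map_poly_pCons_hom)

lemma of_int_poly_sum: "of_int_poly (sum f S) = (\<Sum>i\<in>S. of_int_poly (f i) :: 'a::comm_ring_1 poly)"
  by (induction S rule: infinite_finite_induct) (auto simp: red_hom)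

lemma of_int_poly_prod: "of_int_poly (prod f S) = (\<Prod>i\<in>S. of_int_poly (f i) :: 'a::comm_ring_1 poly)"
  by (induction S rule: infinite_finite_induct) (auto simp: red_hom)

lemma of_int_poly_of_nat: "of_int_poly (of_nat m) = (of_nat m :: 'a::comm_ring_1 poly)"
  by (induction m) (auto simp: red_hom)

lemma of_int_poly_monom: "of_int_poly (Polynomial.monom 1 m) = ([:0, 1:] ^ m :: 'a::comm_ring_1 poly)"
proof -
  have "Polynomial.monom 1 m = ([:0, 1:] ^ m :: int poly)" by (simp add: monom_altdef)
  then show ?thesis by (simp only: red_hom)
qed

text \<open>A mere section of the reduction: it respects sums and products only modulo p.\<close>

definition lift_poly :: "'p::prime_card mod_ring poly \<Rightarrow> int poly"
  where "lift_poly f = map_poly to_int_mod_ring f"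

lemma red_lift_poly [simp]: "of_int_poly (lift_poly f) = (f :: 'p::prime_card mod_ring poly)"
  by (intro poly_eqI) (simp add: lift_poly_def coeff_map_poly of_int_of_int_mod_ring)

abbreviation zcyc :: "nat \<Rightarrow> nat \<Rightarrow> complex"
  where "zcyc p n \<equiv> root_unity (1 / of_nat (p ^ n - 1))"

lemma zeta_order:
  assumes "Factorial_Ring.prime (p::nat)" "n > 0"
  shows "p ^ n - 1 > 0" "coprime (p ^ n - 1) p" "zcyc p n ^ (p ^ n - 1) = 1"
proof -
  have p: "p > 1" using assms prime_gt_1_nat by blast
  have 1: "p ^ n > 1" by (rule one_less_power[OF p assms(2)])
  then show *: "p ^ n - 1 > 0" by simp
  have "coprime (p ^ n - 1) (p ^ n)" using p by (intro coprime_diff_one_left_nat) auto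
  then show "coprime (p ^ n - 1) p" using assms(2) by simp
  show "zcyc p n ^ (p ^ n - 1) = 1" using * root_unity_inverse_power by blast
qed

text \<open>If x = 1 in the residue field, then so are all its powers, and reducing 1 + x + ... +
  x^(N-1) = 0 gives N = 0 there, although p does not divide N. Thus roots of unity of order prime to
  p keep their exact order under reduction.\<close>

lemma (in cyclo_valuation) unity_root_minus_one:
  assumes "x \<in> cyclo" "x ^ N = 1" "x \<noteq> 1" "coprime N p"
  shows "\<not> 0 < w (x - 1)"
proof
  assume pos: "0 < w (x - 1)"
  have wx: "0 \<le> w x"
  proof (cases "N = 0")
    case False then show ?thesis using unity_root[of x N] assms by simp
  next
    case True then show ?thesis using assms(4) prime_p by simp
  qed
  have wxj: "0 \<le> w (x ^ j)" for j using wx by (simp add: power assms(1))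
  have "0 < w (x ^ j - 1)" for j
  proof -
    have "x ^ j - 1 = (x - 1) * (\<Sum>i<j. x ^ i)" by (simp add: power_diff_1_eq)
    moreover have "0 \<le> w (\<Sum>i<j. x ^ i)"
      by (induction j) (auto intro!: add_nonneg cyclo_sum cyclo_power assms(1) wxj)
    ultimately show ?thesis
      using pos by (auto intro!: mult_pos_left cyclo_diff cyclo_1 cyclo_sum cyclo_power assms(1))
  qed
  then have "0 < w (\<Sum>j<N. x ^ j - 1)"
    by (intro sum_pos) (auto intro!: cyclo_diff cyclo_power cyclo_1 assms(1))
  moreover have "(\<Sum>j<N. x ^ j) = 0"
    using assms(2,3) power_diff_1_eq[of x N] by simp
  ultimately have "0 < w (- of_nat N)" by (simp add: sum_subtractf)
  then have "0 < w (of_int (int N))" by (simp add: uminus cyclo_of_nat)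
  then have "int p dvd int N" using of_int_pos_iff by blast
  then show False using assms(4) prime_p by (metis coprime_absorb_left coprime_commute int_dvd_int_iff not_prime_unit)
qed

lemma field_valuation_restrict:
  assumes "v \<in> Val p"
  shows "field_valuation (Qcyc_prime_to p) v"
proof -
  have "valuation_on (Qcyc_prime_to p) v"
    using assms Qcyc_prime_to_subset[of p]
    by (auto simp: Val_def valuation_on_def Qcyc_prime_to_def subset_iff)
  then show ?thesis
    by (simp add: field_valuation_def field_valuation_axioms_def field_Qcyc_prime_to)
qed

text \<open>The last clause is the link between valuation and polynomials on which both injectivity
  and surjectivity rest. Sending A to the residue class of A(\<zeta>) kills p, so it factors through
  the polynomials over the prime field and becomes an instance of
  \<open>root_generator\<close>.\<close>

lemma char_poly_seq_props:
  fixes v :: "qcyc \<Rightarrow> ereal"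
  assumes p: "CARD('p::prime_card) = p" and v: "v \<in> Val p" and n: "n > 0"
  defines "P \<equiv> char_poly_seq p v n :: 'p mod_ring poly"
  shows "monic P" "degree P = n" "Factorial_Ring.irreducible P" "T_generates_mod P"
    and "0 < v (qcyc_of (ipoly_at (zcyc p n) A)) \<longleftrightarrow> P dvd of_int_poly A"
proof -
  have prime: "Factorial_Ring.prime p" using prime_card[where 'a = 'p] p by simp
  define K where "K = Qcyc_prime_to p"
  define w where "w = (\<lambda>x. v (qcyc_of x))"
  define N where "N = p ^ n - 1"
  define z where "z = zcyc p n"
  have N: "N > 0" "coprime N p" "z ^ N = 1" using zeta_order[OF prime n] by (simp_all add: N_def z_def)
  have z: "z \<in> cyclo" by (simp add: z_def cyclo_root_unity)
  interpret w: cyclo_valuation p w using v Val_iff[OF prime] by (simp add: w_def)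
  interpret V: field_valuation K v unfolding K_def by (rule field_valuation_restrict[OF v])
  define k where "k = residue_field K v"
  interpret k: Ring.field k unfolding k_def by (rule V.field_residue)
  interpret O: cring "valuation_ring K v" by (rule V.cring_O)
  define el where "el = (\<lambda>A. qcyc_of (ipoly_at z A))"
  have el_K: "el A \<in> carrier K" for A
    unfolding el_def K_def using ipoly_at_in_Qcyc_prime_to[OF N(1,2) z N(3)] .
  have v_el: "0 \<le> v (el A)" for A
    using w.ipoly_at_nonneg[OF z, of A] by (simp add: el_def w_def z_def) (metis w.root_unity w_def order_refl)
  have el_O: "el A \<in> carrier (valuation_ring K v)" for A
    using el_K v_el by (simp add: V.O_simps)
  have el_hom: "el (A + B) = el A \<oplus>\<^bsub>K\<^esub> el B" "el (A * B) = el A \<otimes>\<^bsub>K\<^esub> el B" "el 1 = \<one>\<^bsub>K\<^esub>" for A B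
    using z by (simp_all add: el_def K_def Qcyc_prime_to_def qcyc_of_add qcyc_of_mult qcyc_of_1 cyclo_ipoly_at)
  define h where "h = (\<lambda>A. residue_class K v (el A))"
  have hom: "residue_class K v \<in> Ring.ring_hom (valuation_ring K v) k"
    unfolding k_def by (rule V.residue_class_hom)
  have h_closed: "h A \<in> carrier k" for A
    unfolding h_def by (rule ring_hom_memE(1)[OF hom el_O])
  have h_add: "h (A + B) = h A \<oplus>\<^bsub>k\<^esub> h B" for A B
    unfolding h_def el_hom using ring_hom_memE(3)[OF hom el_O[of A] el_O[of B]] by (simp add: V.O_simps)
  have h_mult: "h (A * B) = h A \<otimes>\<^bsub>k\<^esub> h B" for A B
    unfolding h_def el_hom using ring_hom_memE(2)[OF hom el_O[of A] el_O[of B]] by (simp add: V.O_simps)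
  have h_1: "h 1 = \<one>\<^bsub>k\<^esub>"
    unfolding h_def el_hom using ring_hom_memE(4)[OF hom] by (simp add: V.O_simps)
  have h_0_iff: "h A = \<zero>\<^bsub>k\<^esub> \<longleftrightarrow> 0 < w (ipoly_at z A)" for A
    using V.residue_class_eq_zero_iff[OF el_K v_el, of A] by (simp only: h_def k_def w_def el_def)
  \<comment> \<open>Polynomials congruent modulo p have values differing by p times an element of
    nonnegative value.\<close>
  have h_red: "h A = h B" if "of_int_poly A = (of_int_poly B :: 'p mod_ring poly)" for A B
  proof -
    have "of_int_poly (A - B) = (0 :: 'p mod_ring poly)" using that by (simp add: red_hom)
    then obtain C where C: "A - B = of_nat p * C" unfolding red_eq_0_iff p by blast
    have "0 < w (of_nat p * ipoly_at z C)"
      using z by (intro w.mult_pos_left w.ipoly_at_nonneg cyclo_of_nat cyclo_ipoly_at)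
        (simp_all add: w.of_nat_p z_def)
    then have "h (A - B) = \<zero>\<^bsub>k\<^esub>" unfolding h_0_iff C by simp
    then have "h ((A - B) + B) = h B" unfolding h_add using h_closed by simp
    then show ?thesis by simp
  qed
  define ev where "ev = (\<lambda>f :: 'p mod_ring poly. h (lift_poly f))"
  have ev_red: "ev (of_int_poly A) = h A" for A
    unfolding ev_def by (rule h_red) simp
  have ev_hom: "ev \<in> Ring.ring_hom ring_of_type_algebra k"
  proof (rule ring_hom_memI)
    fix f g :: "'p mod_ring poly"
    show "ev f \<in> carrier k" unfolding ev_def by (rule h_closed)
    have "ev (f * g) = h (lift_poly f * lift_poly g)" unfolding ev_def by (rule h_red) (simp add: red_hom)
    then show "ev (f \<otimes>\<^bsub>ring_of_type_algebra\<^esub> g) = ev f \<otimes>\<^bsub>k\<^esub> ev g" unfolding h_mult by (simp only: ev_def ring_of_type_algebra_simps)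
    have "ev (f + g) = h (lift_poly f + lift_poly g)" unfolding ev_def by (rule h_red) (simp add: red_hom)
    then show "ev (f \<oplus>\<^bsub>ring_of_type_algebra\<^esub> g) = ev f \<oplus>\<^bsub>k\<^esub> ev g" unfolding h_add by (simp only: ev_def ring_of_type_algebra_simps)
  next
    have "ev 1 = h 1" unfolding ev_def by (rule h_red) (simp add: red_hom)
    then show "ev \<one>\<^bsub>ring_of_type_algebra\<^esub> = \<one>\<^bsub>k\<^esub>" unfolding h_1 by (simp only: ring_of_type_algebra_simps)
  qed
  have ev_T_power: "ev ([:0, 1:] ^ i) = h ([:0, 1:] ^ i)" for i
    unfolding ev_red[symmetric] by (simp only: red_hom)
  have h_T_power_1: "h ([:0, 1:] ^ i) = \<one>\<^bsub>k\<^esub> \<longleftrightarrow> 0 < w (z ^ i - 1)" for i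
  proof -
    have "h ([:0, 1:] ^ i) = h ([:0, 1:] ^ i - 1) \<oplus>\<^bsub>k\<^esub> h 1" unfolding h_add[symmetric] by simp
    moreover have "h ([:0, 1:] ^ i - 1) = h ([:0, 1:] ^ i) \<oplus>\<^bsub>k\<^esub> h (- 1)" unfolding h_add[symmetric] by simp
    moreover have "\<zero>\<^bsub>k\<^esub> = h 1 \<oplus>\<^bsub>k\<^esub> h (- 1)" unfolding h_add[symmetric] using h_0_iff[of 0] by simp
    ultimately have "h ([:0, 1:] ^ i) = \<one>\<^bsub>k\<^esub> \<longleftrightarrow> h ([:0, 1:] ^ i - 1) = \<zero>\<^bsub>k\<^esub>"
      unfolding h_1[symmetric] by (metis k.l_zero h_closed)
    also have "\<dots> \<longleftrightarrow> 0 < w (z ^ i - 1)" unfolding h_0_iff by simp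
    finally show ?thesis .
  qed
  interpret R: root_generator k ev n "CARD('p) ^ n" "range (of_prime_field k :: 'p mod_ring \<Rightarrow> _)"
  proof (unfold_locales)
    show "ev \<in> Ring.ring_hom ring_of_type_algebra k" by (rule ev_hom)
    show "n > 0" by (rule n)
    show "ev ([:0, 1:] ^ (CARD('p) ^ n - 1)) = \<one>\<^bsub>k\<^esub>"
      unfolding ev_T_power h_T_power_1 p N_def[symmetric] N(3) by simp
    fix i assume i: "0 < i" "i < CARD('p) ^ n - 1"
    then have "z ^ i \<noteq> 1" unfolding z_def p by (rule root_unity_primitive)
    moreover have "(z ^ i) ^ N = 1" using N(3) by (metis mult.commute power_mult power_one)
    ultimately have "\<not> 0 < w (z ^ i - 1)" using w.unity_root_minus_one N(2) z cyclo_power by blast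
    then show "ev ([:0, 1:] ^ i) \<noteq> \<one>\<^bsub>k\<^esub>" unfolding ev_T_power h_T_power_1 .
  qed
  \<comment> \<open>In \<open>char_poly_seq\<close> the difference p^n - 1 is taken in the
    rationals, in \<open>zcyc\<close> in the naturals; they agree since p^n is at least 1.\<close>
  have "(1 / (of_nat p ^ n - 1) :: rat) = 1 / of_nat (p ^ n - 1)"
    using N(1) by (simp add: N_def of_nat_diff)
  then have "residue_class K v (zeta (1 / (of_nat p ^ n - 1))) = h [:0, 1:]"
    by (simp add: h_def el_def z_def qcyc_of_root_unity)
  also have "\<dots> = ev [:0, 1:]" using ev_T_power[of 1] by simp
  finally have P: "P = mult_char_poly k R.E (ev [:0, 1:])"
    using n unfolding P_def char_poly_seq_def K_def[symmetric] k_def[symmetric] R.subfield_of_card_eq[unfolded p, symmetric]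
    by simp
  note props = R.mult_char_poly_props[folded P]
  show "monic P" "degree P = n" using props by blast+
  show "Factorial_Ring.irreducible P" "T_generates_mod P"
    using R.annihilator_irreducible[OF props] R.annihilator_T_generates[OF props] by blast+
  have "P dvd of_int_poly A \<longleftrightarrow> 0 < w (ipoly_at z A)"
    unfolding R.annihilator_unique[OF props, symmetric] ev_red h_0_iff ..
  then show "0 < v (qcyc_of (ipoly_at (zcyc p n) A)) \<longleftrightarrow> P dvd of_int_poly A"
    by (simp add: w_def z_def)
qed

lemma zcyc_power:
  assumes p: "Factorial_Ring.prime p" and m: "m > 0" and n: "n > 0" and "m dvd n"
  shows "(p ^ m - 1) * ((p ^ n - 1) div (p ^ m - 1)) = p ^ n - 1"
    and "zcyc p n ^ ((p ^ n - 1) div (p ^ m - 1)) = zcyc p m"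
proof -
  obtain e where e: "n = m * e" using assms(4) by (auto simp: dvd_def)
  have "p ^ m - 1 dvd p ^ n - 1"
  proof -
    have "int (p ^ m) - 1 dvd int (p ^ m) ^ e - 1 ^ e" 
      by (metis dvd_triv_left power_diff_sumr2 power_one)
    moreover have "1 \<le> p ^ m" "1 \<le> p ^ n" using prime_gt_0_nat[OF p] by (simp_all add: Suc_leI)
    ultimately have "int (p ^ m - 1) dvd int (p ^ n - 1)" by (simp add: of_nat_diff e power_mult)
    then show ?thesis by simp
  qed
  then show 1: "(p ^ m - 1) * ((p ^ n - 1) div (p ^ m - 1)) = p ^ n - 1" by simp
  define d where "d = (p ^ n - 1) div (p ^ m - 1)"
  have "d > 0" "p ^ m - 1 > 0" using 1 zeta_order(1)[OF p n] unfolding d_def by (metis mult_0_right not_gr0, metis mult_0 not_gr0)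
  have "zcyc p n ^ d = root_unity (of_nat d / of_nat ((p ^ m - 1) * d))"
    unfolding root_unity_power 1[folded d_def] by simp
  also have "(of_nat d / of_nat ((p ^ m - 1) * d) :: rat) = 1 / of_nat (p ^ m - 1)"
    using \<open>d > 0\<close> by simp
  finally show "zcyc p n ^ ((p ^ n - 1) div (p ^ m - 1)) = zcyc p m" by (simp add: d_def)
qed

text \<open>For the third condition, a lift of P_m(T^d) evaluated at the root of level n equals the
  lift of P_m at the root of level m, whose value is positive.\<close>

lemma char_poly_seq_in_primitive_poly_seqs:
  assumes p: "CARD('p::prime_card) = p" and v: "v \<in> Val p"
  shows "(char_poly_seq p v :: nat \<Rightarrow> 'p mod_ring poly) \<in> primitive_poly_seqs p"
proof -
  have prime: "Factorial_Ring.prime p" using prime_card[where 'a = 'p] p by simp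
  define P where "P = (char_poly_seq p v :: nat \<Rightarrow> 'p mod_ring poly)"
  note props = char_poly_seq_props[OF p v, folded P_def]
  have "P \<in> extensional {1..}" by (simp add: P_def char_poly_seq_def)
  moreover have "P n dvd pcompose (P m) ([:0, 1:] ^ ((p ^ n - 1) div (p ^ m - 1)))" if n: "n \<ge> 1" and mn: "m dvd n" for m n
  proof -
    define d where "d = (p ^ n - 1) div (p ^ m - 1)"
    have m: "m > 0" using n mn by (auto simp: dvd_def intro!: Nat.gr0I)
    have "zcyc p n ^ d = zcyc p m" using zcyc_power(2)[OF prime m _ mn] n by (simp add: d_def)
    then have "ipoly_at (zcyc p n) (pcompose (lift_poly (P m)) ([:0, 1:] ^ d)) = ipoly_at (zcyc p m) (lift_poly (P m))"
      by (simp add: ipoly_at_pcompose)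
    moreover have "0 < v (qcyc_of (ipoly_at (zcyc p m) (lift_poly (P m))))"
      using props(5)[OF m, of "lift_poly (P m)"] by simp
    ultimately have "P n dvd of_int_poly (pcompose (lift_poly (P m)) ([:0, 1:] ^ d))"
      using props(5)[of n "pcompose (lift_poly (P m)) ([:0, 1:] ^ d)"] n by (simp del: One_nat_def)
    then show ?thesis by (simp add: of_int_poly_pcompose red_hom d_def)
  qed
  ultimately show ?thesis
    using props(1-4) by (auto simp: primitive_poly_seqs_def simp flip: P_def)
qed

section \<open>Uniqueness of the valuation\<close>

lemma root_unity_of_int_divide:
  assumes "N > 0"
  shows "root_unity (of_int u / of_nat N) = root_unity (1 / of_nat N) ^ nat (u mod int N)"
proof -
  have "(of_int u :: rat) = of_int (u div int N) * of_nat N + of_nat (nat (u mod int N))"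
  proof -
    have "u = (u div int N) * int N + int (nat (u mod int N))" using assms by simp
    then show ?thesis by (metis of_int_add of_int_mult of_int_of_nat_eq)
  qed
  then have "of_int u / of_nat N = of_int (u div int N) + of_nat (nat (u mod int N)) * (1 / of_nat N :: rat)"
    using assms by (simp add: add_divide_distrib)
  then show ?thesis by (simp add: root_unity_add root_unity_int root_unity_power)
qed

lemma range_ipoly_at_closed:
  assumes "a \<in> range (ipoly_at x)" "b \<in> range (ipoly_at x)"
  shows "a + b \<in> range (ipoly_at x)" "a * b \<in> range (ipoly_at x)" "a - b \<in> range (ipoly_at x)" "a ^ i \<in> range (ipoly_at x)"
  using assms by (auto simp flip: ipoly_at_simps(3-7))

lemma range_ipoly_at_of_int: "of_int i \<in> range (ipoly_at x)"
  by (metis ipoly_at_of_int rangeI)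

lemma range_ipoly_at_self: "x \<in> range (ipoly_at x)"
  by (rule range_eqI[of _ _ "[:0, 1:]"]) simp

lemma range_ipoly_at_sum: "(\<And>i. i \<in> S \<Longrightarrow> f i \<in> range (ipoly_at x)) \<Longrightarrow> sum f S \<in> range (ipoly_at x)"
  using range_ipoly_at_of_int[of 0 x]
  by (induction S rule: infinite_finite_induct) (auto intro: range_ipoly_at_closed)

lemma range_ipoly_at_ipoly_at: "y \<in> range (ipoly_at x) \<Longrightarrow> ipoly_at y A \<in> range (ipoly_at x)"
  by (auto simp flip: ipoly_at_pcompose)

text \<open>Evaluated at a root of unity \<eta> of order dividing p^k, this exhibits (\<eta> -
  1)^(p^k) as a multiple of p.\<close>

lemma poly_minus_one_power_cong:
  "\<exists>D. [:-1, 1:] ^ (CARD('p::prime_card) ^ k) = unity_poly (CARD('p) ^ k) + of_nat CARD('p) * D"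
proof -
  define q where "q = CARD('p) ^ k"
  have "of_int_poly (unity_poly q) = ([:0, 1:] ^ q - 1 :: 'p mod_ring poly)"
    by (simp add: unity_poly_def red_hom monom_altdef flip: one_pCons)
  moreover have "of_int_poly ([:-1, 1:] ^ q) = ([:0, 1:] + [:-1:] :: 'p mod_ring poly) ^ q"
    by (simp add: red_hom of_int_hom.map_poly_pCons_hom)
  moreover have "([:0, 1:] + [:-1:]) ^ q = [:0, 1:] ^ q + ([:-1 :: 'p mod_ring:] ^ q)"
    unfolding q_def by (rule frobenius_add)
  moreover have "[:-1 :: 'p mod_ring:] ^ q = - 1"
    unfolding q_def poly_const_pow mod_ring_power_card_power by (simp add: one_pCons)
  ultimately have "of_int_poly ([:-1, 1:] ^ q - unity_poly q) = (0 :: 'p mod_ring poly)"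
    by (simp add: red_hom)
  then obtain D where "[:-1, 1:] ^ q - unity_poly q = of_nat CARD('p) * D" unfolding red_eq_0_iff ..
  then have "[:-1, 1:] ^ q = unity_poly q + of_nat CARD('p) * D" by (simp only: diff_eq_eq add.commute)
  then show ?thesis unfolding q_def ..
qed

lemma of_nat_mod_ring_poly_unit:
  assumes "coprime d CARD('p::prime_card)"
  shows "is_unit (of_nat d :: 'p mod_ring poly)"
proof -
  have "(of_nat d :: 'p mod_ring) \<noteq> 0"
  proof
    assume "(of_nat d :: 'p mod_ring) = 0"
    then have "CARD('p) dvd d" by (simp add: of_nat_eq_0_iff_char_dvd)
    then show False using assms prime_card[where 'a = 'p]
      by (metis coprime_absorb_right coprime_commute not_prime_unit)
  qed
  then show ?thesis by (simp add: of_nat_poly)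
qed

text \<open>A repeated factor would divide T^N - 1 and its derivative, hence the integer N, which is
  invertible modulo p.\<close>

lemma unity_poly_separable:
  fixes P g :: "'p::prime_card mod_ring poly"
  assumes "Factorial_Ring.irreducible P" "coprime N CARD('p)"
    and "of_int_poly (unity_poly N) = P * g"
  shows "\<not> P dvd g"
proof
  assume "P dvd g"
  then obtain g' where g': "g = P * g'" by (auto simp: dvd_def)
  have prime: "prime_elem P" using assms(1) by (rule irreducible_imp_prime_elem)
  have "N > 0" using assms(2) prime_card[where 'a = 'p] by (intro Nat.gr0I) auto
  define W :: "'p mod_ring poly" where "W = of_int_poly (unity_poly N)"
  have W: "W = P * (P * g')" using assms(3) by (simp add: W_def g')
  have "of_int_poly (pderiv (unity_poly N)) = pderiv W"
    unfolding W_def by (rule of_int_hom.map_poly_pderiv)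
  moreover have "of_int_poly (of_nat N) = (of_nat N :: 'p mod_ring poly)"
    by (rule of_int_poly_of_nat)
  ultimately have eq: "[:0, 1:] * pderiv W - of_nat N * W = of_nat N"
    using arg_cong[OF unity_poly_separable_identity[OF \<open>N > 0\<close>], of "of_int_poly :: _ \<Rightarrow> 'p mod_ring poly"]
    by (simp only: red_hom W_def)
  have "P dvd pderiv W" "P dvd W" unfolding W pderiv_mult by (intro dvd_add dvd_mult2 dvd_refl)+
  then have "P dvd [:0, 1:] * pderiv W - of_nat N * W" by (intro dvd_diff dvd_mult)
  then have "P dvd of_nat N" by (simp only: eq)
  moreover have "is_unit (of_nat N :: 'p mod_ring poly)" by (rule of_nat_mod_ring_poly_unit[OF assms(2)])
  ultimately have "is_unit P" by (rule dvd_trans)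
  then show False using prime_elem_not_unit[OF prime] by blast
qed

text \<open>
  Modulo \<open>\<pi>\<close>, a uniformizer of the totally ramified part, \<open>\<int>[\<omega>]\<close> reduces to \<open>\<int>[\<zeta>]\<close>; the primes of
  \<open>\<int>[\<zeta>]\<close> above \<open>p\<close> are locally generated by \<open>p\<close> because \<open>T ^ N - 1\<close> is separable modulo \<open>p\<close>. Hence
  up to elements of value \<open>0\<close> every element of \<open>\<int>[\<omega>]\<close> is a power of \<open>\<pi>\<close>, and its value is
  determined by the prime.
\<close>

locale valuation_pair = w: cyclo_valuation p w + w': cyclo_valuation p w'
  for p w w' +
  fixes P :: "nat \<Rightarrow> 'p::prime_card mod_ring poly"
  assumes card: "CARD('p) = p"
    and irreducible: "n > 0 \<Longrightarrow> Factorial_Ring.irreducible (P n)"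
    and pos_iff: "n > 0 \<Longrightarrow> 0 < w (ipoly_at (zcyc p n) A) \<longleftrightarrow> P n dvd of_int_poly A"
    and pos_iff': "n > 0 \<Longrightarrow> 0 < w' (ipoly_at (zcyc p n) A) \<longleftrightarrow> P n dvd of_int_poly A"
begin

lemma valuation_eq_on_level:
  assumes n: "n > 0" and k: "k > 0"
  defines "\<omega> \<equiv> root_unity (1 / of_nat ((p ^ n - 1) * p ^ k))"
  assumes b: "b \<in> range (ipoly_at \<omega>)" "b \<noteq> 0"
  shows "w b = w' b"
proof -
  define N where "N = p ^ n - 1"
  define B where "B = range (ipoly_at \<omega>)"
  define z where "z = zcyc p n"
  \<comment> \<open>Exact order p^k; with \<open>k > 0\<close> the difference \<eta> - 1 is nonzero
    and will divide p.\<close>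
  define \<eta> where "\<eta> = root_unity (1 / of_nat (p ^ k))"
  define \<pi> where "\<pi> = \<eta> - 1"
  have p: "p > 1" by (rule prime_gt_1_nat[OF w.prime_p])
  have N: "N > 0" "coprime N p" "z ^ N = 1"
    unfolding N_def z_def by (rule zeta_order[OF w.prime_p n])+
  have z_cyclo: "z \<in> cyclo" and \<eta>_cyclo: "\<eta> \<in> cyclo" and \<omega>_cyclo: "\<omega> \<in> cyclo"
    unfolding z_def \<eta>_def \<omega>_def by (rule cyclo_root_unity)+
  have \<pi>_cyclo: "\<pi> \<in> cyclo" unfolding \<pi>_def by (intro cyclo_diff \<eta>_cyclo cyclo_1)
  have B_cyclo: "x \<in> cyclo" if "x \<in> B" for x
    using that cyclo_ipoly_at[OF \<omega>_cyclo] unfolding B_def by blast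
  have "w \<omega> = 0" "w' \<omega> = 0" unfolding \<omega>_def by (rule w.root_unity, rule w'.root_unity)
  then have w_B: "0 \<le> w x" "0 \<le> w' x" if "x \<in> B" for x
    using that w.ipoly_at_nonneg[OF \<omega>_cyclo] w'.ipoly_at_nonneg[OF \<omega>_cyclo] unfolding B_def by fastforce+
  note B_closed = range_ipoly_at_closed[of _ \<omega>, folded B_def]
  have B_int: "of_int i \<in> B" for i unfolding B_def by (rule range_ipoly_at_of_int)
  have B_1: "1 \<in> B" using B_int[of 1] by simp
  have \<omega>_B: "\<omega> \<in> B" unfolding B_def by (rule range_ipoly_at_self)
  have "\<omega> ^ (p ^ k) = z" "\<omega> ^ N = \<eta>"
    using p N(1) unfolding \<omega>_def z_def \<eta>_def N_def[symmetric] root_unity_power by simp_all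
  then have z_B: "z \<in> B" and \<eta>_B: "\<eta> \<in> B" using B_closed(4)[OF \<omega>_B \<omega>_B] by metis+
  have zA_B: "ipoly_at z A \<in> B" for A
    using z_B unfolding B_def by (rule range_ipoly_at_ipoly_at)
  have \<pi>_B: "\<pi> \<in> B" unfolding \<pi>_def using B_closed(3) \<eta>_B B_1 by blast
  have \<eta>_power: "\<exists>b\<in>B. \<eta> ^ i = 1 + \<pi> * b" for i
  proof
    show "(\<Sum>j<i. \<eta> ^ j) \<in> B" unfolding B_def
      by (rule range_ipoly_at_sum) (use B_closed(4)[OF \<eta>_B \<eta>_B] in \<open>simp add: B_def\<close>)
    show "\<eta> ^ i = 1 + \<pi> * (\<Sum>j<i. \<eta> ^ j)" using power_diff_1_eq[of \<eta> i] by (simp add: \<pi>_def algebra_simps)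
  qed
  define Dec where "Dec = (\<lambda>x. \<exists>C. \<exists>b\<in>B. x = ipoly_at z C + \<pi> * b)"
  have Dec: "Dec x" if "x \<in> B" for x
  proof -
    have Dec_z: "Dec (ipoly_at z C)" for C
      unfolding Dec_def using B_int[of 0] by (intro exI[of _ C] bexI[of _ 0]) auto
    have Dec_add: "Dec (x + y)" if "Dec x" "Dec y" for x y
    proof -
      from that obtain C b C' b' where "b \<in> B" "b' \<in> B" "x = ipoly_at z C + \<pi> * b" "y = ipoly_at z C' + \<pi> * b'"
        by (auto simp: Dec_def)
      then have "b + b' \<in> B" "x + y = ipoly_at z (C + C') + \<pi> * (b + b')"
        using B_closed(1) by (auto simp: algebra_simps)
      then show ?thesis unfolding Dec_def by blast
    qed
    have Dec_mult: "Dec (x * y)" if "Dec x" "Dec y" for x y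
    proof -
      from that obtain C b C' b' where *: "b \<in> B" "b' \<in> B" "x = ipoly_at z C + \<pi> * b" "y = ipoly_at z C' + \<pi> * b'"
        by (auto simp: Dec_def)
      have "ipoly_at z C * b' + b * ipoly_at z C' + \<pi> * (b * b') \<in> B"
        by (intro B_closed zA_B \<pi>_B *)
      moreover have "x * y = ipoly_at z (C * C') + \<pi> * (ipoly_at z C * b' + b * ipoly_at z C' + \<pi> * (b * b'))"
        unfolding * by (simp add: algebra_simps)
      ultimately show ?thesis unfolding Dec_def by blast
    qed
    have "Dec \<omega>"
    proof -
      \<comment> \<open>Bezout splits 1/(N p^k) as u/N + v/p^k, so \<omega> is a power of z times a
        power of \<eta>, and powers of \<eta> are 1 modulo \<pi>.\<close>
      have "coprime (int (p ^ k)) (int N)" using N(2) by (simp add: coprime_commute)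
      then obtain u v where uv: "u * int (p ^ k) + v * int N = 1"
        using bezout_int[of "int (p ^ k)" "int N"] by (metis coprime_imp_gcd_eq_1)
      have "(of_int u * of_nat (p ^ k) + of_int v * of_nat N :: rat) = 1"
        using arg_cong[OF uv, of "of_int :: int \<Rightarrow> rat"] by simp
      then have "1 / of_nat (N * p ^ k) = (of_int u / of_nat N + of_int v / of_nat (p ^ k) :: rat)"
        using N(1) p by (simp add: divide_simps mult.commute)
      then have "\<omega> = z ^ nat (u mod int N) * \<eta> ^ nat (v mod int (p ^ k))"
        using N(1) p by (simp only: \<omega>_def N_def[symmetric] root_unity_add z_def \<eta>_def root_unity_of_int_divide
            zero_less_power order.strict_trans[OF zero_less_one])
      moreover have "Dec (z ^ i)" for i using Dec_z[of "[:0, 1:] ^ i"] by simp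
      moreover have "Dec (\<eta> ^ i)" for i using \<eta>_power[of i] unfolding Dec_def by (metis ipoly_at_simps(2))
      ultimately show ?thesis using Dec_mult by metis
    qed
    moreover have "Dec (of_int i)" for i using Dec_z[of "of_int i"] by simp
    moreover have "Dec 0" using Dec_z[of 0] by simp
    ultimately have "Dec (ipoly_at \<omega> A)" for A
      by (induction A) (auto intro: Dec_add Dec_mult)
    then show ?thesis using that by (auto simp: B_def)
  qed
  have \<eta>_ord: "\<eta> ^ (p ^ k) = 1" unfolding \<eta>_def using p by (intro root_unity_inverse_power) simp
  \<comment> \<open>\<xi> has order p. Each of its powers is 1 modulo \<pi>, so the vanishing sum of
    the p powers shows that \<pi> divides p.\<close>
  define \<xi> where "\<xi> = \<eta> ^ (p ^ (k - 1))"
  have "\<xi> \<noteq> 1" unfolding \<xi>_def \<eta>_def using p k by (intro root_unity_primitive) (auto intro: power_strict_increasing)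
  have "p ^ (k - 1) * p = p ^ k" using k by (cases k) auto
  then have "\<xi> ^ p = 1" using \<eta>_ord by (simp add: \<xi>_def flip: power_mult)
  have "\<exists>\<beta>\<in>B. of_nat p = \<pi> * \<beta>"
  proof -
    have "\<exists>b\<in>B. \<xi> ^ i = 1 + \<pi> * b" for i
      unfolding \<xi>_def power_mult[symmetric] by (rule \<eta>_power)
    then obtain c where c: "\<And>i. c i \<in> B" "\<And>i. \<xi> ^ i = 1 + \<pi> * c i" by metis
    have "(\<Sum>i<p. \<xi> ^ i) = 0" using power_diff_1_eq[of \<xi> p] \<open>\<xi> ^ p = 1\<close> \<open>\<xi> \<noteq> 1\<close> by simp
    then have "of_nat p = \<pi> * (0 - (\<Sum>i<p. c i))"
      by (simp add: c(2) sum.distrib sum_distrib_left[symmetric] eq_neg_iff_add_eq_0)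
    moreover have "0 - (\<Sum>i<p. c i) \<in> B"
      using B_closed(3)[OF B_int[of 0]] range_ipoly_at_sum[of "{..<p}" c \<omega>] c(1) by (simp add: B_def)
    ultimately show ?thesis by blast
  qed
  then obtain \<beta> where \<beta>: "\<beta> \<in> B" "of_nat p = \<pi> * \<beta>" by blast
  have \<pi>0: "\<pi> \<noteq> 0" using \<beta>(2) p by auto
  obtain D where D: "[:-1, 1:] ^ (p ^ k) = unity_poly (p ^ k) + of_nat p * D"
    using poly_minus_one_power_cong[where 'p = 'p, of k] unfolding card by blast
  have \<pi>_power: "\<pi> ^ (p ^ k) = of_nat p * ipoly_at \<eta> D"
    using arg_cong[OF D, of "ipoly_at \<eta>"] \<eta>_ord by (simp add: \<pi>_def)
  have \<eta>D: "ipoly_at \<eta> D \<in> cyclo" by (rule cyclo_ipoly_at[OF \<eta>_cyclo])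
  have "0 \<le> w (ipoly_at \<eta> D)" "0 \<le> w' (ipoly_at \<eta> D)"
    by (rule w.ipoly_at_nonneg[OF \<eta>_cyclo], simp add: \<eta>_def, rule w'.ipoly_at_nonneg[OF \<eta>_cyclo], simp add: \<eta>_def)
  then have w_\<pi>: "0 < w \<pi>" and w'_\<pi>: "0 < w' \<pi>"
    using w.pos_if_power_eq_p_mult[OF \<pi>_cyclo \<eta>D] w'.pos_if_power_eq_p_mult[OF \<pi>_cyclo \<eta>D] \<pi>_power by blast+
  have reduce: "0 < w (ipoly_at z C + \<pi> * b) \<longleftrightarrow> P n dvd of_int_poly C"
    "0 < w' (ipoly_at z C + \<pi> * b) \<longleftrightarrow> P n dvd of_int_poly C" if b: "b \<in> B" for C b
  proof -
    have cyc: "ipoly_at z C \<in> cyclo" "\<pi> * b \<in> cyclo"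
      using z_cyclo b B_cyclo by (auto intro: cyclo_ipoly_at cyclo_mult \<pi>_cyclo)
    have "0 < w (\<pi> * b)" "0 < w' (\<pi> * b)"
      using w_\<pi> w'_\<pi> w_B[OF b] B_cyclo[OF b] \<pi>_cyclo by (auto intro: w.mult_pos_left w'.mult_pos_left)
    then have "0 < w (ipoly_at z C + \<pi> * b) \<longleftrightarrow> 0 < w (ipoly_at z C)"
      "0 < w' (ipoly_at z C + \<pi> * b) \<longleftrightarrow> 0 < w' (ipoly_at z C)"
      using w.add_pos[OF cyc] w.diff_pos[of "ipoly_at z C + \<pi> * b" "\<pi> * b"]
        w'.add_pos[OF cyc] w'.diff_pos[of "ipoly_at z C + \<pi> * b" "\<pi> * b"] cyc
      by (auto simp: cyclo_add)
    then show "0 < w (ipoly_at z C + \<pi> * b) \<longleftrightarrow> P n dvd of_int_poly C"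
      "0 < w' (ipoly_at z C + \<pi> * b) \<longleftrightarrow> P n dvd of_int_poly C"
      using pos_iff[OF n] pos_iff'[OF n] by (simp_all add: z_def)
  qed
  have agree: "0 < w x \<longleftrightarrow> 0 < w' x" if "x \<in> B" for x
    using Dec[OF that] reduce unfolding Dec_def by metis
  have "P n dvd of_int_poly (unity_poly N)"
    using pos_iff[OF n, of "unity_poly N"] N(3) by (simp add: z_def)
  then obtain g where g: "of_int_poly (unity_poly N) = P n * g" by (auto simp: dvd_def)
  have "\<not> P n dvd g" using unity_poly_separable[OF irreducible[OF n] _ g] N(2) by (simp add: card)
  \<comment> \<open>g is the cofactor of \<open>P n\<close> in T^N - 1 modulo p, and s has value 0
    for both valuations. If \<open>P n\<close> divides C modulo p, then g C is a multiple of T^N - 1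
    modulo p, so s C(z) is divisible by p and thus by \<pi>.\<close>
  define s where "s = ipoly_at z (lift_poly g)"
  have s_B: "s \<in> B" unfolding s_def by (rule zA_B)
  have "\<not> 0 < w s" using pos_iff[OF n, of "lift_poly g"] \<open>\<not> P n dvd g\<close> by (simp add: s_def z_def)
  then have w_s: "w s = 0" "w' s = 0" using agree[OF s_B] w_B[OF s_B] by auto
  have divide: "\<exists>b'\<in>B. s * x = \<pi> * b'" if x: "x \<in> B" "0 < w x" for x
  proof -
    obtain C b where C: "b \<in> B" "x = ipoly_at z C + \<pi> * b" using Dec[OF x(1)] by (auto simp: Dec_def)
    then obtain c where c: "of_int_poly C = P n * c" using x(2) reduce(1) by (auto simp: dvd_def)
    have "of_int_poly (lift_poly g * C - unity_poly N * lift_poly c) = (0 :: 'p mod_ring poly)"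
      by (simp add: red_hom c g)
    then obtain D where "lift_poly g * C - unity_poly N * lift_poly c = of_nat p * D"
      using red_eq_0_iff card by metis
    then have "s * ipoly_at z C = of_nat p * ipoly_at z D"
      using N(3) unfolding s_def by (metis diff_0_right diff_self ipoly_at_of_nat ipoly_at_simps(4,6) ipoly_at_unity_poly mult_zero_left)
    then have "s * x = \<pi> * (\<beta> * ipoly_at z D + s * b)"
      unfolding C \<beta>(2) by (simp add: algebra_simps)
    moreover have "\<beta> * ipoly_at z D + s * b \<in> B" by (intro B_closed \<beta> zA_B s_B C)
    ultimately show ?thesis by blast
  qed
  \<comment> \<open>Each element of positive value can be divided by \<pi> up to s, which lowers
    both values by those of \<pi>. The bound m limits the number of divisions.\<close>
  have power: "\<exists>j. w x = ereal (real j) * w \<pi> \<and> w' x = ereal (real j) * w' \<pi>"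
    if "x \<in> B" "x \<noteq> 0" "w x < ereal (real m) * w \<pi>" for m x
    using that
  proof (induction m arbitrary: x)
    case 0
    then show ?case using w_B(1)[of x] by (simp flip: zero_ereal_def)
  next
    case (Suc m)
    show ?case
    proof (cases "0 < w x")
      case False
      then have "w x = 0" "w' x = 0" using w_B Suc.prems(1) agree by (auto simp: less_le)
      then show ?thesis by (intro exI[of _ 0]) simp
    next
      case True
      obtain b' where b': "b' \<in> B" "s * x = \<pi> * b'" using divide[OF Suc.prems(1) True] by blast
      have "s \<noteq> 0" using w_s by auto
      then have "b' \<noteq> 0" using b'(2) Suc.prems(2) by auto
      note cyc = B_cyclo[OF s_B] B_cyclo[OF Suc.prems(1)] B_cyclo[OF b'(1)] \<pi>_cyclo
      have wx: "w x = w \<pi> + w b'" using arg_cong[OF b'(2), of w] cyc by (simp add: w.mult w_s)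
      have w'x: "w' x = w' \<pi> + w' b'" using arg_cong[OF b'(2), of w'] cyc by (simp add: w'.mult w_s)
      obtain r where r: "w \<pi> = ereal r" using w.real_value[OF \<pi>_cyclo \<pi>0] by blast
      obtain r' where r': "w' \<pi> = ereal r'" using w'.real_value[OF \<pi>_cyclo \<pi>0] by blast
      obtain t where t: "w b' = ereal t" using w.real_value[OF B_cyclo \<open>b' \<noteq> 0\<close>] b'(1) by blast
      have "w b' < ereal (real m) * w \<pi>" using Suc.prems(3) unfolding wx r t by (simp add: algebra_simps)
      then obtain j where j: "w b' = ereal (real j) * w \<pi>" "w' b' = ereal (real j) * w' \<pi>"
        using Suc.IH[OF b'(1) \<open>b' \<noteq> 0\<close>] by blast
      show ?thesis unfolding wx w'x j r r' by (intro exI[of _ "Suc j"]) (simp add: algebra_simps)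
    qed
  qed
  have power': "\<exists>j. w x = ereal (real j) * w \<pi> \<and> w' x = ereal (real j) * w' \<pi>" if x: "x \<in> B" "x \<noteq> 0" for x
  proof -
    obtain r where r: "w \<pi> = ereal r" using w.real_value[OF \<pi>_cyclo \<pi>0] by blast
    obtain t where t: "w x = ereal t" using w.real_value[OF B_cyclo x(2)] x(1) by blast
    have "r > 0" using w_\<pi> r by simp
    then obtain m where "t < real m * r" using reals_Archimedean3 by blast
    then have "w x < ereal (real m) * w \<pi>" by (simp add: r t)
    then show ?thesis using power[OF x] by blast
  qed
  \<comment> \<open>Applied to p itself, the normalization to value 1 gives both valuations the same
    exponent e and thereby pins down the value of \<pi>.\<close>
  have "of_nat p \<in> B" using B_int[of "int p"] by simp
  then obtain e where e: "1 = ereal (real e) * w \<pi>" "1 = ereal (real e) * w' \<pi>"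
    using power'[of "of_nat p"] p by (auto simp: w.of_nat_p w'.of_nat_p)
  have "w \<pi> = w' \<pi>"
  proof -
    obtain r where r: "w \<pi> = ereal r" using w.real_value[OF \<pi>_cyclo \<pi>0] by blast
    obtain r' where r': "w' \<pi> = ereal r'" using w'.real_value[OF \<pi>_cyclo \<pi>0] by blast
    have "real e * r = 1" "real e * r' = 1" using e unfolding r r' by (simp_all add: one_ereal_def)
    then have "r = r'" by (metis mult_cancel_left mult_zero_left zero_neq_one)
    then show ?thesis using r r' by simp
  qed
  then show ?thesis using power'[of b] b by (auto simp: B_def)
qed

text \<open>Clearing denominators leaves a polynomial in a root of unity of order M. Write M = p^j
  N0; by Euler's theorem N0 divides p^n - 1 for n = \<open>totient N0\<close>, so this root lies in
  one of the levels treated above.\<close>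

lemma valuation_eq:
  assumes x: "x \<in> cyclo"
  shows "w x = w' x"
proof (cases "x = 0")
  case False
  obtain M c A where M: "M > 0" "c \<noteq> 0" "of_int c * x = ipoly_at (root_unity (1 / of_nat M)) A"
    using cyclo_clear_denominators[OF x] .
  have p: "p > 1" using w.prime_p prime_gt_1_nat by blast
  obtain j N0 where N0: "M = p ^ j * N0" "\<not> p dvd N0"
    using multiplicity_decompose'[of M p] M(1) w.prime_p not_prime_unit by (metis less_numeral_extra(3) mult.commute)
  have N0pos: "N0 > 0" using N0(1) M(1) by (intro Nat.gr0I) auto
  have cop: "coprime p N0" using N0(2) w.prime_p by (simp add: prime_imp_coprime)
  define n where "n = totient N0"
  have n: "n > 0" using N0pos by (simp add: n_def)
  have "[p ^ n = 1] (mod N0)" unfolding n_def by (rule euler_theorem[OF cop])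
  then have "N0 dvd p ^ n - 1" by (rule cong_to_1_nat)
  then obtain d where d: "p ^ n - 1 = N0 * d" by (auto simp: dvd_def)
  \<comment> \<open>\<open>Suc j\<close> because a level needs a positive exponent of p even when p
    does not divide M; the power d p undoes the surplus.\<close>
  define \<omega> where "\<omega> = root_unity (1 / of_nat ((p ^ n - 1) * p ^ Suc j))"
  have "d > 0" using d zeta_order(1)[OF w.prime_p n] by (intro Nat.gr0I) auto
  have "root_unity (1 / of_nat M) = \<omega> ^ (d * p)"
    unfolding \<omega>_def d N0(1) root_unity_power using \<open>d > 0\<close> N0pos p by (simp add: mult.commute)
  then have "of_int c * x \<in> range (ipoly_at \<omega>)"
    using M(3) by (intro range_eqI[of _ _ "pcompose A (Polynomial.monom 1 (d * p))"]) (simp add: ipoly_at_pcompose)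
  moreover have "of_int c * x \<noteq> 0" using M(2) False by simp
  ultimately have "w (of_int c * x) = w' (of_int c * x)"
    unfolding \<omega>_def by (intro valuation_eq_on_level[OF n, of "Suc j"]) auto
  then have "w (of_int c) + w x = w' (of_int c) + w' x" using x by (simp add: w.mult w'.mult cyclo_of_int)
  moreover obtain r where "w (of_int c) = ereal r" using w.real_value[OF cyclo_of_int, of c] M(2) by auto
  moreover from this have "w' (of_int c) = ereal r" by (simp add: w.of_int w'.of_int)
  ultimately show ?thesis by (cases "w x"; cases "w' x") auto
qed simp

end

section \<open>Valuation rings\<close>

definition class_subring :: "'a::comm_ring_1 set \<Rightarrow> bool"
  where "class_subring R \<longleftrightarrow> 1 \<in> R \<and> (\<forall>x\<in>R. \<forall>y\<in>R. x - y \<in> R \<and> x * y \<in> R)"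

lemma class_subring_closed:
  assumes "class_subring R"
  shows "1 \<in> R" "0 \<in> R" "x \<in> R \<Longrightarrow> y \<in> R \<Longrightarrow> x - y \<in> R" "x \<in> R \<Longrightarrow> y \<in> R \<Longrightarrow> x * y \<in> R"
    "x \<in> R \<Longrightarrow> - x \<in> R" "x \<in> R \<Longrightarrow> y \<in> R \<Longrightarrow> x + y \<in> R"
proof -
  show 1: "1 \<in> R" and diff: "x \<in> R \<Longrightarrow> y \<in> R \<Longrightarrow> x - y \<in> R" and "x \<in> R \<Longrightarrow> y \<in> R \<Longrightarrow> x * y \<in> R" for x y
    using assms by (auto simp: class_subring_def)
  show 0: "0 \<in> R" using diff[OF 1 1] by simp
  show minus: "x \<in> R \<Longrightarrow> - x \<in> R" for x using diff[OF 0, of x] by simp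
  show "x \<in> R \<Longrightarrow> y \<in> R \<Longrightarrow> x + y \<in> R" using diff[of x "- y"] minus[of y] by simp
qed

lemma class_subring_sum: "class_subring R \<Longrightarrow> (\<And>i. i \<in> S \<Longrightarrow> f i \<in> R) \<Longrightarrow> sum f S \<in> R"
  by (induction S rule: infinite_finite_induct) (auto intro: class_subring_closed(2,6))

lemma class_subring_power: "class_subring R \<Longrightarrow> x \<in> R \<Longrightarrow> x ^ n \<in> R"
  by (induction n) (auto intro: class_subring_closed(1,4))

text \<open>Defined for arbitrary sets and monotone in \<open>R\<close>, so that the ideals
  generated by the same \<open>M\<close> in a growing family of rings can be compared.\<close>

inductive_set ideal_gen :: "'a::comm_ring_1 set \<Rightarrow> 'a set \<Rightarrow> 'a set" for M R where
  zero: "0 \<in> ideal_gen M R"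
| step: "a \<in> M \<Longrightarrow> r \<in> R \<Longrightarrow> x \<in> ideal_gen M R \<Longrightarrow> a * r + x \<in> ideal_gen M R"

lemma ideal_gen_add: "x \<in> ideal_gen M R \<Longrightarrow> y \<in> ideal_gen M R \<Longrightarrow> x + y \<in> ideal_gen M R"
  by (induction rule: ideal_gen.induct) (auto simp: add.assoc intro: ideal_gen.intros)

lemma ideal_gen_mult:
  assumes "class_subring R" "s \<in> R" "x \<in> ideal_gen M R"
  shows "s * x \<in> ideal_gen M R"
  using assms(3)
proof (induction rule: ideal_gen.induct)
  case (step a r x)
  have "s * (a * r + x) = a * (s * r) + s * x" by (simp add: algebra_simps)
  then show ?case using step class_subring_closed(4)[OF assms(1,2)] by (auto intro: ideal_gen.step)
qed (simp add: ideal_gen.zero)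

lemma ideal_gen_base: "class_subring R \<Longrightarrow> a \<in> M \<Longrightarrow> a \<in> ideal_gen M R"
  using ideal_gen.step[of a M 1 R 0] class_subring_closed(1) ideal_gen.zero by auto

lemma ideal_gen_sum: "(\<And>i. i \<in> S \<Longrightarrow> f i \<in> ideal_gen M R) \<Longrightarrow> sum f S \<in> ideal_gen M R"
  by (induction S rule: infinite_finite_induct) (auto intro: ideal_gen.zero ideal_gen_add)

lemma ideal_gen_subset:
  assumes "class_subring R" "M \<subseteq> R" "x \<in> ideal_gen M R"
  shows "x \<in> R"
  using assms(3) by (induction rule: ideal_gen.induct) (use assms(2) in \<open>auto intro!: class_subring_closed(2,4,6)[OF assms(1)]\<close>)

lemma ideal_gen_mono:
  assumes "R \<subseteq> R'" "x \<in> ideal_gen M R"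
  shows "x \<in> ideal_gen M R'"
  using assms(2) by (induction rule: ideal_gen.induct) (use assms(1) in \<open>auto intro: ideal_gen.intros\<close>)

text \<open>A combination involves finitely many coefficients, so one member of the chain contains
  them all.\<close>

lemma ideal_gen_Union:
  assumes "C \<noteq> {}" "\<And>R R'. R \<in> C \<Longrightarrow> R' \<in> C \<Longrightarrow> R \<subseteq> R' \<or> R' \<subseteq> R" "x \<in> ideal_gen M (\<Union>C)"
  shows "\<exists>R\<in>C. x \<in> ideal_gen M R"
  using assms(3)
proof (induction rule: ideal_gen.induct)
  case zero
  then show ?case using assms(1) ideal_gen.zero by blast
next
  case (step a r x)
  then obtain R R' where R: "R \<in> C" "r \<in> R" "R' \<in> C" "x \<in> ideal_gen M R'" by blast
  from assms(2)[OF R(1,3)] show ?case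
  proof
    assume "R \<subseteq> R'"
    then have "r \<in> R'" using R(2) by blast
    then show ?thesis using ideal_gen.step[OF step(1) _ R(4)] R(3) by blast
  next
    assume "R' \<subseteq> R"
    then have "x \<in> ideal_gen M R" using R(4) by (rule ideal_gen_mono)
    then show ?thesis using ideal_gen.step[OF step(1) R(2)] R(1) by blast
  qed
qed

text \<open>
  Chevalley's argument: a subring maximal among those containing \<open>R0\<close> in which \<open>M\<close> does not generate
  the unit ideal is a valuation ring. It is local because it could be enlarged by inverting \<open>1 - b\<close>,
  and if it contained neither \<open>x\<close> nor its inverse, then \<open>1\<close> would be a polynomial in each of them with
  coefficients in the ideal; such polynomials of minimal degree can be reduced against each other.
\<close>

locale maximal_subring =
  fixes M R :: "'a::field set"
  assumes subring: "class_subring R" and M_subset: "M \<subseteq> R" and proper: "1 \<notin> ideal_gen M R"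
    and maximal: "\<And>R'. class_subring R' \<Longrightarrow> R \<subseteq> R' \<Longrightarrow> 1 \<notin> ideal_gen M R' \<Longrightarrow> R' = R"
begin

abbreviation "I \<equiv> ideal_gen M R"

text \<open>Adjoin 1/s for s = 1 - b. If \<open>M\<close> generated 1 in the larger ring, clearing
  denominators would put a power of s into \<open>I\<close>, but every power of s is 1 modulo
  \<open>I\<close>. So maximality applies and 1/s is already in \<open>R\<close>.\<close>

lemma inverse_one_minus:
  assumes b: "b \<in> I"
  shows "inverse (1 - b) \<in> R"
proof -
  define s where "s = 1 - b"
  have s0: "s \<noteq> 0" using b proper by (auto simp: s_def)
  have sR: "s \<in> R" unfolding s_def
    using class_subring_closed[OF subring] ideal_gen_subset[OF subring M_subset b] by blast
  define R' where "R' = {r / s ^ j |r j. r \<in> R}"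
  have R'I: "r / s ^ j \<in> R'" if "r \<in> R" for r j using that by (auto simp: R'_def)
  have spow: "s ^ j \<in> R" for j by (rule class_subring_power[OF subring sR])
  note closed = class_subring_closed[OF subring]
  have "class_subring R'"
    unfolding class_subring_def
  proof (intro conjI ballI)
    show "1 \<in> R'" using R'I[OF closed(1), of 0] by simp
    fix x y assume "x \<in> R'" "y \<in> R'"
    then obtain r i t j where r: "r \<in> R" "t \<in> R" "x = r / s ^ i" "y = t / s ^ j" by (auto simp: R'_def)
    have "x - y = (r * s ^ j - t * s ^ i) / s ^ (i + j)" "x * y = (r * t) / s ^ (i + j)"
      using s0 by (simp_all add: r power_add field_simps)
    then show "x - y \<in> R'" "x * y \<in> R'" using r closed(3,4) spow R'I by metis+
  qed
  moreover have "R \<subseteq> R'" using R'I[of _ 0] by auto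
  moreover have "1 \<notin> ideal_gen M R'"
  proof
    assume "1 \<in> ideal_gen M R'"
    moreover have "\<exists>c\<in>I. \<exists>j. x = c / s ^ j" if "x \<in> ideal_gen M R'" for x
      using that
    proof (induction rule: ideal_gen.induct)
      case zero
      show ?case using ideal_gen.zero by (intro bexI[of _ 0]) auto
    next
      case (step a r x)
      then obtain c j t i where c: "c \<in> I" "x = c / s ^ j" "t \<in> R" "r = t / s ^ i" by (auto simp: R'_def)
      have "a * (t * s ^ j) + s ^ i * c \<in> I"
        using step(1) c closed(4) spow by (intro ideal_gen.step ideal_gen_mult[OF subring]) auto
      moreover have "a * r + x = (a * (t * s ^ j) + s ^ i * c) / s ^ (i + j)"
        using s0 by (simp add: c power_add field_simps)
      ultimately show ?case by blast
    qed
    ultimately obtain c j where "c \<in> I" "1 = c / s ^ j" by blast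
    then have "s ^ j \<in> I" using s0 by simp
    moreover have "1 - s ^ j \<in> I"
    proof -
      have "1 - s ^ j = (\<Sum>i<j. s ^ i) * b" unfolding one_diff_power_eq by (simp add: s_def mult.commute)
      then show ?thesis using ideal_gen_mult[OF subring class_subring_sum[OF subring] b] spow by metis
    qed
    ultimately have "(1 - s ^ j) + s ^ j \<in> I" by (rule ideal_gen_add[rotated])
    then show False using proper by simp
  qed
  ultimately have "R' = R" by (rule maximal)
  then show ?thesis using R'I[OF closed(1), of 1] by (simp add: s_def inverse_eq_divide)
qed

text \<open>Adjoining x enlarges \<open>R\<close> strictly, so by maximality \<open>M\<close>
  generates 1 in R[x]; collecting powers of x gives coefficients in \<open>I\<close>.\<close>

lemma poly_relation:
  assumes "x \<notin> R"
  shows "\<exists>f. (\<forall>i. coeff f i \<in> I) \<and> poly f x = 1"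
proof -
  note closed = class_subring_closed[OF subring]
  define R' where "R' = {poly f x |f. \<forall>i. coeff f i \<in> R}"
  have "class_subring R'"
    unfolding class_subring_def
  proof (intro conjI ballI)
    show "1 \<in> R'" unfolding R'_def using closed(1,2)
      by (intro CollectI exI[of _ 1]) (auto simp: coeff_1)
    fix y z assume "y \<in> R'" "z \<in> R'"
    then obtain f g where f: "\<forall>i. coeff f i \<in> R" "y = poly f x" "\<forall>i. coeff g i \<in> R" "z = poly g x"
      by (auto simp: R'_def)
    show "y - z \<in> R'" unfolding R'_def using f closed(3)
      by (intro CollectI exI[of _ "f - g"]) auto
    show "y * z \<in> R'" unfolding R'_def using f closed(4)
      by (intro CollectI exI[of _ "f * g"]) (auto simp: coeff_mult intro!: class_subring_sum[OF subring])
  qed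
  moreover have "R \<subseteq> R'"
  proof
    fix r assume "r \<in> R"
    then show "r \<in> R'" unfolding R'_def using closed(2)
      by (intro CollectI exI[of _ "[:r:]"]) (auto simp: coeff_pCons split: nat.splits)
  qed
  moreover have "x \<in> R'" unfolding R'_def using closed(1,2)
    by (intro CollectI exI[of _ "[:0, 1:]"]) (auto simp: coeff_pCons split: nat.splits)
  ultimately have "1 \<in> ideal_gen M R'" using maximal[of R'] assms by blast
  moreover have "\<exists>f. (\<forall>i. coeff f i \<in> I) \<and> y = poly f x" if "y \<in> ideal_gen M R'" for y
    using that
  proof (induction rule: ideal_gen.induct)
    case zero
    show ?case using ideal_gen.zero by (intro exI[of _ 0]) auto
  next
    case (step a r y)
    then obtain f g where "\<forall>i. coeff f i \<in> R" "r = poly f x" "\<forall>i. coeff g i \<in> I" "y = poly g x"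
      by (auto simp: R'_def)
    then show ?case using step(1)
      by (intro exI[of _ "Polynomial.smult a f + g"]) (auto intro: ideal_gen.step)
  qed
  ultimately show ?thesis by metis
qed

text \<open>As one minus the constant term of \<open>g\<close> is invertible in \<open>R\<close>,
  \<open>g\<close> expresses 1 through strictly negative powers of x. Multiplying the leading term
  of \<open>f\<close> by this expression replaces it by terms of lower degree; \<open>deg\<close>
  keeps their exponents nonnegative.\<close>

lemma reduce_relation:
  assumes x0: "x \<noteq> 0" and f: "\<And>i. coeff f i \<in> I" "poly f x = 1"
    and g: "\<And>i. coeff g i \<in> I" "poly g (inverse x) = 1"
    and deg: "degree g \<le> degree f"
  shows "\<exists>f'. ((\<forall>i. coeff f' i \<in> I) \<and> poly f' x = 1) \<and> degree f' < degree f"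
proof -
  define n where "n = degree f"
  define m where "m = degree g"
  define u where "u = inverse (1 - coeff g 0)"
  have uR: "u \<in> R" unfolding u_def by (rule inverse_one_minus[OF g(1)])
  have n0: "n > 0"
  proof (rule ccontr)
    assume "\<not> n > 0"
    then obtain c where "f = [:c:]" using n_def by (metis degree_eq_zeroE not_gr_zero)
    then show False using f(1)[of 0] f(2) proper by simp
  qed
  have ne: "1 - coeff g 0 \<noteq> 0" using g(1)[of 0] proper by auto
  have "1 = (\<Sum>j\<le>m. coeff g j * inverse x ^ j)" using g(2) by (simp add: poly_altdef m_def)
  also have "\<dots> = coeff g 0 + (\<Sum>j\<in>{1..m}. coeff g j * inverse x ^ j)"
    by (simp add: sum.atLeast1_atMost_eq sum.atMost_shift lessThan_Suc_atMost)
  finally have "(\<Sum>j\<in>{1..m}. coeff g j * inverse x ^ j) = 1 - coeff g 0" by (simp add: algebra_simps)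
  then have rel: "(\<Sum>j\<in>{1..m}. u * coeff g j * inverse x ^ j) = 1"
    using ne by (simp add: u_def mult.assoc flip: sum_distrib_left)
  define a where "a = coeff f n"
  define f' where "f' = f - Polynomial.monom a n + (\<Sum>j\<in>{1..m}. Polynomial.monom (a * u * coeff g j) (n - j))"
  have aI: "a \<in> I" by (simp add: a_def f)
  have IR: "y \<in> R" if "y \<in> I" for y using ideal_gen_subset[OF subring M_subset that] .
  have coeffI: "a * u * coeff g j \<in> I" for j
  proof -
    have "(a * u) * coeff g j \<in> I"
      by (intro ideal_gen_mult[OF subring] class_subring_closed[OF subring] IR aI uR g)
    then show ?thesis .
  qed
  have "coeff f' i \<in> I" for i
  proof -
    have "coeff (f - Polynomial.monom a n) i \<in> I"
      using f(1)[of i] by (auto simp: a_def ideal_gen.zero)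
    moreover have "coeff (Polynomial.monom (a * u * coeff g j) (n - j)) i \<in> I" for j
      using coeffI ideal_gen.zero by auto
    ultimately show ?thesis unfolding f'_def coeff_add coeff_sum by (intro ideal_gen_add ideal_gen_sum) auto
  qed
  moreover have "poly f' x = 1"
  proof -
    have "(\<Sum>j\<in>{1..m}. a * u * coeff g j * x ^ (n - j)) = a * x ^ n * (\<Sum>j\<in>{1..m}. u * coeff g j * inverse x ^ j)"
      unfolding sum_distrib_left
    proof (rule sum.cong[OF refl])
      fix j assume j: "j \<in> {1..m}"
      then have "j \<le> n" using deg by (simp add: n_def m_def)
      then have "x ^ (n - j) = x ^ n * inverse x ^ j" using x0 by (simp add: power_diff divide_inverse power_inverse)
      then show "a * u * coeff g j * x ^ (n - j) = a * x ^ n * (u * coeff g j * inverse x ^ j)"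
        by (simp add: mult_ac)
    qed
    then show ?thesis unfolding rel by (simp add: f'_def f(2) poly_sum poly_monom)
  qed
  moreover have "degree f' < n"
  proof (rule degree_lessI)
    show "f' \<noteq> 0 \<or> n > 0" using n0 by simp
    show "\<forall>i\<ge>n. coeff f' i = 0"
    proof (intro allI impI)
      fix i assume i: "i \<ge> n"
      have "coeff (f - Polynomial.monom a n) i = 0"
        using i by (cases "i = n") (auto simp: a_def n_def coeff_eq_0)
      moreover have "(\<Sum>j\<in>{1..m}. coeff (Polynomial.monom (a * u * coeff g j) (n - j)) i) = 0"
        using i n0 by (intro sum.neutral) auto
      ultimately show "coeff f' i = 0" by (simp add: f'_def coeff_sum)
    qed
  qed
  ultimately show ?thesis unfolding n_def by blast
qed

lemma valuation_ring: "x \<in> R \<or> inverse x \<in> R"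
proof (rule ccontr)
  assume neg: "\<not> (x \<in> R \<or> inverse x \<in> R)"
  then have x0: "x \<noteq> 0" using class_subring_closed(2)[OF subring] by auto
  define Q where "Q = (\<lambda>y f. (\<forall>i. coeff f i \<in> I) \<and> poly f y = 1)"
  have ex: "\<exists>f. Q x f" "\<exists>f. Q (inverse x) f" using poly_relation neg by (auto simp: Q_def)
  obtain f where f: "Q x f" "\<And>f'. Q x f' \<Longrightarrow> degree f \<le> degree f'"
    using ex(1) ex_has_least_nat[of "Q x" _ degree] by blast
  obtain g where g: "Q (inverse x) g" "\<And>g'. Q (inverse x) g' \<Longrightarrow> degree g \<le> degree g'"
    using ex(2) ex_has_least_nat[of "Q (inverse x)" _ degree] by blast
  show False
  proof (cases "degree g \<le> degree f")
    case True
    then have "\<exists>f'. Q x f' \<and> degree f' < degree f"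
      using f(1) g(1) unfolding Q_def by (intro reduce_relation[OF x0, of f g]) auto
    then show False using f(2) leD by blast
  next
    case False
    then have "\<exists>g'. Q (inverse x) g' \<and> degree g' < degree g"
      using f(1) g(1) x0 unfolding Q_def
      by (intro reduce_relation[of "inverse x" g f]) auto
    then show False using g(2) leD by blast
  qed
qed

end

lemma exists_maximal_subring:
  fixes R0 M :: "'a::field set"
  assumes R0: "class_subring R0" and M: "M \<subseteq> R0" and proper: "1 \<notin> ideal_gen M R0"
  obtains R where "R0 \<subseteq> R" "maximal_subring M R"
proof -
  define S where "S = {R. class_subring R \<and> R0 \<subseteq> R \<and> 1 \<notin> ideal_gen M R}"
  have "\<exists>R\<in>S. \<forall>R'\<in>S. R \<subseteq> R' \<longrightarrow> R' = R"
  proof (rule subset_Zorn_nonempty)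
    show "S \<noteq> {}" using assms by (auto simp: S_def)
    fix C assume C: "C \<noteq> {}" "subset.chain S C"
    then have CS: "C \<subseteq> S" and chain: "\<And>R R'. R \<in> C \<Longrightarrow> R' \<in> C \<Longrightarrow> R \<subseteq> R' \<or> R' \<subseteq> R"
      by (auto simp: subset_chain_def)
    have "class_subring (\<Union>C)"
      unfolding class_subring_def
    proof (intro conjI ballI)
      show "1 \<in> \<Union>C" using C(1) CS class_subring_closed(1) by (auto simp: S_def)
      fix x y assume "x \<in> \<Union>C" "y \<in> \<Union>C"
      then obtain R where R: "R \<in> C" "x \<in> R" "y \<in> R" using chain by blast
      then have "class_subring R" using CS by (auto simp: S_def)
      then show "x - y \<in> \<Union>C" "x * y \<in> \<Union>C" using R class_subring_closed(3,4) by blast+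
    qed
    moreover have "R0 \<subseteq> \<Union>C" using C(1) CS by (auto simp: S_def)
    moreover have "1 \<notin> ideal_gen M (\<Union>C)" using ideal_gen_Union[OF C(1) chain] CS by (auto simp: S_def)
    ultimately show "\<Union>C \<in> S" by (simp add: S_def)
  qed
  then obtain R where R: "R \<in> S" "\<And>R'. R' \<in> S \<Longrightarrow> R \<subseteq> R' \<Longrightarrow> R' = R" by blast
  then have "maximal_subring M R"
    using M by unfold_locales (auto simp: S_def)
  then show ?thesis using that R(1) by (auto simp: S_def)
qed

section \<open>From the maximal subring to a real-valued valuation\<close>

locale maximal_subring_over = maximal_subring M R for M R :: "complex set" +
  fixes p :: nat
  assumes prime_p: "Factorial_Ring.prime p" and p_in_M: "of_nat p \<in> M"
begin

definition units :: "complex set"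
  where "units = {x. x \<noteq> 0 \<and> x \<in> R \<and> inverse x \<in> R}"

lemmas closed = class_subring_closed[OF subring]

lemma I_subset: "x \<in> I \<Longrightarrow> x \<in> R"
  by (rule ideal_gen_subset[OF subring M_subset])

lemma units_mult: "x \<in> units \<Longrightarrow> y \<in> units \<Longrightarrow> x * y \<in> units"
  and units_inverse: "x \<in> units \<Longrightarrow> inverse x \<in> units"
  and units_1: "1 \<in> units"
  using closed(1,4) by (auto simp: units_def)

lemma units_power: "x \<in> units \<Longrightarrow> x ^ n \<in> units"
  by (induction n) (auto intro: units_1 units_mult)

lemma units_divide: "x \<in> units \<Longrightarrow> y \<in> units \<Longrightarrow> x / y \<in> units"
  unfolding divide_inverse by (intro units_mult units_inverse)

lemma I_not_unit: "x \<in> I \<Longrightarrow> x \<notin> units"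
proof
  assume x: "x \<in> I" "x \<in> units"
  then have "inverse x * x \<in> I" by (intro ideal_gen_mult[OF subring]) (simp_all add: units_def)
  moreover have "x \<noteq> 0" using x(2) by (simp add: units_def)
  ultimately show False using proper by simp
qed

lemma p_in_I: "of_nat p \<in> I"
  using ideal_gen_base[OF subring p_in_M] .

lemma p_nonzero [simp]: "p \<noteq> 0"
  using prime_p by auto

lemma of_int_in_R: "of_int i \<in> R"
proof -
  have nat: "of_nat n \<in> R" for n by (induction n) (auto intro: closed)
  show ?thesis by (cases i) (auto simp del: of_nat_Suc intro: nat closed)
qed

text \<open>From s c + t p = 1 the product s c = 1 - t p is invertible, since t p lies in
  \<open>I\<close>.\<close>

lemma of_int_in_units:
  assumes "\<not> int p dvd c"
  shows "of_int c \<in> units"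
proof -
  have "Factorial_Ring.prime (int p)" using prime_p by simp
  then have "coprime c (int p)" using prime_imp_coprime[OF _ assms] by (simp add: coprime_commute)
  then obtain s t where st: "s * c + t * int p = 1"
    using bezout_int[of c "int p"] by (metis coprime_imp_gcd_eq_1)
  have "of_int t * of_nat p \<in> I" by (rule ideal_gen_mult[OF subring of_int_in_R p_in_I])
  then have "inverse (1 - of_int t * of_nat p) \<in> R" by (rule inverse_one_minus)
  moreover have e: "1 - of_int t * of_nat p = (of_int s * of_int c :: complex)"
    using arg_cong[OF st, of "of_int :: int \<Rightarrow> complex"] by (simp add: algebra_simps)
  moreover have c0: "c \<noteq> 0" using assms by auto
  moreover have "of_int s \<noteq> (0 :: complex)"
  proof
    assume "of_int s = (0 :: complex)"
    then have "of_int t * of_nat p = (1 :: complex)" using e by simp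
    then show False using \<open>of_int t * of_nat p \<in> I\<close> proper by simp
  qed
  ultimately have "of_int s * inverse (of_int s * of_int c) \<in> R" using of_int_in_R closed(4) by metis
  moreover have "of_int s * inverse (of_int s * of_int c) = inverse (of_int c :: complex)"
    using \<open>of_int s \<noteq> (0 :: complex)\<close> c0 by (simp add: divide_simps)
  ultimately have "inverse (of_int c) \<in> R" by metis
  then show ?thesis using of_int_in_R c0 by (simp add: units_def)
qed

lemma of_int_decompose:
  assumes "c \<noteq> 0"
  shows "\<exists>e\<in>units. of_int c = of_nat p ^ multiplicity (int p) c * e"
proof -
  have "\<not> is_unit (int p)" using prime_p not_prime_unit by (metis int_dvd_int_iff of_nat_1)
  then obtain c' where c': "c = int p ^ multiplicity (int p) c * c'" "\<not> int p dvd c'"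
    using multiplicity_decompose'[OF assms] by metis
  have "of_int c = of_nat p ^ multiplicity (int p) c * (of_int c' :: complex)"
    using arg_cong[OF c'(1), of "of_int :: int \<Rightarrow> complex"] by simp
  then show ?thesis using of_int_in_units[OF c'(2)] by blast
qed

text \<open>One of the quotients x/y and y/x lies in \<open>R\<close>; if a/b does, then b divides a
  + b = b (a/b + 1) and inherits its invertibility.\<close>

lemma nonunit_add:
  assumes "x \<in> R" "y \<in> R" "x \<notin> units" "y \<notin> units"
  shows "x + y \<notin> units"
proof
  assume s: "x + y \<in> units"
  have *: "b \<in> units" if "a \<in> R" "b \<in> R" "a + b \<in> units" "b \<noteq> 0" "a / b \<in> R" for a b
  proof -
    have "a + b \<noteq> 0" using that(3) by (simp add: units_def)
    then have "inverse b = (a / b + 1) * inverse (a + b)" using that(4) by (simp add: field_simps)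
    also have "\<dots> \<in> R" using that closed by (auto simp: units_def)
    finally show ?thesis using that by (simp add: units_def)
  qed
  show False
  proof (cases "x = 0 \<or> y = 0")
    case True then show False using s assms(3,4) by auto
  next
    case False
    then show False using valuation_ring[of "x / y"] *[of x y] *[of y x] assms s by (auto simp: add.commute)
  qed
qed

lemma nonunit_sum: "(\<And>i. i \<in> S \<Longrightarrow> f i \<in> R \<and> f i \<notin> units) \<Longrightarrow> sum f S \<notin> units"
proof -
  assume "\<And>i. i \<in> S \<Longrightarrow> f i \<in> R \<and> f i \<notin> units"
  then have "sum f S \<in> R \<and> sum f S \<notin> units"
  proof (induction S rule: infinite_finite_induct)
    case (insert i S)
    then show ?case using nonunit_add[of "f i" "sum f S"] closed(6)[of "f i" "sum f S"] by simp
  qed (simp_all add: units_def closed(2))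
  then show ?thesis ..
qed

text \<open>Divisibility in a valuation ring is total, so a finite family has a member dividing all
  others: the term of least value.\<close>

lemma exists_divisor:
  assumes "finite S" "S \<noteq> {}" "0 \<notin> t ` S"
  shows "\<exists>m\<in>S. \<forall>i\<in>S. t i / t m \<in> R"
  using assms
proof (induction S rule: finite_ne_induct)
  case (singleton i)
  then show ?case using closed(1) by auto
next
  case (insert i S)
  then obtain m where m: "m \<in> S" "\<forall>j\<in>S. t j / t m \<in> R" by auto
  have nz: "t i \<noteq> 0" "t m \<noteq> 0" using insert.prems m(1) by (auto simp: image_iff)
  show ?case
  proof (cases "t i / t m \<in> R")
    case True
    then show ?thesis using m by auto
  next
    case False
    then have mi: "t m / t i \<in> R" using valuation_ring[of "t i / t m"] by simp
    have "t j / t i \<in> R" if "j \<in> S" for j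
    proof -
      have "t j / t i = t j / t m * (t m / t i)" using nz by simp
      then show ?thesis using m(2) that mi closed(4) by metis
    qed
    then show ?thesis using nz closed(1) by (intro bexI[of _ i]) auto
  qed
qed

text \<open>Encodes that x has value a/b when p has value 1. Fractions come from ramification,
  \<open>powi\<close> from values that may be negative.\<close>

definition value_rel :: "complex \<Rightarrow> int \<Rightarrow> nat \<Rightarrow> bool"
  where "value_rel x a b \<longleftrightarrow> b > 0 \<and> x ^ b / of_nat p powi a \<in> units"

text \<open>
  Two terms of an algebraic relation for \<open>x\<close> over \<open>\<int>\<close> must differ by a unit, so some power of \<open>x\<close> is a
  power of \<open>p\<close> up to units.
\<close>

lemma exists_value:
  assumes x: "x \<in> cyclo" "x \<noteq> 0"
  shows "\<exists>a b. value_rel x a b"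
proof -
  obtain B where B: "B \<noteq> 0" "ipoly_at x B = 0" using cyclo_algebraic[OF x(1)] .
  define S where "S = {i. i \<le> degree B \<and> coeff B i \<noteq> 0}"
  define t where "t = (\<lambda>i. of_int (coeff B i) * x ^ i)"
  have S: "finite S" "S \<noteq> {}" using B(1) by (auto simp: S_def intro!: exI[of _ "degree B"])
  have t0: "t i \<noteq> 0" if "i \<in> S" for i using that x(2) by (simp add: t_def S_def)
  obtain m where m: "m \<in> S" "\<And>i. i \<in> S \<Longrightarrow> t i / t m \<in> R" using exists_divisor[OF S, of t] t0 by (auto simp: image_iff)
  have "0 = (\<Sum>i\<le>degree B. t i)" using B(2) by (simp add: ipoly_at_def poly_altdef t_def)
  also have "\<dots> = sum t S" by (rule sum.mono_neutral_right) (auto simp: S_def t_def)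
  also have "\<dots> = t m + sum t (S - {m})" using S(1) m(1) by (rule sum.remove)
  finally have "sum t (S - {m}) = - t m" by (simp add: eq_neg_iff_add_eq_0 add.commute)
  \<comment> \<open>Were all these quotients nonunits, so would be their sum -1; hence some term
    differs from \<open>t m\<close> by a unit.\<close>
  then have "(\<Sum>i\<in>S - {m}. t i / t m) = - 1"
    using t0[OF m(1)] by (simp flip: sum_divide_distrib)
  moreover have "- 1 \<in> units" using closed(1,5) by (simp add: units_def)
  ultimately obtain i where i: "i \<in> S" "i \<noteq> m" "t i / t m \<in> units"
    using nonunit_sum[of "S - {m}" "\<lambda>i. t i / t m"] m(2) by auto
  have wlog: "\<exists>a b. value_rel x a b" if ij: "i < j" "i \<in> S" "j \<in> S" "t j / t i \<in> units" for i j
  proof -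
    define a b where "a = multiplicity (int p) (coeff B i)" and "b = multiplicity (int p) (coeff B j)"
    obtain e where e: "e \<in> units" "of_int (coeff B i) = of_nat p ^ a * e"
      using of_int_decompose ij(2) unfolding a_def S_def by blast
    obtain f where f: "f \<in> units" "of_int (coeff B j) = of_nat p ^ b * f"
      using of_int_decompose ij(3) unfolding b_def S_def by blast
    have nz: "e \<noteq> 0" "f \<noteq> 0" using e(1) f(1) by (auto simp: units_def)
    have "x ^ j = x ^ i * x ^ (j - i)" using ij(1) by (simp flip: power_add)
    then have "x ^ (j - i) / of_nat p powi (int a - int b) = t j / t i * (e / f)"
      using x(2) nz by (simp add: t_def e(2) f(2) power_int_diff divide_simps mult_ac)
    also have "\<dots> \<in> units" by (intro units_mult units_divide ij e f)
    finally show ?thesis using ij(1) unfolding value_rel_def by (intro exI[of _ "int a - int b"] exI[of _ "j - i"]) simp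
  qed
  consider "i < m" | "m < i" using i(2) by linarith
  then show ?thesis
  proof cases
    case 1
    then show ?thesis using wlog[of i m] i m(1) units_inverse[OF i(3)] by simp
  next
    case 2
    then show ?thesis using wlog[of m i] i m(1) by simp
  qed
qed

lemma p_powi_in_units: "of_nat p powi k \<in> units \<Longrightarrow> k = 0"
proof -
  have pos: "of_nat p powi k \<notin> units" if k: "k > 0" for k
  proof -
    have "of_nat p powi k = of_nat p ^ (nat k - 1) * (of_nat p :: complex)"
      using k by (simp add: power_int_def flip: power_Suc2)
    moreover have "of_nat p ^ (nat k - 1) * of_nat p \<in> I"
      using I_subset[OF p_in_I] p_in_I by (intro ideal_gen_mult[OF subring] class_subring_power[OF subring])
    ultimately show ?thesis using I_not_unit by metis
  qed
  assume k: "of_nat p powi k \<in> units"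
  then have "of_nat p powi (- k) \<in> units" using units_inverse by (simp add: power_int_minus)
  then show "k = 0" using pos[of k] pos[of "- k"] k by linarith
qed

lemma value_rel_unique:
  assumes "value_rel x a b" "value_rel x a' b'" "x \<noteq> 0"
  shows "of_int a / of_nat b = (of_int a' / of_nat b' :: real)"
proof -
  have "(x ^ b / of_nat p powi a) ^ b' \<in> units" "(x ^ b' / of_nat p powi a') ^ b \<in> units"
    using assms by (auto simp: value_rel_def intro: units_power)
  then have "(x ^ b' / of_nat p powi a') ^ b / (x ^ b / of_nat p powi a) ^ b' \<in> units" by (rule units_divide[rotated])
  also have "(x ^ b' / of_nat p powi a') ^ b / (x ^ b / of_nat p powi a) ^ b' = of_nat p powi (a * int b' - a' * int b)"
    using assms(3) by (simp add: power_divide power_int_diff power_int_mult mult.commute flip: power_mult)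
  finally have "a * int b' = a' * int b" using p_powi_in_units by fastforce
  then have "of_int a * of_nat b' = (of_int a' * of_nat b :: real)" by (metis of_int_mult of_int_of_nat_eq)
  then show ?thesis using assms by (simp add: value_rel_def frac_eq_eq)
qed

definition val :: "complex \<Rightarrow> real"
  where "val x = (SOME r. \<exists>a b. value_rel x a b \<and> r = of_int a / of_nat b)"

lemma val_eq:
  assumes "value_rel x a b" "x \<noteq> 0"
  shows "val x = of_int a / of_nat b"
proof -
  have "\<exists>r a b. value_rel x a b \<and> r = (of_int a / of_nat b :: real)" using assms(1) by blast
  then have "\<exists>a b. value_rel x a b \<and> val x = of_int a / of_nat b" unfolding val_def by (rule someI_ex)
  then show ?thesis using value_rel_unique assms by metis
qed

lemma val_mult:
  assumes "x \<in> cyclo" "x \<noteq> 0" "y \<in> cyclo" "y \<noteq> 0"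
  shows "val (x * y) = val x + val y"
proof -
  obtain a b where x: "value_rel x a b" using exists_value assms by blast
  obtain a' b' where y: "value_rel y a' b'" using exists_value assms by blast
  have b: "b > 0" "b' > 0" using x y by (auto simp: value_rel_def)
  have "(x * y) ^ (b * b') / of_nat p powi (a * int b' + a' * int b) =
      (x ^ b / of_nat p powi a) ^ b' * (y ^ b' / of_nat p powi a') ^ b"
    by (simp add: power_mult_distrib power_divide power_int_add power_int_mult mult.commute[of b'] flip: power_mult)
  also have "\<dots> \<in> units" using x y by (auto simp: value_rel_def intro!: units_mult units_power)
  finally have "value_rel (x * y) (a * int b' + a' * int b) (b * b')" using b by (simp add: value_rel_def)
  then show ?thesis using val_eq x y assms b by (simp add: add_divide_distrib mult.commute)
qed

lemma val_nonneg_iff: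
  assumes "x \<in> cyclo" "x \<noteq> 0"
  shows "0 \<le> val x \<longleftrightarrow> x \<in> R"
proof -
  obtain a b where x: "value_rel x a b" using exists_value assms by blast
  then have b: "b > 0" and u: "x ^ b / of_nat p powi a \<in> units" by (auto simp: value_rel_def)
  have "0 \<le> val x \<longleftrightarrow> 0 \<le> a" using b val_eq[OF x assms(2)] by (simp add: zero_le_divide_iff)
  also have "\<dots> \<longleftrightarrow> x \<in> R"
  proof
    assume a: "0 \<le> a"
    have "x ^ b = (x ^ b / of_nat p powi a) * of_nat p ^ nat a" using a by (simp add: power_int_def)
    also have "\<dots> \<in> R"
      using u unfolding units_def by (blast intro: closed(4) class_subring_power[OF subring] I_subset[OF p_in_I])
    finally have xb: "x ^ b \<in> R" .
    \<comment> \<open>Valuation rings are integrally closed: otherwise 1/x lies in \<open>R\<close>,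
      and so does x = x^b (1/x)^(b-1).\<close>
    show "x \<in> R"
    proof (rule ccontr)
      assume "x \<notin> R"
      then have "inverse x ^ (b - 1) \<in> R" using valuation_ring class_subring_power[OF subring] by blast
      then have "x ^ b * inverse x ^ (b - 1) \<in> R" using xb closed(4) by blast
      also have "x ^ b * inverse x ^ (b - 1) = x"
        using b assms(2) by (cases b) (auto simp: power_inverse)
      finally show False using \<open>x \<notin> R\<close> by simp
    qed
  next
    assume xR: "x \<in> R"
    show "0 \<le> a"
    proof (rule ccontr)
      assume a: "\<not> 0 \<le> a"
      then have "x ^ b / of_nat p powi a = x ^ b * of_nat p ^ (nat (- a) - 1) * of_nat p"
        by (simp add: power_int_def divide_inverse power_inverse mult.assoc flip: power_Suc2)
      also have "\<dots> \<in> I"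
        using xR I_subset[OF p_in_I] p_in_I
        by (intro ideal_gen_mult[OF subring] closed(4) class_subring_power[OF subring])
      finally show False using u I_not_unit by blast
    qed
  qed
  finally show ?thesis .
qed

lemma val_pos:
  assumes "x \<in> cyclo" "x \<noteq> 0" "x \<in> I"
  shows "0 < val x"
proof -
  obtain a b where x: "value_rel x a b" using exists_value assms by blast
  then have b: "b > 0" and u: "x ^ b / of_nat p powi a \<in> units" by (auto simp: value_rel_def)
  have "0 \<le> val x" using val_nonneg_iff assms I_subset by blast
  moreover have "a \<noteq> 0"
  proof
    assume "a = 0"
    then have "x ^ b \<in> units" using u by simp
    moreover have "x ^ (b - 1) * x \<in> I"
      using assms(3) I_subset by (intro ideal_gen_mult[OF subring] class_subring_power[OF subring])
    then have "x ^ b \<in> I" using b by (cases b) (auto simp: mult.commute)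
    ultimately show False using I_not_unit by blast
  qed
  then have "val x \<noteq> 0" using b val_eq[OF x assms(2)] by simp
  ultimately show ?thesis by simp
qed

lemma val_of_int: "c \<noteq> 0 \<Longrightarrow> val (of_int c) = real (multiplicity (int p) c)"
proof -
  assume c: "c \<noteq> 0"
  obtain e where e: "e \<in> units" "of_int c = of_nat p ^ multiplicity (int p) c * e" using of_int_decompose[OF c] by blast
  have "value_rel (of_int c) (int (multiplicity (int p) c)) 1"
    using e(1) by (simp add: value_rel_def e(2))
  then show ?thesis using val_eq c by fastforce
qed

definition extended_val :: "complex \<Rightarrow> ereal"
  where "extended_val x = (if x = 0 then \<infinity> else ereal (val x))"

lemma cyclo_valuation_extended_val: "cyclo_valuation p extended_val"
proof
  show "Factorial_Ring.prime p" by (rule prime_p)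
  fix x y assume x: "x \<in> cyclo"
  show "extended_val x \<noteq> - \<infinity>" "extended_val x = \<infinity> \<longleftrightarrow> x = 0" by (auto simp: extended_val_def)
  assume y: "y \<in> cyclo"
  show "extended_val (x * y) = extended_val x + extended_val y"
    using val_mult[OF x _ y] by (simp add: extended_val_def)
  \<comment> \<open>The sum is a (1 + b/a) with a the term of smaller value, and b/a lies in
    \<open>R\<close>.\<close>
  have ultra: "val a \<le> val (a + b)" if "a \<in> cyclo" "b \<in> cyclo" "a \<noteq> 0" "b \<noteq> 0" "a + b \<noteq> 0" "val a \<le> val b" for a b
  proof -
    have "val b = val (b / a) + val a" using val_mult[of "b / a" a] that by (simp add: cyclo_divide)
    then have "b / a \<in> R" using val_nonneg_iff[of "b / a"] that by (simp add: cyclo_divide)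
    then have "1 + b / a \<in> R" using closed(1,6) by blast
    moreover have nz: "1 + b / a \<noteq> 0" using that by (simp add: field_simps)
    moreover have cyc: "1 + b / a \<in> cyclo" using that by (intro cyclo_closed)
    ultimately have "0 \<le> val (1 + b / a)" using val_nonneg_iff by blast
    moreover have "a + b = (1 + b / a) * a" using that by (simp add: field_simps)
    ultimately show ?thesis using val_mult[OF cyc nz, of a] that by simp
  qed
  show "min (extended_val x) (extended_val y) \<le> extended_val (x + y)"
    using ultra[of x y] ultra[of y x] x y
    by (cases "val x \<le> val y") (auto simp: extended_val_def min_def add.commute)
next
  fix q
  show "extended_val (of_rat q) = padic_valuation p q"
  proof (cases "q = 0")
    case True
    then show ?thesis by (simp add: extended_val_def padic_valuation_def)
  next
    case False
    obtain a b where ab: "quotient_of q = (a, b)" by force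
    have b: "b > 0" and q: "q = of_int a / of_int b" using ab quotient_of_denom_pos quotient_of_div by blast+
    have a: "a \<noteq> 0" using False q by auto
    have "of_rat q * of_int b = (of_int a :: complex)" using b by (simp add: q of_rat_divide)
    then have "val (of_int a) = val (of_rat q) + val (of_int b)"
      using val_mult[of "of_rat q" "of_int b"] False b by (simp add: cyclo_of_rat cyclo_of_int)
    then show ?thesis using val_of_int[OF a] val_of_int[of b] b False ab
      by (simp add: extended_val_def padic_valuation_def)
  qed
qed

end

section \<open>Existence of the valuation\<close>

lemma ideal_gen_ideal_subset:
  assumes "0 \<in> M" "\<And>a b. a \<in> M \<Longrightarrow> b \<in> M \<Longrightarrow> a + b \<in> M" "\<And>a r. a \<in> M \<Longrightarrow> r \<in> R \<Longrightarrow> a * r \<in> M"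
    and "x \<in> ideal_gen M R"
  shows "x \<in> M"
  using assms(4) by (induction rule: ideal_gen.induct) (use assms(1-3) in auto)

lemma prime_elem_dvd_prodD:
  assumes "prime_elem q" "finite S" "q dvd prod f S"
  shows "\<exists>x\<in>S. q dvd f x"
  using assms(2,3)
proof (induction S)
  case empty
  then show ?case using prime_elem_not_unit[OF assms(1)] by simp
qed (auto simp: prime_elem_dvd_mult_iff[OF assms(1)])

text \<open>Modulo \<open>P\<close>, T has exact order N. For d at least 2 dividing N, t = T^(N/d)
  satisfies t^d = 1 but not t = 1, so the geometric sum in the factor of index d vanishes and the
  factor becomes d, a unit because p does not divide N.\<close>

lemma generator_not_dvd_killer:
  fixes P :: "'p::prime_card mod_ring poly"
  assumes P: "Factorial_Ring.irreducible P" "T_generates_mod P" and n: "degree P = n" "n > 0"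
  shows "\<not> P dvd of_int_poly (nonprimitive_killer (CARD('p) ^ n - 1))"
proof
  define N where "N = CARD('p) ^ n - 1"
  define T :: "'p mod_ring poly" where "T = [:0, 1:]"
  have prime: "prime_elem P" using P(1) by (rule irreducible_imp_prime_elem)
  have N: "N > 0" "coprime N CARD('p)"
    using zeta_order(1,2)[OF prime_card[where 'a = 'p] n(2)] by (simp_all add: N_def)
  have ord: "P dvd T ^ N - 1" "\<And>i. 0 < i \<Longrightarrow> i < N \<Longrightarrow> \<not> P dvd T ^ i - 1"
    using order_of_T_generator[OF P] n by (simp_all add: N_def T_def)
  assume "P dvd of_int_poly (nonprimitive_killer (CARD('p) ^ n - 1))"
  then have "P dvd (\<Prod>d | d dvd N \<and> 2 \<le> d. of_nat d - (\<Sum>j<d. T ^ (j * (N div d))))"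
    by (simp only: nonprimitive_killer_def of_int_poly_prod of_int_poly_sum red_hom
        of_int_poly_of_nat of_int_poly_monom T_def N_def)
  then have "\<exists>d\<in>{d. d dvd N \<and> 2 \<le> d}. P dvd of_nat d - (\<Sum>j<d. T ^ (j * (N div d)))"
    by (intro prime_elem_dvd_prodD[OF prime]) (use N(1) in simp)
  then obtain d where d: "d dvd N" "2 \<le> d" "P dvd of_nat d - (\<Sum>j<d. T ^ (j * (N div d)))" by blast
  define t where "t = T ^ (N div d)"
  have "N div d > 0" "N div d < N" using d(1,2) N(1) by (auto simp: dvd_def)
  then have "\<not> P dvd t - 1" using ord(2) by (simp add: t_def)
  moreover have "(t - 1) * (\<Sum>j<d. t ^ j) = T ^ N - 1"
  proof -
    have "t ^ d = T ^ N" unfolding t_def power_mult[symmetric] using d(1) by simp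
    then show ?thesis using power_diff_1_eq[of t d] by simp
  qed
  then have "P dvd (t - 1) * (\<Sum>j<d. t ^ j)" using ord(1) by simp
  ultimately have "P dvd (\<Sum>j<d. t ^ j)" using prime by (simp add: prime_elem_dvd_mult_iff)
  moreover have "(\<Sum>j<d. T ^ (j * (N div d))) = (\<Sum>j<d. t ^ j)"
    by (simp add: t_def mult.commute flip: power_mult)
  ultimately have "P dvd (of_nat d - (\<Sum>j<d. t ^ j)) + (\<Sum>j<d. t ^ j)" using d(3) by (intro dvd_add) simp_all
  then have "P dvd of_nat d" by simp
  moreover have "coprime d CARD('p)" using d(1) N(2) by (metis coprime_divisors dvd_refl)
  then have "is_unit (of_nat d :: 'p mod_ring poly)" by (rule of_nat_mod_ring_poly_unit)
  ultimately have "is_unit P" by (rule dvd_trans)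
  then show False using prime_elem_not_unit[OF prime] by blast
qed

locale primitive_seq =
  fixes P :: "nat \<Rightarrow> 'p::prime_card mod_ring poly" and p :: nat
  assumes card: "CARD('p) = p" and P: "P \<in> primitive_poly_seqs p"
begin

lemma prime_p: "Factorial_Ring.prime p"
  using prime_card[where 'a = 'p] card by simp

lemma P_props:
  assumes "n > 0"
  shows "degree (P n) = n" "monic (P n)" "Factorial_Ring.irreducible (P n)" "T_generates_mod (P n)"
proof -
  have "n \<ge> 1" using assms by simp
  then have "degree (P n) = n \<and> monic (P n) \<and> Factorial_Ring.irreducible (P n) \<and> T_generates_mod (P n)"
    using P unfolding primitive_poly_seqs_def by blast
  then show "degree (P n) = n" "monic (P n)" "Factorial_Ring.irreducible (P n)" "T_generates_mod (P n)"
    by blast+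
qed

text \<open>Makes the prescribed reduction of \<int>[\<zeta>] well defined. T^N - 1 divides A times
  \<open>nonprimitive_killer N\<close>; modulo p, \<open>P n\<close> divides T^N - 1 and is prime to
  the second factor.\<close>

lemma vanishing_imp_dvd:
  assumes n: "n > 0" and A: "ipoly_at (zcyc p n) A = 0"
  shows "P n dvd of_int_poly A"
proof -
  define N where "N = p ^ n - 1"
  have N: "N > 0" using zeta_order(1)[OF prime_p n] by (simp add: N_def)
  have prime: "prime_elem (P n)" using P_props(3)[OF n] by (rule irreducible_imp_prime_elem)
  have "unity_poly N dvd A * nonprimitive_killer N"
  proof (rule unity_poly_dvd_mult_killer[OF N])
    show "zcyc p n ^ N = 1" unfolding N_def by (rule zeta_order(3)[OF prime_p n])
    show "zcyc p n ^ i \<noteq> 1" if "0 < i" "i < N" for i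
      using root_unity_primitive[OF that] by (simp add: N_def)
  qed (rule A)
  then obtain Q where Q: "A * nonprimitive_killer N = unity_poly N * Q" by (auto simp: dvd_def)
  have "of_int_poly (unity_poly N) = ([:0, 1:] ^ N - 1 :: 'p mod_ring poly)"
    by (simp only: unity_poly_def red_hom of_int_poly_monom)
  then have "P n dvd of_int_poly (unity_poly N)"
    using order_of_T_generator(1)[OF P_props(3,4)[OF n]] by (simp only: card P_props(1)[OF n] N_def)
  then have "P n dvd of_int_poly (A * nonprimitive_killer N)" unfolding Q red_hom by (rule dvd_mult2)
  then have "P n dvd of_int_poly A \<or> P n dvd of_int_poly (nonprimitive_killer N)"
    unfolding red_hom using prime by (simp add: prime_elem_dvd_mult_iff)
  then show ?thesis
    using generator_not_dvd_killer[OF P_props(3,4,1)[OF n] n] by (simp add: card N_def)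
qed

text \<open>The compatibility of \<open>P m\<close> and \<open>P n\<close> enters here: substituting
  T^d moves an element from level m to level n without leaving the prescribed kernel.\<close>

lemma level_change:
  assumes m: "m > 0" and n: "n > 0" and mn: "m dvd n"
  shows "\<exists>B. ipoly_at (zcyc p n) B = ipoly_at (zcyc p m) A \<and>
    (P m dvd of_int_poly A \<longrightarrow> P n dvd of_int_poly B)"
proof (intro exI conjI impI)
  define d where "d = (p ^ n - 1) div (p ^ m - 1)"
  show "ipoly_at (zcyc p n) (pcompose A ([:0, 1:] ^ d)) = ipoly_at (zcyc p m) A"
    using zcyc_power(2)[OF prime_p m n mn] by (simp add: ipoly_at_pcompose d_def)
  assume "P m dvd of_int_poly A"
  then obtain g where g: "of_int_poly A = P m * g" by (auto simp: dvd_def)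
  have "P n dvd pcompose (P m) ([:0, 1:] ^ d)"
    using P n mn by (simp add: primitive_poly_seqs_def d_def)
  then show "P n dvd of_int_poly (pcompose A ([:0, 1:] ^ d))"
    by (simp only: of_int_poly_pcompose g red_hom pcompose_mult dvd_mult2)
qed

definition R0 :: "complex set"
  where "R0 = {ipoly_at (zcyc p n) A |n A. n > 0}"

definition M0 :: "complex set"
  where "M0 = {ipoly_at (zcyc p n) A |n A. n > 0 \<and> P n dvd of_int_poly A}"

lemma R0_I: "n > 0 \<Longrightarrow> ipoly_at (zcyc p n) A \<in> R0"
  and M0_I: "n > 0 \<Longrightarrow> P n dvd of_int_poly A \<Longrightarrow> ipoly_at (zcyc p n) A \<in> M0"
  by (auto simp: R0_def M0_def)

text \<open>The product of two levels is a common multiple. Membership in \<open>M0\<close> only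
  asserts that some representation is divisible, so such a representation is chosen before the
  levels are merged.\<close>

lemma common_level:
  assumes "x \<in> R0" "y \<in> R0"
  obtains n A B where "n > 0" "x = ipoly_at (zcyc p n) A" "y = ipoly_at (zcyc p n) B"
    "x \<in> M0 \<Longrightarrow> P n dvd of_int_poly A" "y \<in> M0 \<Longrightarrow> P n dvd of_int_poly B"
proof -
  have rep: "\<exists>m>0. \<exists>A. x = ipoly_at (zcyc p m) A \<and> (x \<in> M0 \<longrightarrow> P m dvd of_int_poly A)" if "x \<in> R0" for x
    using that by (cases "x \<in> M0") (auto simp: R0_def M0_def)
  obtain m A where m: "m > 0" "x = ipoly_at (zcyc p m) A" "x \<in> M0 \<longrightarrow> P m dvd of_int_poly A"
    using rep[OF assms(1)] by blast
  obtain l B where l: "l > 0" "y = ipoly_at (zcyc p l) B" "y \<in> M0 \<longrightarrow> P l dvd of_int_poly B"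
    using rep[OF assms(2)] by blast
  have n: "m * l > 0" using m l by simp
  obtain A' where "ipoly_at (zcyc p (m * l)) A' = x" "x \<in> M0 \<longrightarrow> P (m * l) dvd of_int_poly A'"
    using level_change[OF m(1) n, of A] m by auto
  moreover obtain B' where "ipoly_at (zcyc p (m * l)) B' = y" "y \<in> M0 \<longrightarrow> P (m * l) dvd of_int_poly B'"
    using level_change[OF l(1) n, of B] l by auto
  ultimately show ?thesis using that[OF n] by metis
qed

lemma M0_subset: "M0 \<subseteq> R0"
  by (auto simp: M0_def R0_def)

lemma subring_R0: "class_subring R0"
  unfolding class_subring_def
proof (intro conjI ballI)
  show "1 \<in> R0" using R0_I[of 1 1] by simp
  fix x y assume "x \<in> R0" "y \<in> R0"
  then obtain n A B where "n > 0" "x = ipoly_at (zcyc p n) A" "y = ipoly_at (zcyc p n) B" by (rule common_level)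
  then show "x - y \<in> R0" "x * y \<in> R0" using R0_I[of n "A - B"] R0_I[of n "A * B"] by auto
qed

text \<open>\<open>M0\<close> is already an ideal of \<open>R0\<close>, so 1 would equal A(\<zeta>)
  with \<open>P n\<close> dividing A modulo p; as A - 1 vanishes at \<zeta>, \<open>P n\<close>
  divides A - 1 too, hence 1.\<close>

lemma M0_proper: "1 \<notin> ideal_gen M0 R0"
proof
  assume "1 \<in> ideal_gen M0 R0"
  have "1 \<in> M0"
  proof (rule ideal_gen_ideal_subset[OF _ _ _ \<open>1 \<in> ideal_gen M0 R0\<close>])
    show "0 \<in> M0" using M0_I[of 1 0] by simp
    fix a b assume ab: "a \<in> M0"
    {
      assume b: "b \<in> M0"
      obtain n A B where "n > 0" "a = ipoly_at (zcyc p n) A" "b = ipoly_at (zcyc p n) B"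
        "P n dvd of_int_poly A" "P n dvd of_int_poly B"
        using common_level[of a b] ab b M0_subset by blast
      then show "a + b \<in> M0" using M0_I[of n "A + B"] by (simp add: red_hom)
    }
    assume b: "b \<in> R0"
    obtain n A B where "n > 0" "a = ipoly_at (zcyc p n) A" "b = ipoly_at (zcyc p n) B" "P n dvd of_int_poly A"
      using common_level[of a b] ab b M0_subset by blast
    then show "a * b \<in> M0" using M0_I[of n "A * B"] by (simp add: red_hom)
  qed
  then obtain n A where n: "n > 0" "1 = ipoly_at (zcyc p n) A" "P n dvd of_int_poly A" by (auto simp: M0_def)
  then have "ipoly_at (zcyc p n) (A - 1) = 0" by simp
  then have "P n dvd of_int_poly (A - 1)" by (rule vanishing_imp_dvd[OF n(1)])
  then have 1: "P n dvd of_int_poly A - 1" by (simp only: red_hom)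
  have "P n dvd of_int_poly A - (of_int_poly A - 1)" by (rule dvd_diff[OF n(3) 1])
  also have "of_int_poly A - (of_int_poly A - 1) = (1 :: 'p mod_ring poly)" by simp
  finally show False using P_props(3)[OF n(1)] Factorial_Ring.irreducible_not_unit by blast
qed

lemma p_in_M0: "of_nat p \<in> M0"
proof -
  have "of_int_poly (of_nat p) = (0 :: 'p mod_ring poly)"
    using red_eq_0_iff[where 'p = 'p, of "of_nat p"] card by (metis mult_1_right)
  then show ?thesis using M0_I[of 1 "of_nat p"] by simp
qed

text \<open>It is enough that a lift of \<open>P n\<close> has positive value at the root of unity:
  the polynomial attached to the valuation then divides \<open>P n\<close>, and both are monic of
  degree n.\<close>

lemma exists_valuation: "\<exists>v\<in>Val p. char_poly_seq p v = P"
proof -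
  obtain R where R: "R0 \<subseteq> R" "maximal_subring M0 R"
    using exists_maximal_subring[OF subring_R0 M0_subset M0_proper] .
  interpret maximal_subring_over M0 R p
    by (rule maximal_subring_over.intro[OF R(2)]) (unfold_locales, rule prime_p, rule p_in_M0)
  define v where "v = (\<lambda>x\<in>carrier Qcyc. extended_val (qcyc_embed x))"
  have v_of: "v (qcyc_of x) = extended_val x" if "x \<in> cyclo" for x using that by (simp add: v_def)
  interpret w: cyclo_valuation p extended_val by (rule cyclo_valuation_extended_val)
  have "cyclo_valuation p (\<lambda>x. v (qcyc_of x))"
    by unfold_locales (auto simp: v_of cyclo_mult cyclo_add cyclo_of_rat prime_p
        w.not_MInf w.PInf_iff w.mult w.min_le_add w.of_rat)
  then have v: "v \<in> Val p" unfolding Val_iff[OF prime_p] by (simp add: v_def)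
  have "char_poly_seq p v n = P n" if n: "n > 0" for n
  proof -
    define x where "x = ipoly_at (zcyc p n) (lift_poly (P n))"
    have "x \<in> M0" unfolding x_def by (rule M0_I[OF n]) simp
    then have "x \<in> I" by (rule ideal_gen_base[OF subring])
    moreover have cyc: "x \<in> cyclo" by (simp add: x_def cyclo_ipoly_at cyclo_root_unity)
    ultimately have "0 < extended_val x" using val_pos[of x] by (auto simp: extended_val_def)
    then have "0 < v (qcyc_of x)" using v_of[OF cyc] by simp
    then have "char_poly_seq p v n dvd P n"
      using char_poly_seq_props(5)[OF card v n, of "lift_poly (P n)"] by (simp add: x_def)
    then show ?thesis
      using char_poly_seq_props(1,2)[OF card v n] P_props(1,2)[OF n] by (intro monic_dvd_degree_eq) auto
  qed
  \<comment> \<open>At index 0 both sequences take the default value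
    \<open>undefined\<close>.\<close>
  moreover have "char_poly_seq p v n = P n" if "\<not> n > 0" for n
    using that P by (simp add: char_poly_seq_def primitive_poly_seqs_def extensional_def)
  ultimately have "char_poly_seq p v = P" by blast
  then show ?thesis using v by blast
qed

end

lemma char_poly_seq_inj:
  assumes p: "CARD('p::prime_card) = p" and v: "v \<in> Val p" "v' \<in> Val p"
    and eq: "char_poly_seq p v = (char_poly_seq p v' :: nat \<Rightarrow> 'p mod_ring poly)"
  shows "v = v'"
proof -
  have prime: "Factorial_Ring.prime p" using prime_card[where 'a = 'p] p by simp
  define P where "P = (char_poly_seq p v :: nat \<Rightarrow> 'p mod_ring poly)"
  interpret w: cyclo_valuation p "\<lambda>x. v (qcyc_of x)" using v(1) Val_iff[OF prime] by blast
  interpret w': cyclo_valuation p "\<lambda>x. v' (qcyc_of x)" using v(2) Val_iff[OF prime] by blast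
  interpret valuation_pair p "\<lambda>x. v (qcyc_of x)" "\<lambda>x. v' (qcyc_of x)" P
    by unfold_locales (use p char_poly_seq_props(3,5)[OF p v(1)] char_poly_seq_props(5)[OF p v(2)] in
      \<open>simp_all add: P_def eq\<close>)
  show ?thesis
  proof (rule extensionalityI)
    show "v \<in> extensional (carrier Qcyc)" "v' \<in> extensional (carrier Qcyc)" using v by (simp_all add: Val_def)
    fix x assume "x \<in> carrier Qcyc"
    then show "v x = v' x" using valuation_eq[of "qcyc_embed x"] by simp
  qed
qed

theorem theorem8p7:
  fixes p :: nat
  assumes "CARD('p::prime_card) = p"
  shows "bij_betw (char_poly_seq p :: (qcyc \<Rightarrow> ereal) \<Rightarrow> nat \<Rightarrow> 'p mod_ring poly)
           (Val p) (primitive_poly_seqs p)"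
  unfolding bij_betw_def
proof
  show "inj_on (char_poly_seq p :: (qcyc \<Rightarrow> ereal) \<Rightarrow> nat \<Rightarrow> 'p mod_ring poly) (Val p)"
    by (rule inj_onI) (rule char_poly_seq_inj[OF assms])
  show "(char_poly_seq p :: (qcyc \<Rightarrow> ereal) \<Rightarrow> nat \<Rightarrow> 'p mod_ring poly) ` Val p = primitive_poly_seqs p"
  proof
    show "(char_poly_seq p :: (qcyc \<Rightarrow> ereal) \<Rightarrow> nat \<Rightarrow> 'p mod_ring poly) ` Val p \<subseteq> primitive_poly_seqs p"
      using char_poly_seq_in_primitive_poly_seqs[OF assms] by blast
    show "primitive_poly_seqs p \<subseteq> (char_poly_seq p :: (qcyc \<Rightarrow> ereal) \<Rightarrow> nat \<Rightarrow> 'p mod_ring poly) ` Val p"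
    proof
      fix P :: "nat \<Rightarrow> 'p mod_ring poly" assume "P \<in> primitive_poly_seqs p"
      then interpret primitive_seq P p using assms by unfold_locales
      show "P \<in> char_poly_seq p ` Val p" using exists_valuation by blast
    qed
  qed
qed

end
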